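(* Let $(M,g)$ and $(\hat M,\hat g)$ be semi-Riemannian manifolds of equal (arbitrary) index and equal dimension $n\ge 2$, let $p\in M$, $\hat p\in\hat M$, let $\hat\imath:T_pM\to T_{\hat p}\hat M$ be a linear isometry, let $V$ be a normal neighborhood of $p$ small enough that $\hat F=\exp_{\hat p}\circ\,\hat\imath\circ(\exp_p|_{\overline{V}})^{-1}$ is defined on $V$ and maps it onto a normal neighborhood $\hat V$ of $\hat p$. Assume that $$\mathrm{Ric}(\xi,\xi)>\widehat{\mathrm{Ric}}(\hat\xi,\hat\xi)\qquad(\text{resp. } \mathrm{Ric}(\xi,\xi)<\widehat{\mathrm{Ric}}(\hat\xi,\hat\xi))$$ for some unit $\xi\in T_pM$ (i.e. $g(\xi,\xi)=\pm1$), where $\hat\xi=d\hat F_p(\xi)=\hat\imath(\xi)$. Then there exist arbitrarily small normal neighborhoods $W$ of $p$ (i.e. every neighborhood of $p$ contains such a $W\subset V$) such that $$\mathrm{vol}(W)<\mathrm{vol}(\hat W)\qquad(\text{resp. } \mathrm{vol}(W)>\mathrm{vol}(\hat W)),$$ where $\hat W=\hat F(W)$.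
   Context: A neighborhood $V$ of $p$ is normal if $V=\exp_p(\overline{V})$, where $\overline{V}\subset T_pM$ (the bar is only notation, not closure) is a neighborhood of $0_p$ starshaped from $0_p$ and $\exp_p:\overline{V}\to V$ is a diffeomorphism. $\mathrm{Ric}$, $\widehat{\mathrm{Ric}}$ are the Ricci tensors of $g$, $\hat g$, with $\mathrm{Ric}(v,v)=\mathrm{trace}\,(x\mapsto R(x,v)v)$, $R(X,Y)=[\nabla_X,\nabla_Y]-\nabla_{[X,Y]}$. Volumes are with respect to the metric volume measures. *)

theory Defs
  imports "HOL-Analysis.Analysis"
begin

section \<open>Smooth maps between open subsets of Euclidean spaces\<close>

(* Both predicates are meant for open S. *)
primrec Ck_on :: "nat \<Rightarrow> 'e::euclidean_space set \<Rightarrow> ('e \<Rightarrow> 'f::real_normed_vector) \<Rightarrow> bool" where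
  "Ck_on 0 S f \<longleftrightarrow> continuous_on S f"
| "Ck_on (Suc k) S f \<longleftrightarrow>
     (\<forall>x\<in>S. f differentiable (at x)) \<and>
     (\<forall>v. Ck_on k S (\<lambda>x. frechet_derivative f (at x) v))"

definition smooth_on :: "'e::euclidean_space set \<Rightarrow> ('e \<Rightarrow> 'f::real_normed_vector) \<Rightarrow> bool" where
  "smooth_on S f \<longleftrightarrow> (\<forall>k. Ck_on k S f)"


section \<open>Smooth manifolds and tangent spaces\<close>

(* A chart (U, f) has domain U and coordinate map f; values of f outside U are irrelevant.
   A manifold is a (not necessarily maximal) smooth atlas on a Hausdorff, second countable
   type; its dimension is CARD('n). *)
type_synonym ('a, 'n) chart = "'a set \<times> ('a \<Rightarrow> real ^ 'n)"

definition chart_inv :: "('a, 'n) chart \<Rightarrow> real ^ 'n \<Rightarrow> 'a" where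
  "chart_inv c = inv_into (fst c) (snd c)"

definition is_chart :: "('a::topological_space, 'n::finite) chart \<Rightarrow> bool" where
  "is_chart c \<longleftrightarrow> open (fst c) \<and> open (snd c ` fst c) \<and>
     homeomorphism (fst c) (snd c ` fst c) (snd c) (chart_inv c)"

definition smooth_manifold ::
  "('a::{t2_space, second_countable_topology}, 'n::finite) chart set \<Rightarrow> bool" where
  "smooth_manifold M \<longleftrightarrow>
     (\<forall>c\<in>M. is_chart c) \<and>
     (\<Union>c\<in>M. fst c) = UNIV \<and>
     (\<forall>c\<in>M. \<forall>d\<in>M. smooth_on (snd c ` (fst c \<inter> fst d)) (snd d \<circ> chart_inv c))"

(* The tangent space at p is real ^ 'n, a vector being given by its components with respect
   to the coordinate basis of the preferred chart chart_at M p. *)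
definition chart_at :: "('a, 'n) chart set \<Rightarrow> 'a \<Rightarrow> ('a, 'n) chart" where
  "chart_at M p = (SOME c. c \<in> M \<and> p \<in> fst c)"

(* The element of the tangent space at q whose components in the chart c around q are v. *)
definition from_chart ::
  "('a, 'n::finite) chart set \<Rightarrow> ('a, 'n) chart \<Rightarrow> 'a \<Rightarrow> real ^ 'n \<Rightarrow> real ^ 'n" where
  "from_chart M c q v =
     frechet_derivative (snd (chart_at M q) \<circ> chart_inv c) (at (snd c q)) v"

(* Smoothness of a map from an open set S of a tangent space into a manifold, and of a map
   from an open set V of a manifold into a tangent space. *)
definition smooth_into ::
  "('a, 'n::finite) chart set \<Rightarrow> (real ^ 'n) set \<Rightarrow> (real ^ 'n \<Rightarrow> 'a::topological_space) \<Rightarrow> bool" where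
  "smooth_into M S f \<longleftrightarrow> continuous_on S f \<and>
     (\<forall>c\<in>M. smooth_on (S \<inter> f -` fst c) (snd c \<circ> f))"

definition smooth_from ::
  "('a, 'n::finite) chart set \<Rightarrow> 'a set \<Rightarrow> ('a \<Rightarrow> real ^ 'n) \<Rightarrow> bool" where
  "smooth_from M V h \<longleftrightarrow>
     (\<forall>c\<in>M. smooth_on (snd c ` (fst c \<inter> V)) (h \<circ> chart_inv c))"

definition diffeo_onto ::
  "('a::topological_space, 'n::finite) chart set \<Rightarrow> (real ^ 'n) set \<Rightarrow> 'a set \<Rightarrow> (real ^ 'n \<Rightarrow> 'a) \<Rightarrow> bool" where
  "diffeo_onto M S V f \<longleftrightarrow> open S \<and> open V \<and> bij_betw f S V \<and>
     smooth_into M S f \<and> smooth_from M V (inv_into S f)"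


section \<open>Semi-Riemannian metrics\<close>

type_synonym ('a, 'n) tensor2 = "'a \<Rightarrow> real ^ 'n \<Rightarrow> real ^ 'n \<Rightarrow> real"

definition nondegenerate :: "('v::real_vector \<Rightarrow> 'v \<Rightarrow> real) \<Rightarrow> bool" where
  "nondegenerate b \<longleftrightarrow> (\<forall>v. (\<forall>w. b v w = 0) \<longrightarrow> v = 0)"

definition form_index :: "('v::euclidean_space \<Rightarrow> 'v \<Rightarrow> real) \<Rightarrow> nat" where
  "form_index b = Max {dim W |W. subspace W \<and> (\<forall>w\<in>W. w \<noteq> 0 \<longrightarrow> b w w < 0)}"

(* The component matrix of g in the chart c, as a function of the coordinates. *)
definition gram ::
  "('a, 'n::finite) chart set \<Rightarrow> ('a, 'n) tensor2 \<Rightarrow> ('a, 'n) chart \<Rightarrow> real ^ 'n \<Rightarrow> real ^ 'n ^ 'n" where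
  "gram M g c x = (let q = chart_inv c x in
     \<chi> i j. g q (from_chart M c q (axis i 1)) (from_chart M c q (axis j 1)))"

definition semi_riemannian ::
  "nat \<Rightarrow> ('a::{t2_space, second_countable_topology}, 'n::finite) chart set \<Rightarrow> ('a, 'n) tensor2 \<Rightarrow> bool" where
  "semi_riemannian \<nu> M g \<longleftrightarrow> smooth_manifold M \<and>
     (\<forall>p. bilinear (g p) \<and> (\<forall>v w. g p v w = g p w v) \<and>
          nondegenerate (g p) \<and> form_index (g p) = \<nu>) \<and>
     (\<forall>c\<in>M. smooth_on (snd c ` fst c) (gram M g c))"

definition linear_isometry ::
  "('v::real_vector \<Rightarrow> 'v \<Rightarrow> real) \<Rightarrow> ('w::real_vector \<Rightarrow> 'w \<Rightarrow> real) \<Rightarrow> ('v \<Rightarrow> 'w) \<Rightarrow> bool" where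
  "linear_isometry b b' L \<longleftrightarrow> linear L \<and> bij L \<and> (\<forall>v w. b' (L v) (L w) = b v w)"


section \<open>Levi-Civita connection and curvature in coordinates\<close>

(* G is the component matrix of a metric on an open subset of real ^ 'n; the value
   christoffel G x k i j is the symbol with upper index k and lower indices i, j. *)

definition partial :: "'n::finite \<Rightarrow> (real ^ 'n \<Rightarrow> real) \<Rightarrow> real ^ 'n \<Rightarrow> real" where
  "partial i f x = frechet_derivative f (at x) (axis i 1)"

definition christoffel ::
  "(real ^ 'n \<Rightarrow> real ^ 'n ^ 'n) \<Rightarrow> real ^ 'n \<Rightarrow> 'n::finite \<Rightarrow> 'n \<Rightarrow> 'n \<Rightarrow> real" where
  "christoffel G x k i j = (1/2) * (\<Sum>m\<in>UNIV. matrix_inv (G x) $ k $ m *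
     (partial i (\<lambda>y. G y $ j $ m) x + partial j (\<lambda>y. G y $ i $ m) x
        - partial m (\<lambda>y. G y $ i $ j) x))"

definition christoffel_form ::
  "(real ^ 'n \<Rightarrow> real ^ 'n ^ 'n) \<Rightarrow> real ^ 'n \<Rightarrow> real ^ 'n \<Rightarrow> real ^ 'n \<Rightarrow> real ^ 'n::finite" where
  "christoffel_form G x v w =
     (\<chi> k. \<Sum>i\<in>UNIV. \<Sum>j\<in>UNIV. christoffel G x k i j * v $ i * w $ j)"

definition nabla ::
  "(real ^ 'n \<Rightarrow> real ^ 'n ^ 'n) \<Rightarrow> (real ^ 'n \<Rightarrow> real ^ 'n) \<Rightarrow> (real ^ 'n \<Rightarrow> real ^ 'n)
     \<Rightarrow> real ^ 'n \<Rightarrow> real ^ 'n::finite" where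
  "nabla G X Y x = frechet_derivative Y (at x) (X x) + christoffel_form G x (X x) (Y x)"

definition lie_bracket ::
  "(real ^ 'n \<Rightarrow> real ^ 'n) \<Rightarrow> (real ^ 'n \<Rightarrow> real ^ 'n) \<Rightarrow> real ^ 'n \<Rightarrow> real ^ 'n::finite" where
  "lie_bracket X Y x = frechet_derivative Y (at x) (X x) - frechet_derivative X (at x) (Y x)"

definition riemann ::
  "(real ^ 'n \<Rightarrow> real ^ 'n ^ 'n) \<Rightarrow> (real ^ 'n \<Rightarrow> real ^ 'n) \<Rightarrow> (real ^ 'n \<Rightarrow> real ^ 'n)
     \<Rightarrow> (real ^ 'n \<Rightarrow> real ^ 'n) \<Rightarrow> real ^ 'n \<Rightarrow> real ^ 'n::finite" where
  "riemann G X Y Z x =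
     nabla G X (nabla G Y Z) x - nabla G Y (nabla G X Z) x - nabla G (lie_bracket X Y) Z x"

(* R is tensorial, so its value on tangent vectors at p may be computed from any extensions
   to vector fields; here they have constant components in the chart chart_at M p. *)
definition curvature ::
  "('a, 'n::finite) chart set \<Rightarrow> ('a, 'n) tensor2 \<Rightarrow> 'a
     \<Rightarrow> real ^ 'n \<Rightarrow> real ^ 'n \<Rightarrow> real ^ 'n \<Rightarrow> real ^ 'n" where
  "curvature M g p x y z =
     riemann (gram M g (chart_at M p)) (\<lambda>_. x) (\<lambda>_. y) (\<lambda>_. z) (snd (chart_at M p) p)"

definition ricci ::
  "('a, 'n::finite) chart set \<Rightarrow> ('a, 'n) tensor2 \<Rightarrow> 'a \<Rightarrow> real ^ 'n \<Rightarrow> real ^ 'n \<Rightarrow> real" where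
  "ricci M g p v w = trace (matrix (\<lambda>x. curvature M g p x v w))"


section \<open>Geodesics, exponential map, normal neighborhoods\<close>

definition geodesic_on ::
  "('a::topological_space, 'n::finite) chart set \<Rightarrow> ('a, 'n) tensor2 \<Rightarrow> real set \<Rightarrow> (real \<Rightarrow> 'a) \<Rightarrow> bool" where
  "geodesic_on M g I \<gamma> \<longleftrightarrow> open I \<and> is_interval I \<and> continuous_on I \<gamma> \<and>
     (\<forall>c\<in>M. smooth_on (I \<inter> \<gamma> -` fst c) (snd c \<circ> \<gamma>) \<and>
        (\<forall>t \<in> I \<inter> \<gamma> -` fst c.
           let x = snd c \<circ> \<gamma>; x' = (\<lambda>s. vector_derivative x (at s))
           in vector_derivative x' (at t)
                + christoffel_form (gram M g c) (x t) (x' t) (x' t) = 0))"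

definition geodesic_from ::
  "('a::topological_space, 'n::finite) chart set \<Rightarrow> ('a, 'n) tensor2 \<Rightarrow> 'a \<Rightarrow> real ^ 'n
     \<Rightarrow> real set \<Rightarrow> (real \<Rightarrow> 'a) \<Rightarrow> bool" where
  "geodesic_from M g p v I \<gamma> \<longleftrightarrow> geodesic_on M g I \<gamma> \<and> 0 \<in> I \<and> \<gamma> 0 = p \<and>
     vector_derivative (snd (chart_at M p) \<circ> \<gamma>) (at 0) = v"

definition exp_dom ::
  "('a::topological_space, 'n::finite) chart set \<Rightarrow> ('a, 'n) tensor2 \<Rightarrow> 'a \<Rightarrow> (real ^ 'n) set" where
  "exp_dom M g p = {v. \<exists>I \<gamma>. geodesic_from M g p v I \<gamma> \<and> 1 \<in> I}"

definition exp_map ::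
  "('a::topological_space, 'n::finite) chart set \<Rightarrow> ('a, 'n) tensor2 \<Rightarrow> 'a \<Rightarrow> real ^ 'n \<Rightarrow> 'a" where
  "exp_map M g p v = (THE q. \<exists>I \<gamma>. geodesic_from M g p v I \<gamma> \<and> 1 \<in> I \<and> q = \<gamma> 1)"

(* V is a normal neighborhood of p, being the diffeomorphic image under exp_map of the
   starshaped open set Vb; the set Vb is determined by V. *)
definition normal_nbhd_via ::
  "('a::topological_space, 'n::finite) chart set \<Rightarrow> ('a, 'n) tensor2 \<Rightarrow> 'a
     \<Rightarrow> (real ^ 'n) set \<Rightarrow> 'a set \<Rightarrow> bool" where
  "normal_nbhd_via M g p Vb V \<longleftrightarrow> 0 \<in> Vb \<and> (\<forall>v\<in>Vb. closed_segment 0 v \<subseteq> Vb) \<and>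
     Vb \<subseteq> exp_dom M g p \<and> diffeo_onto M Vb V (exp_map M g p)"

definition normal_nbhd ::
  "('a::topological_space, 'n::finite) chart set \<Rightarrow> ('a, 'n) tensor2 \<Rightarrow> 'a \<Rightarrow> 'a set \<Rightarrow> bool" where
  "normal_nbhd M g p V \<longleftrightarrow> (\<exists>Vb. normal_nbhd_via M g p Vb V)"

definition geodesic_transfer ::
  "('a::topological_space, 'n::finite) chart set \<Rightarrow> ('a, 'n) tensor2 \<Rightarrow> 'a \<Rightarrow> (real ^ 'n) set
     \<Rightarrow> (real ^ 'n \<Rightarrow> real ^ 'm)
     \<Rightarrow> ('b::topological_space, 'm::finite) chart set \<Rightarrow> ('b, 'm) tensor2 \<Rightarrow> 'b \<Rightarrow> 'a \<Rightarrow> 'b" where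
  "geodesic_transfer M g p Vb L M' g' p' =
     exp_map M' g' p' \<circ> L \<circ> inv_into Vb (exp_map M g p)"


section \<open>Metric volume\<close>

(* The unique Borel measure given by sqrt |det g_ij| dx in every chart. *)
definition volume_measure ::
  "('a::topological_space, 'n::finite) chart set \<Rightarrow> ('a, 'n) tensor2 \<Rightarrow> 'a measure" where
  "volume_measure M g = (THE \<mu>. sets \<mu> = sets borel \<and>
     (\<forall>c\<in>M. \<forall>A\<in>sets borel. A \<subseteq> fst c \<longrightarrow>
        emeasure \<mu> A =
          (\<integral>\<^sup>+x\<in>snd c ` A. ennreal (sqrt \<bar>det (gram M g c x)\<bar>) \<partial>lborel)))"

abbreviation vol ::
  "('a::topological_space, 'n::finite) chart set \<Rightarrow> ('a, 'n) tensor2 \<Rightarrow> 'a set \<Rightarrow> ennreal" where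
  "vol M g W \<equiv> emeasure (volume_measure M g) W"

end

theory Submission
  imports Defs
begin

text \<open>
  Let \<open>\<rho>\<close> be the density of the metric volume in the coordinates of the tangent space given by the
  exponential map. The geodesic equation along radial geodesics determines the 3-jet of the exponential
  map at \<open>0\<close> in terms of the Christoffel symbols, and this yields
  \<open>\<rho>(v)\<^sup>2 = \<rho>(0)\<^sup>2 (1 - Ric(v, v) / 3 + o(|v|\<^sup>2))\<close>. Both volumes become integrals over the same
  subset of the tangent space at \<open>p\<close> with integrands agreeing to first order at \<open>0\<close>; the second order
  terms in the direction \<open>\<xi>\<close> are ordered by assumption, hence the integrands are ordered on a thin cone
  around \<open>\<xi>\<close>. Adding a tiny ball around \<open>0\<close> makes the cone a starshaped neighbourhood without
  changing the strict inequality of the integrals.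
\<close>

section \<open>Calculus of \<open>Ck\<close> maps\<close>

text \<open>The squared density is differentiated instead of the density: it needs no absolute
  values or roots and keeps the sign of \<open>det G\<close>, which cancels once everything is
  divided by the value at 0, so every index is treated alike. Along a ray its logarithmic derivative
  is twice a sum of two traces, one from the metric and one from the Jacobian. They cancel at 0, so
  the densities are critical there and Ricci curvature is the leading term. The radial equation
  gives the third derivative of the exponential map only on the diagonal (v, v, v), while the trace
  needs (v, v, w); polarization fills this gap. Smoothness of the exponential map is part of the
  notion of a normal neighbourhood, so dependence of solutions on initial data is never studied. But
  \<open>exp_map\<close> and \<open>volume_measure\<close> are definite descriptions: before either
  can be computed, uniqueness of slow geodesics and existence and uniqueness of a measure glued from
  charts have to be established. The linear isometry pulls the second density back to the tangent
  space at \<open>p\<close> and makes the two values at 0 equal.\<close>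

abbreviation dird :: "('e::euclidean_space \<Rightarrow> 'f::real_normed_vector) \<Rightarrow> 'e \<Rightarrow> 'e \<Rightarrow> 'f" where
  "dird f v \<equiv> (\<lambda>x. frechet_derivative f (at x) v)"

lemma has_derivative_dird:
  "f differentiable (at x) \<Longrightarrow> (f has_derivative (\<lambda>v. dird f v x)) (at x)"
  using frechet_derivative_works by (metis eta_contract_eq)

lemma dird_eq: "(f has_derivative f') (at x) \<Longrightarrow> dird f v x = f' v"
  using frechet_derivative_at by metis

lemma dird_cong_open:
  assumes "open S" "x \<in> S" "\<And>y. y \<in> S \<Longrightarrow> f y = g y" "f differentiable (at x)"
  shows "dird f v x = dird g v x" "g differentiable (at x)"
proof -
  have "(g has_derivative (\<lambda>v. dird f v x)) (at x)"
    using has_derivative_transform_within_open[OF has_derivative_dird[OF assms(4)] assms(1,2)] assms(3)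
    by blast
  then show "dird f v x = dird g v x" "g differentiable (at x)"
    by (auto simp: dird_eq differentiable_def)
qed

lemma Ck_on_cong:
  assumes "open S" "\<And>x. x \<in> S \<Longrightarrow> f x = g x" "Ck_on k S f"
  shows "Ck_on k S g"
  using assms(2,3)
proof (induction k arbitrary: f g)
  case 0
  then show ?case by (simp cong: continuous_on_cong)
next
  case (Suc k)
  have d: "\<And>x. x \<in> S \<Longrightarrow> f differentiable (at x)" using Suc.prems by simp
  have "Ck_on k S (dird g v)" for v
    using Suc.IH[of "dird f v" "dird g v"] Suc.prems dird_cong_open(1)[OF \<open>open S\<close> _ Suc.prems(1) d]
    by auto
  then show ?case
    using dird_cong_open(2)[OF \<open>open S\<close> _ Suc.prems(1) d] by simp
qed

lemma Ck_on_subset: "Ck_on k S f \<Longrightarrow> T \<subseteq> S \<Longrightarrow> Ck_on k T f"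
  by (induction k arbitrary: f) (auto intro: continuous_on_subset)

lemma smooth_on_subset: "smooth_on S f \<Longrightarrow> T \<subseteq> S \<Longrightarrow> smooth_on T f"
  unfolding smooth_on_def using Ck_on_subset by blast

lemma smooth_on_cong:
  "open S \<Longrightarrow> (\<And>x. x \<in> S \<Longrightarrow> f x = g x) \<Longrightarrow> smooth_on S f \<Longrightarrow> smooth_on S g"
  unfolding smooth_on_def using Ck_on_cong by blast

lemma Ck_on_Suc_imp: "Ck_on (Suc k) S f \<Longrightarrow> Ck_on k S f"
proof (induction k arbitrary: f)
  case 0
  then show ?case
    by (auto intro!: continuous_at_imp_continuous_on differentiable_imp_continuous_within)
next
  case (Suc k)
  then show ?case by (simp del: Ck_on.simps add: Ck_on.simps(2)[of "Suc k"] Ck_on.simps(2)[of k])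
qed

lemma Ck_on_le: "Ck_on m S f \<Longrightarrow> k \<le> m \<Longrightarrow> Ck_on k S f"
proof (induction m arbitrary: k)
  case 0 then show ?case by simp
next
  case (Suc m) then show ?case by (metis Ck_on_Suc_imp le_Suc_eq)
qed

lemma Ck_on_continuous: "Ck_on k S f \<Longrightarrow> continuous_on S f"
  using Ck_on_le[of k S f 0] by simp

lemma Ck_on_differentiable: "Ck_on k S f \<Longrightarrow> 0 < k \<Longrightarrow> x \<in> S \<Longrightarrow> f differentiable (at x)"
  by (cases k) auto

lemma Ck_on_dird: "Ck_on (Suc k) S f \<Longrightarrow> Ck_on k S (dird f v)"
  by simp

lemma smooth_on_dird: "smooth_on S f \<Longrightarrow> smooth_on S (dird f v)"
  unfolding smooth_on_def using Ck_on_dird by blast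

lemma smooth_on_differentiable: "smooth_on S f \<Longrightarrow> x \<in> S \<Longrightarrow> f differentiable (at x)"
  unfolding smooth_on_def using Ck_on_differentiable zero_less_one by blast

lemma smooth_on_continuous: "smooth_on S f \<Longrightarrow> continuous_on S f"
  unfolding smooth_on_def using Ck_on_continuous by blast

lemma Ck_on_SucI:
  assumes "open S" "\<And>x. x \<in> S \<Longrightarrow> (f has_derivative f' x) (at x)"
    and "\<And>v. Ck_on k S (\<lambda>x. f' x v)"
  shows "Ck_on (Suc k) S f"
proof -
  have "Ck_on k S (dird f v)" for v
    by (rule Ck_on_cong[OF assms(1) _ assms(3)[of v]]) (simp add: dird_eq[OF assms(2)])
  then show ?thesis using assms(2) by (auto simp: differentiable_def)
qed

lemma Ck_on_const [simp]: "Ck_on k S (\<lambda>x. c)"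
  by (induction k arbitrary: c) auto

lemma Ck_on_bounded_linear:
  assumes "bounded_linear h" shows "Ck_on k S h"
proof (cases k)
  case 0
  then show ?thesis using assms by (auto intro: linear_continuous_on)
next
  case (Suc m)
  have "dird h v = (\<lambda>x. h v)" for v
    using bounded_linear_imp_has_derivative[OF assms] dird_eq by metis
  then show ?thesis using assms Suc by (auto intro: bounded_linear_imp_differentiable)
qed


lemma Ck_on_bounded_linear_compose:
  assumes "open S" "bounded_linear h" "Ck_on k S f"
  shows "Ck_on k S (\<lambda>x. h (f x))"
  using assms(3)
proof (induction k arbitrary: f)
  case 0
  then show ?case using assms(2) by (auto intro: bounded_linear.continuous_on)
next
  case (Suc k)
  show ?case
  proof (rule Ck_on_SucI[OF assms(1)])
    show "((\<lambda>x. h (f x)) has_derivative (\<lambda>v. h (dird f v x))) (at x)" if "x \<in> S" for x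
      using bounded_linear.has_derivative[OF assms(2) has_derivative_dird] Suc.prems that by auto
    show "Ck_on k S (\<lambda>x. h (dird f v x))" for v
      using Suc by auto
  qed
qed

lemma Ck_on_add:
  assumes "open S" "Ck_on k S f" "Ck_on k S g"
  shows "Ck_on k S (\<lambda>x. f x + g x)"
  using assms(2,3)
proof (induction k arbitrary: f g)
  case 0
  then show ?case by (auto intro: continuous_on_add)
next
  case (Suc k)
  show ?case
  proof (rule Ck_on_SucI[OF assms(1)])
    show "((\<lambda>x. f x + g x) has_derivative (\<lambda>v. dird f v x + dird g v x)) (at x)" if "x \<in> S" for x
      using Suc.prems that by (auto intro!: has_derivative_add has_derivative_dird)
    show "Ck_on k S (\<lambda>x. dird f v x + dird g v x)" for v
      using Suc by auto
  qed
qed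

lemma Ck_on_bilinear:
  assumes "open S" "bounded_bilinear b" "Ck_on k S f" "Ck_on k S g"
  shows "Ck_on k S (\<lambda>x. b (f x) (g x))"
  using assms(3,4)
proof (induction k arbitrary: f g)
  case 0
  then show ?case using assms(2) by (auto intro: bounded_bilinear.continuous_on)
next
  case (Suc k)
  have Sk: "Ck_on k S f" "Ck_on k S g" using Suc.prems Ck_on_Suc_imp by auto
  show ?case
  proof (rule Ck_on_SucI[OF assms(1)])
    show "((\<lambda>x. b (f x) (g x)) has_derivative (\<lambda>v. b (f x) (dird g v x) + b (dird f v x) (g x))) (at x)"
      if "x \<in> S" for x
      using Suc.prems that
      by (intro bounded_bilinear.FDERIV[OF assms(2)] has_derivative_dird) auto
    show "Ck_on k S (\<lambda>x. b (f x) (dird g v x) + b (dird f v x) (g x))" for v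
      using Suc Sk by (intro Ck_on_add assms(1)) auto
  qed
qed

lemma Ck_on_mult:
  fixes f g :: "'e::euclidean_space \<Rightarrow> real"
  shows "open S \<Longrightarrow> Ck_on k S f \<Longrightarrow> Ck_on k S g \<Longrightarrow> Ck_on k S (\<lambda>x. f x * g x)"
  by (rule Ck_on_bilinear[OF _ bounded_bilinear_mult])

lemma Ck_on_scaleR:
  "open S \<Longrightarrow> Ck_on k S f \<Longrightarrow> Ck_on k S g \<Longrightarrow> Ck_on k S (\<lambda>x. f x *\<^sub>R g x)"
  by (rule Ck_on_bilinear[OF _ bounded_bilinear_scaleR])

lemma Ck_on_diff:
  assumes "open S" "Ck_on k S f" "Ck_on k S g"
  shows "Ck_on k S (\<lambda>x. f x - g x)"
  using Ck_on_add[OF assms(1,2) Ck_on_bounded_linear_compose[OF assms(1) bounded_linear_minus[OF bounded_linear_ident] assms(3)]]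
  by simp

lemma Ck_on_sum:
  assumes "open S" "\<And>i. i \<in> A \<Longrightarrow> Ck_on k S (f i)"
  shows "Ck_on k S (\<lambda>x. \<Sum>i\<in>A. f i x)"
  using assms(2)
proof (induction A rule: infinite_finite_induct)
  case (insert a A)
  then show ?case by (simp add: Ck_on_add assms(1))
qed auto

lemma Ck_on_prod:
  fixes f :: "'i \<Rightarrow> 'e::euclidean_space \<Rightarrow> real"
  assumes "open S" "\<And>i. i \<in> A \<Longrightarrow> Ck_on k S (f i)"
  shows "Ck_on k S (\<lambda>x. \<Prod>i\<in>A. f i x)"
  using assms(2)
proof (induction A rule: infinite_finite_induct)
  case (insert a A)
  then show ?case by (simp add: Ck_on_mult assms(1))
qed auto

lemma Ck_on_inverse:
  fixes f :: "'e::euclidean_space \<Rightarrow> real"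
  assumes "open S" "Ck_on k S f" "\<And>x. x \<in> S \<Longrightarrow> f x \<noteq> 0"
  shows "Ck_on k S (\<lambda>x. inverse (f x))"
  using assms(2)
proof (induction k)
  case 0
  then show ?case using assms by (auto intro!: continuous_on_inverse)
next
  case (Suc k)
  show ?case
  proof (rule Ck_on_SucI[OF assms(1)])
    show "((\<lambda>x. inverse (f x)) has_derivative (\<lambda>v. - (inverse (f x) * dird f v x * inverse (f x)))) (at x)"
      if "x \<in> S" for x
      using Suc.prems that assms(3) by (intro Deriv.has_derivative_inverse has_derivative_dird) auto
    have "Ck_on k S (\<lambda>x. 0 - inverse (f x) * dird f v x * inverse (f x))" for v
      using Suc.IH[OF Ck_on_Suc_imp[OF Suc.prems]] Suc.prems
      by (intro Ck_on_mult Ck_on_diff assms(1)) auto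
    then show "Ck_on k S (\<lambda>x. - (inverse (f x) * dird f v x * inverse (f x)))" for v
      by simp
  qed
qed

lemma Ck_on_componentwise:
  fixes f :: "'e::euclidean_space \<Rightarrow> 'f::euclidean_space"
  assumes "open S" "\<And>b. b \<in> Basis \<Longrightarrow> Ck_on k S (\<lambda>x. f x \<bullet> b)"
  shows "Ck_on k S f"
proof -
  have "Ck_on k S (\<lambda>x. \<Sum>b\<in>Basis. (f x \<bullet> b) *\<^sub>R b)"
    using assms by (intro Ck_on_sum Ck_on_scaleR) auto
  then show ?thesis by (simp add: euclidean_representation)
qed

lemma Ck_on_vec:
  fixes f :: "'e::euclidean_space \<Rightarrow> 'f::euclidean_space ^ 'n"
  assumes "open S" "\<And>i. Ck_on k S (\<lambda>x. f x $ i)"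
  shows "Ck_on k S f"
proof (rule Ck_on_componentwise[OF assms(1)])
  fix b :: "'f ^ 'n" assume "b \<in> Basis"
  then obtain i u where b: "b = axis i u" by (auto simp: Basis_vec_def)
  have "Ck_on k S (\<lambda>x. (f x $ i) \<bullet> u)"
    by (rule Ck_on_bounded_linear_compose[OF assms(1) bounded_linear_inner_left assms(2)])
  then show "Ck_on k S (\<lambda>x. f x \<bullet> b)" by (simp add: b inner_axis)
qed

lemma Ck_on_nth:
  fixes f :: "'e::euclidean_space \<Rightarrow> 'f::real_normed_vector ^ 'n"
  shows "open S \<Longrightarrow> Ck_on k S f \<Longrightarrow> Ck_on k S (\<lambda>x. f x $ i)"
  by (rule Ck_on_bounded_linear_compose[OF _ bounded_linear_vec_nth])

lemma dird_expand:
  assumes "f differentiable (at x)"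
  shows "dird f v x = (\<Sum>b\<in>Basis. (v \<bullet> b) *\<^sub>R dird f b x)"
proof -
  interpret linear "\<lambda>v. dird f v x" using linear_frechet_derivative[OF assms] .
  show ?thesis
    by (subst euclidean_representation[of v, symmetric]) (simp only: sum scale)
qed

text \<open>In the derivative of the composite both the base point and the direction depend on
  \<open>x\<close>. Expanding the direction in the basis gives a finite sum of coordinates of
  \<open>dird h v\<close> times \<open>dird f b\<close> composed with \<open>h\<close>; the
  induction hypothesis, general in \<open>f\<close>, covers the latter.\<close>

lemma Ck_on_compose:
  fixes f :: "'f::euclidean_space \<Rightarrow> 'g::real_normed_vector" and h :: "'e::euclidean_space \<Rightarrow> 'f"
  assumes "open S" "open T" "h ` S \<subseteq> T" "Ck_on k T f" "Ck_on k S h"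
  shows "Ck_on k S (\<lambda>x. f (h x))"
  using assms(4,5)
proof (induction k arbitrary: f)
  case 0
  then show ?case using assms(3) by (auto intro: continuous_on_compose2)
next
  case (Suc k)
  have h: "Ck_on k S h" using Suc.prems Ck_on_Suc_imp by auto
  show ?case
  proof (rule Ck_on_SucI[OF assms(1)])
    fix x assume x: "x \<in> S"
    have d: "f differentiable (at (h x))" "h differentiable (at x)"
      using x Suc.prems assms(3) by auto
    have "((\<lambda>x. f (h x)) has_derivative (\<lambda>v. dird f (dird h v x) (h x))) (at x)"
      using has_derivative_compose[OF has_derivative_dird[OF d(2)] has_derivative_dird[OF d(1)]]
      by (simp add: o_def)
    then show "((\<lambda>x. f (h x)) has_derivative (\<lambda>v. \<Sum>b\<in>Basis. (dird h v x \<bullet> b) *\<^sub>R dird f b (h x))) (at x)"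
      by (subst dird_expand[OF d(1), symmetric])
  next
    fix v
    have "Ck_on k S (\<lambda>x. dird f b (h x))" for b
      using Suc by (intro Suc.IH) (auto simp: h)
    then show "Ck_on k S (\<lambda>x. \<Sum>b\<in>Basis. (dird h v x \<bullet> b) *\<^sub>R dird f b (h x))"
      using Suc.prems by (intro Ck_on_sum Ck_on_scaleR Ck_on_bounded_linear_compose[OF _ bounded_linear_inner_left] assms(1)) auto
  qed
qed

section \<open>Determinants and inverses of matrix-valued functions\<close>

lemma Ck_on_det:
  fixes A :: "'e::euclidean_space \<Rightarrow> real ^ 'n ^ 'n"
  assumes "open S" "\<And>i j. Ck_on k S (\<lambda>x. A x $ i $ j)"
  shows "Ck_on k S (\<lambda>x. det (A x))"
  unfolding det_def
  by (intro Ck_on_sum Ck_on_mult Ck_on_prod assms Ck_on_const)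

lemma matrix_inv_inverse:
  fixes A :: "real ^ 'n ^ 'n"
  assumes "det A \<noteq> 0"
  shows "A ** matrix_inv A = mat 1" "matrix_inv A ** A = mat 1"
  using assms[folded invertible_det_nz]
  unfolding matrix_inv_def invertible_def by (metis (mono_tags, lifting) someI_ex)+

text \<open>Cramer's rule for the \<open>m\<close>-th unit vector. Entries of the inverse become
  quotients of polynomials in the entries of \<open>A\<close>, from which both regularity and
  differentiability of the inverse are read off below.\<close>

lemma matrix_inv_cramer:
  fixes A :: "real ^ 'n ^ 'n"
  assumes "det A \<noteq> 0"
  shows "matrix_inv A $ k $ m = det (\<chi> i j. if j = k then axis m 1 $ i else A $ i $ j) / det A"
proof -
  have "A *v (matrix_inv A *v axis m 1) = axis m 1"
    by (simp add: matrix_vector_mul_assoc matrix_inv_inverse assms)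
  from this[unfolded cramer[OF assms]]
  show ?thesis
    by (simp add: matrix_vector_mul_component inner_axis vec_eq_iff matrix_vector_mult_basis column_def)
qed

lemma Ck_on_matrix_inv:
  fixes A :: "'e::euclidean_space \<Rightarrow> real ^ 'n ^ 'n"
  assumes "open S" "\<And>i j. Ck_on k S (\<lambda>x. A x $ i $ j)" "\<And>x. x \<in> S \<Longrightarrow> det (A x) \<noteq> 0"
  shows "Ck_on k S (\<lambda>x. matrix_inv (A x) $ i $ j)"
proof -
  have "Ck_on k S (\<lambda>x. det (\<chi> l m. if m = i then axis j 1 $ l else A x $ l $ m) * inverse (det (A x)))"
  proof (intro Ck_on_mult Ck_on_det Ck_on_inverse assms)
    show "Ck_on k S (\<lambda>x. (\<chi> l m. if m = i then axis j 1 $ l else A x $ l $ m) $ p $ q)" for p q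
      by (cases "q = i") (simp_all add: assms(2))
  qed
  then show ?thesis
    by (rule Ck_on_cong[OF assms(1), rotated]) (simp add: matrix_inv_cramer assms(3) divide_inverse)
qed

section \<open>Derivatives along lines and symmetry of second derivatives\<close>

lemma line_has_vector_derivative:
  assumes "f differentiable (at (a + s *\<^sub>R v))"
  shows "((\<lambda>s. f (a + s *\<^sub>R v)) has_vector_derivative dird f v (a + s *\<^sub>R v)) (at s)"
proof -
  have "((\<lambda>s. a + s *\<^sub>R v) has_derivative (\<lambda>h. h *\<^sub>R v)) (at s)"
    by (auto intro!: derivative_eq_intros)
  from has_derivative_compose[OF this has_derivative_dird[OF assms]]
  have "((\<lambda>s. f (a + s *\<^sub>R v)) has_derivative (\<lambda>h. dird f (h *\<^sub>R v) (a + s *\<^sub>R v))) (at s)"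
    by (simp add: o_def)
  moreover have "(\<lambda>h. dird f (h *\<^sub>R v) (a + s *\<^sub>R v)) = (\<lambda>h. h *\<^sub>R dird f v (a + s *\<^sub>R v))"
    using linear_frechet_derivative[OF assms] by (auto simp: linear_cmul)
  ultimately show ?thesis by (simp add: has_vector_derivative_def)
qed

lemma line_has_real_derivative:
  fixes f :: "'e::euclidean_space \<Rightarrow> real"
  assumes "f differentiable (at (a + s *\<^sub>R v))"
  shows "((\<lambda>s. f (a + s *\<^sub>R v)) has_real_derivative dird f v (a + s *\<^sub>R v)) (at s)"
  using line_has_vector_derivative[OF assms]
  by (simp add: has_real_derivative_iff_has_vector_derivative)

text \<open>The mean value theorem is applied to the increment in direction \<open>w\<close> as a
  function of the step along \<open>v\<close>, and then to \<open>dird f v\<close> as a function of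
  the step along \<open>w\<close>. The second difference is symmetric in \<open>v\<close> and
  \<open>w\<close>, which is what forces second derivatives to commute.\<close>

lemma mixed_difference:
  fixes f :: "'e::euclidean_space \<Rightarrow> real"
  assumes f: "Ck_on 2 (ball x e) f" and h: "h > 0" "h * (norm v + norm w) < e"
  obtains y where "dist y x \<le> h * (norm v + norm w)"
    "f (x + h *\<^sub>R v + h *\<^sub>R w) - f (x + h *\<^sub>R v) - f (x + h *\<^sub>R w) + f x = h\<^sup>2 * dird (dird f v) w y"
proof -
  have near: "dist (x + s *\<^sub>R v + t *\<^sub>R w) x \<le> h * (norm v + norm w)" if "0 \<le> s" "s \<le> h" "0 \<le> t" "t \<le> h" for s t
  proof -
    have "dist (x + s *\<^sub>R v + t *\<^sub>R w) x = norm (s *\<^sub>R v + t *\<^sub>R w)" by (simp add: dist_norm)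
    also have "\<dots> \<le> s * norm v + t * norm w"
      using norm_triangle_ineq[of "s *\<^sub>R v" "t *\<^sub>R w"] that by simp
    also have "\<dots> \<le> h * norm v + h * norm w" using that by (intro add_mono mult_right_mono) auto
    finally show ?thesis by (simp add: algebra_simps)
  qed
  have inb: "x + s *\<^sub>R v + t *\<^sub>R w \<in> ball x e" if "0 \<le> s" "s \<le> h" "0 \<le> t" "t \<le> h" for s t
    using near[OF that] h by (auto simp: dist_commute)
  have d1: "f differentiable (at y)" and d2: "dird f v differentiable (at y)" if "y \<in> ball x e" for y
    using f that by (auto simp: numeral_2_eq_2)
  define g where "g s = f (x + h *\<^sub>R w + s *\<^sub>R v) - f (x + s *\<^sub>R v)" for s
  have g': "(g has_real_derivative dird f v (x + h *\<^sub>R w + s *\<^sub>R v) - dird f v (x + s *\<^sub>R v)) (at s)"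
    if "0 \<le> s" "s \<le> h" for s
    unfolding g_def using inb[of s h] inb[of s 0] that h
    by (intro DERIV_diff line_has_real_derivative d1)
      (simp_all add: add.assoc add.commute[of "h *\<^sub>R w"])
  from MVT2[OF h(1) g'] obtain s where s: "0 < s" "s < h"
    "g h - g 0 = (h - 0) * (dird f v (x + h *\<^sub>R w + s *\<^sub>R v) - dird f v (x + s *\<^sub>R v))" by auto
  define k where "k t = dird f v (x + s *\<^sub>R v + t *\<^sub>R w)" for t
  have k': "(k has_real_derivative dird (dird f v) w (x + s *\<^sub>R v + t *\<^sub>R w)) (at t)" if "0 \<le> t" "t \<le> h" for t
    unfolding k_def using inb[of s t] that s
    by (intro line_has_real_derivative d2)
      auto
  from MVT2[OF h(1) k'] obtain t where t: "0 < t" "t < h"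
    "k h - k 0 = (h - 0) * dird (dird f v) w (x + s *\<^sub>R v + t *\<^sub>R w)" by auto
  show ?thesis
  proof (rule that[of "x + s *\<^sub>R v + t *\<^sub>R w"])
    show "dist (x + s *\<^sub>R v + t *\<^sub>R w) x \<le> h * (norm v + norm w)" using near s t by auto
    show "f (x + h *\<^sub>R v + h *\<^sub>R w) - f (x + h *\<^sub>R v) - f (x + h *\<^sub>R w) + f x =
       h\<^sup>2 * dird (dird f v) w (x + s *\<^sub>R v + t *\<^sub>R w)"
      using s(3) t(3) by (simp add: g_def k_def algebra_simps power2_eq_square)
  qed
qed

text \<open>Both orders of \<open>mixed_difference\<close> evaluate the same second difference, so
  the two second derivatives take equal values at points \<open>y\<close> and \<open>z\<close> close
  to \<open>x\<close>. If they differed at \<open>x\<close> by \<open>2 * d\<close>, continuity with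
  tolerance \<open>d\<close> would be contradicted.\<close>

lemma dird_symmetric_real:
  fixes f :: "'e::euclidean_space \<Rightarrow> real"
  assumes S: "open S" "x \<in> S" and f: "Ck_on 2 S f"
  shows "dird (dird f v) w x = dird (dird f w) v x"
proof (rule ccontr)
  assume ne: "\<not> ?thesis"
  define d where "d = \<bar>dird (dird f v) w x - dird (dird f w) v x\<bar> / 2"
  have d: "d > 0" using ne by (simp add: d_def)
  have c: "continuous (at x) (dird (dird f v) w)" "continuous (at x) (dird (dird f w) v)"
    using f S by (auto simp: numeral_2_eq_2 continuous_on_eq_continuous_at)
  obtain e0 where e0: "e0 > 0" "ball x e0 \<subseteq> S" using S openE by blast
  obtain e1 where e1: "e1 > 0" "\<And>y. dist y x < e1 \<Longrightarrow> dist (dird (dird f v) w y) (dird (dird f v) w x) < d"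
    using c(1) d unfolding continuous_at by (metis (no_types, lifting) dist_self LIM_def)
  obtain e2 where e2: "e2 > 0" "\<And>y. dist y x < e2 \<Longrightarrow> dist (dird (dird f w) v y) (dird (dird f w) v x) < d"
    using c(2) d unfolding continuous_at by (metis (no_types, lifting) dist_self LIM_def)
  define e where "e = min e0 (min e1 e2)"
  have e: "e > 0" "e \<le> e0" "e \<le> e1" "e \<le> e2" using e0 e1 e2 by (auto simp: e_def)
  define h where "h = e / (norm v + norm w + 1)"
  have n: "norm v + norm w + 1 > 0" using norm_ge_zero[of v] norm_ge_zero[of w] by linarith

  have h: "h > 0" using e n by (simp add: h_def)
  have "h * (norm v + norm w) < h * (norm v + norm w + 1)"
    using h by simp
  also have "\<dots> = e" using n by (simp add: h_def)
  finally have he: "h * (norm v + norm w) < e" .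
  have fb: "Ck_on 2 (ball x e) f"
    using Ck_on_subset[OF f] e0 e by (meson subset_ball subset_trans)
  obtain y where y: "dist y x \<le> h * (norm v + norm w)"
    "f (x + h *\<^sub>R v + h *\<^sub>R w) - f (x + h *\<^sub>R v) - f (x + h *\<^sub>R w) + f x = h\<^sup>2 * dird (dird f v) w y"
    using mixed_difference[OF fb h he] by blast
  obtain z where z: "dist z x \<le> h * (norm w + norm v)"
    "f (x + h *\<^sub>R w + h *\<^sub>R v) - f (x + h *\<^sub>R w) - f (x + h *\<^sub>R v) + f x = h\<^sup>2 * dird (dird f w) v z"
    using mixed_difference[OF fb h, of w v] he by (metis add.commute)
  have "h\<^sup>2 * dird (dird f v) w y = h\<^sup>2 * dird (dird f w) v z"
    unfolding y(2)[symmetric] z(2)[symmetric] by (simp add: algebra_simps)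
  then have "dird (dird f v) w y = dird (dird f w) v z" using h by simp
  moreover have "dist (dird (dird f v) w y) (dird (dird f v) w x) < d" using e1(2) y(1) he e by auto
  moreover have "dist (dird (dird f w) v z) (dird (dird f w) v x) < d"
    using e2(2) z(1) he e by (auto simp: add.commute)
  ultimately show False unfolding d_def dist_real_def by (smt (verit) field_sum_of_halves)
qed

lemma dird_linear:
  assumes "bounded_linear h" "f differentiable (at x)"
  shows "dird (\<lambda>x. h (f x)) v x = h (dird f v x)"
  using dird_eq[OF bounded_linear.has_derivative[OF assms(1) has_derivative_dird[OF assms(2)]]] by simp

lemma dird_symmetric:
  fixes f :: "'e::euclidean_space \<Rightarrow> 'f::euclidean_space"
  assumes S: "open S" "x \<in> S" and f: "Ck_on 2 S f"
  shows "dird (dird f v) w x = dird (dird f w) v x"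
proof (rule euclidean_eqI)
  fix b :: 'f assume "b \<in> Basis"
  have d1: "f differentiable (at y)" and d2: "dird f u differentiable (at y)" if "y \<in> S" for y u
    using f that by (auto simp: numeral_2_eq_2)
  have C: "Ck_on 2 S (\<lambda>x. f x \<bullet> b)"
    by (rule Ck_on_bounded_linear_compose[OF S(1) bounded_linear_inner_left f])
  have *: "dird (dird (\<lambda>x. f x \<bullet> b) u) z x = dird (dird f u) z x \<bullet> b" for u z
  proof -
    have "dird (dird (\<lambda>x. f x \<bullet> b) u) z x = dird (\<lambda>x. dird f u x \<bullet> b) z x"
      by (rule dird_cong_open(1)[OF S])
        (use C S(2) in \<open>auto simp: dird_linear[OF bounded_linear_inner_left d1] numeral_2_eq_2\<close>)
    then show ?thesis by (simp add: dird_linear[OF bounded_linear_inner_left d2[OF S(2)]])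
  qed
  show "dird (dird f v) w x \<bullet> b = dird (dird f w) v x \<bullet> b"
    using dird_symmetric_real[OF S C, of v w] by (simp add: *)
qed

section \<open>Determinants along curves\<close>

lemma det_deriv_general:
  fixes A :: "real \<Rightarrow> real ^ 'n ^ 'n"
  assumes "\<And>i j. ((\<lambda>t. A t $ i $ j) has_real_derivative A' i j) (at t)"
  shows "((\<lambda>s. det (A s)) has_real_derivative
    (\<Sum>p | p permutes UNIV. of_int (sign p) * (\<Sum>i\<in>UNIV. A' i (p i) * (\<Prod>j\<in>UNIV - {i}. A t $ j $ p j)))) (at t)"
proof -
  have "((\<lambda>s. \<Prod>i\<in>UNIV. A s $ i $ p i) has_real_derivative
     (\<Sum>i\<in>UNIV. A' i (p i) * (\<Prod>j\<in>UNIV - {i}. A t $ j $ p j))) (at t)" for p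
  proof -
    have "((\<lambda>s. \<Prod>i\<in>UNIV. A s $ i $ p i) has_derivative
      (\<lambda>y. \<Sum>i\<in>UNIV. (A' i (p i) * y) * (\<Prod>j\<in>UNIV - {i}. A t $ j $ p j))) (at t)"
      by (intro has_derivative_prod assms[unfolded has_field_derivative_def])
    moreover have "(\<lambda>y. \<Sum>i\<in>UNIV. (A' i (p i) * y) * (\<Prod>j\<in>UNIV - {i}. A t $ j $ p j)) =
      times (\<Sum>i\<in>UNIV. A' i (p i) * (\<Prod>j\<in>UNIV - {i}. A t $ j $ p j))"
      unfolding sum_distrib_right by (intro ext sum.cong) (simp_all only: mult_ac)
    ultimately show ?thesis
      by (simp only: has_field_derivative_def)
  qed
  then show ?thesis
    unfolding det_def by (intro DERIV_sum DERIV_cmult)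
qed

text \<open>A permutation other than the identity moves at least two indices, so after removal of
  one factor a vanishing off-diagonal entry of the identity matrix remains in the product. Only the
  identity permutation contributes.\<close>

lemma det_deriv_mat1:
  fixes A :: "real \<Rightarrow> real ^ 'n ^ 'n"
  assumes "\<And>i j. ((\<lambda>t. A t $ i $ j) has_real_derivative A' i j) (at t)" and "A t = mat 1"
  shows "((\<lambda>s. det (A s)) has_real_derivative (\<Sum>i\<in>UNIV. A' i i)) (at t)"
proof -
  let ?g = "\<lambda>p. of_int (sign p) * (\<Sum>i\<in>UNIV. A' i (p i) * (\<Prod>j\<in>UNIV - {i}. A t $ j $ p j))"
  have z: "?g p = 0" if p: "p permutes UNIV" "p \<noteq> id" for p
  proof -
    obtain k where k: "p k \<noteq> k" using p by (auto simp: fun_eq_iff)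
    have k2: "p (p k) \<noteq> p k" using k permutes_inj[OF p(1)] by (auto dest: injD)
    have p0: "(\<Prod>j\<in>UNIV - {i}. A t $ j $ p j) = 0" for i
    proof -
      obtain j where "j \<noteq> i" "p j \<noteq> j" using k k2 by metis
      then show ?thesis by (intro prod_zero bexI[of _ j]) (auto simp: assms(2) mat_def)
    qed
    show ?thesis unfolding p0 by simp
  qed
  have "(\<Sum>p | p permutes UNIV. ?g p) = (\<Sum>p\<in>{id}. ?g p)"
    by (rule sum.mono_neutral_right) (auto simp: finite_permutations z permutes_id)
  also have "\<dots> = (\<Sum>i\<in>UNIV. A' i i)"
    by (simp add: assms(2) mat_def)
  finally show ?thesis using det_deriv_general[of A A' t, OF assms(1)] by simp
qed

lemma matrix_mult_deriv:
  fixes A B :: "real \<Rightarrow> real ^ 'n ^ 'n"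
  assumes "\<And>i j. ((\<lambda>t. A t $ i $ j) has_real_derivative A' $ i $ j) (at t)"
    and "\<And>i j. ((\<lambda>t. B t $ i $ j) has_real_derivative B' $ i $ j) (at t)"
  shows "((\<lambda>t. (A t ** B t) $ i $ j) has_real_derivative (A' ** B t + A t ** B') $ i $ j) (at t)"
proof -
  have "((\<lambda>t. (A t ** B t) $ i $ j) has_real_derivative
     (\<Sum>k\<in>UNIV. A' $ i $ k * B t $ k $ j + B' $ k $ j * A t $ i $ k)) (at t)"
    unfolding matrix_matrix_mult_def using assms by (simp, intro DERIV_sum DERIV_mult) auto
  then show ?thesis by (simp add: matrix_matrix_mult_def sum.distrib mult.commute)
qed

text \<open>Jacobi's formula. Multiplication by the inverse of the matrix at the fixed time
  \<open>t\<close> reduces it to the derivative of the determinant at the identity.\<close>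

lemma det_has_derivative:
  fixes A :: "real \<Rightarrow> real ^ 'n ^ 'n"
  assumes A': "\<And>i j. ((\<lambda>t. A t $ i $ j) has_real_derivative A' $ i $ j) (at t)" and nz: "det (A t) \<noteq> 0"
  shows "((\<lambda>s. det (A s)) has_real_derivative det (A t) * trace (matrix_inv (A t) ** A')) (at t)"
proof -
  let ?N = "matrix_inv (A t)"
  have "((\<lambda>s. (?N ** A s) $ i $ j) has_real_derivative (?N ** A') $ i $ j) (at t)" for i j
    using matrix_mult_deriv[of "\<lambda>_. ?N" 0 t A A', OF _ A'] by (simp add: matrix_matrix_mult_def)
  from det_deriv_mat1[OF this] have "((\<lambda>s. det (?N ** A s)) has_real_derivative trace (?N ** A')) (at t)"
    by (simp add: matrix_inv_inverse nz trace_def)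
  from DERIV_cmult[OF this, of "det (A t)"]
  have "((\<lambda>s. det (A t) * det (?N ** A s)) has_real_derivative det (A t) * trace (?N ** A')) (at t)" .
  moreover have "det (A t) * det (?N ** A s) = det (A s)" for s
    using matrix_inv_inverse(1)[OF nz] by (metis det_I det_mul matrix_mul_assoc matrix_mul_lid)
  ultimately show ?thesis by simp
qed

text \<open>Second-order companion of Jacobi's formula: as \<open>A 0\<close> is the identity, the
  inverse has derivative \<open>- A' 0\<close> there, and the product rule produces the two
  traces.\<close>

lemma trace_matrix_inv_mult_deriv:
  fixes A A' :: "real \<Rightarrow> real ^ 'n ^ 'n"
  assumes e: "e > 0" and A: "\<And>s i j. \<bar>s\<bar> < e \<Longrightarrow> ((\<lambda>t. A t $ i $ j) has_real_derivative A' s $ i $ j) (at s)"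
    and A': "\<And>i j. ((\<lambda>t. A' t $ i $ j) has_real_derivative A'' $ i $ j) (at 0)"
    and A0: "A 0 = mat 1" and nz: "\<And>s. \<bar>s\<bar> < e \<Longrightarrow> det (A s) \<noteq> 0"
  shows "((\<lambda>s. trace (matrix_inv (A s) ** A' s)) has_real_derivative trace A'' - trace (A' 0 ** A' 0)) (at 0)"
proof -
  let ?N = "\<lambda>s. matrix_inv (A s)"
  have ev: "\<forall>\<^sub>F s in nhds 0. \<bar>s\<bar> < e"
    using e by (auto simp: eventually_nhds_metric dist_real_def)
  \<comment> \<open>Cramer's rule shows that the inverse is differentiable at all. The value of its
    derivative is found afterwards by differentiating its product with \<open>A\<close>.\<close>
  have "\<exists>D. ((\<lambda>s. ?N s $ i $ j) has_real_derivative D) (at 0)" for i j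
  proof -
    let ?C = "\<lambda>s. (\<chi> l m. if m = i then axis j 1 $ l else A s $ l $ m) :: real ^ 'n ^ 'n"
    have "((\<lambda>s. ?C s $ l $ m) has_real_derivative (if m = i then 0 else A' 0 $ l $ m)) (at 0)" for l m
      using A[of 0 l m] e by (cases "m = i") auto
    from det_deriv_general[of ?C, OF this]
    obtain D1 where D1: "((\<lambda>s. det (?C s)) has_real_derivative D1) (at 0)" ..
    from det_deriv_general[of A "\<lambda>i j. A' 0 $ i $ j" 0, OF A] e
    obtain D2 where D2: "((\<lambda>s. det (A s)) has_real_derivative D2) (at 0)" by auto
    obtain D where D: "((\<lambda>s. det (?C s) / det (A s)) has_real_derivative D) (at 0)"
      using DERIV_divide[OF D1 D2] nz[of 0] e by auto
    have "\<forall>\<^sub>F s in nhds 0. det (?C s) / det (A s) = ?N s $ i $ j"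
      using ev by eventually_elim (simp add: matrix_inv_cramer nz)
    from iffD1[OF DERIV_cong_ev[OF refl this refl] D] show ?thesis ..
  qed
  then obtain D where D: "\<And>i j. ((\<lambda>s. ?N s $ i $ j) has_real_derivative D i j) (at 0)" by metis
  define N' where "N' = (\<chi> i j. D i j)"
  have N': "((\<lambda>s. ?N s $ i $ j) has_real_derivative N' $ i $ j) (at 0)" for i j
    using D by (simp add: N'_def)
  have inv1: "matrix_inv (mat 1 :: real ^ 'n ^ 'n) = mat 1"
    using matrix_inv_inverse(1)[of "mat 1 :: real ^ 'n ^ 'n"] by simp
  have "(A' 0 + N') $ i $ j = 0" for i j
  proof -
    have "((\<lambda>s. (A s ** ?N s) $ i $ j) has_real_derivative (A' 0 + N') $ i $ j) (at 0)"
      using matrix_mult_deriv[of A "A' 0" 0 ?N N', OF A N'] e A0 inv1 by simp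
    moreover have "\<forall>\<^sub>F s in nhds 0. (A s ** ?N s) $ i $ j = (mat 1 :: real ^ 'n ^ 'n) $ i $ j"
      using ev by eventually_elim (simp add: matrix_inv_inverse nz)
    from iffD2[OF DERIV_cong_ev[OF refl this refl] DERIV_const]
    have "((\<lambda>s. (A s ** ?N s) $ i $ j) has_real_derivative 0) (at 0)" .
    ultimately show ?thesis using DERIV_unique by blast
  qed
  then have N'_eq: "N' = - A' 0"
    by (simp add: vec_eq_iff add_eq_0_iff)
  have "((\<lambda>s. \<Sum>i\<in>UNIV. (?N s ** A' s) $ i $ i) has_real_derivative
      (\<Sum>i\<in>UNIV. (N' ** A' 0 + ?N 0 ** A'') $ i $ i)) (at 0)"
    by (intro DERIV_sum matrix_mult_deriv N' A')
  moreover have "(\<Sum>i\<in>UNIV. (N' ** A' 0 + ?N 0 ** A'') $ i $ i) = trace A'' - trace (A' 0 ** A' 0)"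
  proof -
    have "N' ** A' 0 = - (A' 0 ** A' 0)"
      by (simp add: N'_eq vec_eq_iff matrix_matrix_mult_def sum_negf)
    then show ?thesis by (simp add: A0 inv1 trace_def sum_subtractf)
  qed
  ultimately show ?thesis by (simp add: trace_def)
qed

section \<open>Christoffel symbols\<close>

text \<open>The component matrix of a metric in one chart, detached from the manifold. Nondegeneracy
  is a nonvanishing determinant, without positivity, so that arbitrary index is covered.\<close>

locale chart_metric =
  fixes U :: "(real ^ 'n::finite) set" and G :: "real ^ 'n \<Rightarrow> real ^ 'n ^ 'n"
  assumes open_U: "open U" and smooth_G: "smooth_on U G"
    and sym_G: "\<And>x i j. x \<in> U \<Longrightarrow> G x $ i $ j = G x $ j $ i"
    and det_G: "\<And>x. x \<in> U \<Longrightarrow> det (G x) \<noteq> 0"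
begin

lemma Ck_G: "Ck_on k U (\<lambda>x. G x $ i $ j)"
  using smooth_G unfolding smooth_on_def by (intro Ck_on_nth open_U) auto

lemma Ck_christoffel: "Ck_on k U (\<lambda>x. christoffel G x i j m)"
proof -
  have "Ck_on k U (dird (\<lambda>y. G y $ a $ b) (axis c 1))" for a b c
    using Ck_G[of "Suc k"] by simp
  then show ?thesis unfolding christoffel_def partial_def
    by (intro Ck_on_mult Ck_on_sum Ck_on_diff Ck_on_add Ck_on_const Ck_on_matrix_inv open_U Ck_G det_G)
qed

lemma Ck_christoffel_form: "Ck_on k U (\<lambda>x. christoffel_form G x v w)"
  unfolding christoffel_form_def
  by (rule Ck_on_vec[OF open_U]) (simp, intro Ck_on_sum Ck_on_mult Ck_on_const open_U Ck_christoffel)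

lemma christoffel_sym: "x \<in> U \<Longrightarrow> christoffel G x k i j = christoffel G x k j i"
proof -
  assume x: "x \<in> U"
  have "partial m (\<lambda>y. G y $ i $ j) x = partial m (\<lambda>y. G y $ j $ i) x" for m
    unfolding partial_def
    using dird_cong_open(1)[OF open_U x sym_G[of _ i j] Ck_on_differentiable[OF Ck_G[of 1] _ x]]
    by simp
  then show ?thesis by (simp add: christoffel_def add.commute)
qed

lemma christoffel_form_sym: "x \<in> U \<Longrightarrow> christoffel_form G x v w = christoffel_form G x w v"
  unfolding christoffel_form_def
  by (subst sum.swap) (simp add: christoffel_sym mult_ac)

lemma matrix_inv_sym:
  assumes "x \<in> U" shows "matrix_inv (G x) $ i $ j = matrix_inv (G x) $ j $ i"
proof -
  let ?N = "matrix_inv (G x)"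
  have G: "transpose (G x) = G x" using sym_G[OF assms] by (simp add: transpose_def vec_eq_iff)
  have "transpose ?N ** G x = mat 1"
    using matrix_inv_inverse(1)[OF det_G[OF assms]] G by (metis matrix_transpose_mul transpose_mat)
  then have "transpose ?N = ?N"
    using matrix_inv_inverse(1)[OF det_G[OF assms]] by (metis matrix_mul_assoc matrix_mul_lid matrix_mul_rid)
  then have "transpose ?N $ i $ j = ?N $ i $ j" by simp
  then show ?thesis by (simp add: transpose_def)
qed

text \<open>Of the three derivatives of the metric in the symbol, the first and the third cancel
  after summation: exchange the summation indices and use the symmetry of the matrix and of its
  inverse.\<close>

lemma christoffel_contraction:
  assumes x: "x \<in> U"
  shows "(\<Sum>k\<in>UNIV. christoffel G x k k i) =
    1/2 * (\<Sum>k\<in>UNIV. \<Sum>m\<in>UNIV. matrix_inv (G x) $ k $ m * partial i (\<lambda>y. G y $ m $ k) x)"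
proof -
  let ?N = "matrix_inv (G x)"
  have p: "partial m (\<lambda>y. G y $ i $ j) x = partial m (\<lambda>y. G y $ j $ i) x" for m i j
    unfolding partial_def
    using dird_cong_open(1)[OF open_U x sym_G[of _ i j] Ck_on_differentiable[OF Ck_G[of 1] _ x]]
    by simp
  let ?T1 = "\<Sum>k\<in>UNIV. \<Sum>m\<in>UNIV. ?N $ k $ m * partial k (\<lambda>y. G y $ i $ m) x"
  let ?T2 = "\<Sum>k\<in>UNIV. \<Sum>m\<in>UNIV. ?N $ k $ m * partial i (\<lambda>y. G y $ m $ k) x"
  let ?T3 = "\<Sum>k\<in>UNIV. \<Sum>m\<in>UNIV. ?N $ k $ m * partial m (\<lambda>y. G y $ k $ i) x"
  have "?T1 = ?T3"
  proof (subst sum.swap, intro sum.cong refl)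
    fix k m
    show "?N $ m $ k * partial m (\<lambda>y. G y $ i $ k) x = ?N $ k $ m * partial m (\<lambda>y. G y $ k $ i) x"
      using p[of m i k] matrix_inv_sym[OF x, of m k] by simp
  qed
  moreover have "(\<Sum>k\<in>UNIV. christoffel G x k k i) = 1/2 * (?T1 + ?T2 - ?T3)"
    unfolding christoffel_def sum_distrib_left[symmetric] sum.distrib[symmetric] sum_subtractf[symmetric]
    by (intro arg_cong[of _ _ "times (1/2)"] sum.cong refl) (subst p[of i], simp add: algebra_simps)
  ultimately show ?thesis by simp
qed

end

lemma christoffel_form_linear1: "linear (\<lambda>v. christoffel_form G x v w)"
  by (rule linearI) (simp_all add: christoffel_form_def vec_eq_iff algebra_simps sum.distrib sum_distrib_left)

lemma christoffel_form_linear2: "linear (\<lambda>w. christoffel_form G x v w)"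
  by (rule linearI) (simp_all add: christoffel_form_def vec_eq_iff algebra_simps sum.distrib sum_distrib_left)


context chart_metric begin

text \<open>By Jacobi's formula the right-hand side is half the logarithmic derivative of
  \<open>det G\<close> in direction \<open>v\<close>. This is the link from Christoffel symbols to
  the volume density.\<close>

lemma christoffel_form_contraction:
  assumes x: "x \<in> U"
  shows "(\<Sum>k\<in>UNIV. christoffel_form G x (axis k 1) v $ k) =
    1/2 * trace (matrix_inv (G x) ** (\<chi> i j. dird (\<lambda>y. G y $ i $ j) v x))"
proof -
  have 1: "dird (\<lambda>y. G y $ a $ b) v x = (\<Sum>i\<in>UNIV. v $ i * partial i (\<lambda>y. G y $ a $ b) x)" for a b
  proof -
    interpret linear "\<lambda>v. dird (\<lambda>y. G y $ a $ b) v x"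
      by (intro linear_frechet_derivative Ck_on_differentiable[OF Ck_G[of 1] _ x]) simp
    show ?thesis
      by (subst basis_expansion[of v, symmetric]) (simp add: sum scale partial_def scalar_mult_eq_scaleR)
  qed
  have "(\<Sum>k\<in>UNIV. christoffel_form G x (axis k 1) v $ k) = (\<Sum>k\<in>UNIV. \<Sum>j\<in>UNIV. christoffel G x k k j * v $ j)"
  proof (rule sum.cong[OF refl])
    fix k
    have "(\<Sum>j\<in>UNIV. christoffel G x k i j * axis k 1 $ i * v $ j) =
       (if i = k then \<Sum>j\<in>UNIV. christoffel G x k i j * v $ j else 0)" for i
      by (simp add: axis_def)
    then have "christoffel_form G x (axis k 1) v $ k =
       (\<Sum>i\<in>UNIV. if i = k then \<Sum>j\<in>UNIV. christoffel G x k i j * v $ j else 0)"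
      unfolding christoffel_form_def by simp
    then show "christoffel_form G x (axis k 1) v $ k = (\<Sum>j\<in>UNIV. christoffel G x k k j * v $ j)" by simp
  qed
  also have "\<dots> = (\<Sum>j\<in>UNIV. v $ j * (\<Sum>k\<in>UNIV. christoffel G x k k j))"
    by (subst sum.swap) (simp add: sum_distrib_left mult.commute)
  also have "\<dots> = 1/2 * (\<Sum>j\<in>UNIV. \<Sum>k\<in>UNIV. \<Sum>m\<in>UNIV.
       matrix_inv (G x) $ k $ m * (v $ j * partial j (\<lambda>y. G y $ m $ k) x))"
    unfolding christoffel_contraction[OF x] by (simp add: sum_distrib_left mult_ac)
  also have "\<dots> = 1/2 * (\<Sum>k\<in>UNIV. \<Sum>m\<in>UNIV. \<Sum>j\<in>UNIV.
       matrix_inv (G x) $ k $ m * (v $ j * partial j (\<lambda>y. G y $ m $ k) x))"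
    by (rule arg_cong[of _ _ "times (1/2)"], rule trans[OF sum.swap], rule sum.cong[OF refl], rule sum.swap)
  also have "\<dots> = 1/2 * trace (matrix_inv (G x) ** (\<chi> i j. dird (\<lambda>y. G y $ i $ j) v x))"
    unfolding trace_def matrix_matrix_mult_def 1 by (simp add: sum_distrib_left)
  finally show ?thesis .
qed

text \<open>Constant fields commute, and the covariant derivative of a constant field consists of
  its Christoffel term alone.\<close>

lemma riemann_const:
  assumes x: "x \<in> U"
  shows "riemann G (\<lambda>_. u) (\<lambda>_. v) (\<lambda>_. w) x =
     dird (\<lambda>y. christoffel_form G y v w) u x + christoffel_form G x u (christoffel_form G x v w)
   - dird (\<lambda>y. christoffel_form G y u w) v x - christoffel_form G x v (christoffel_form G x u w)"
proof -
  have n: "nabla G (\<lambda>_. u) (\<lambda>_. w) = (\<lambda>y. christoffel_form G y u w)" for u w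
    by (simp add: nabla_def fun_eq_iff)
  have l: "lie_bracket (\<lambda>_. u) (\<lambda>_. v) = (\<lambda>_. 0)"
    by (simp add: lie_bracket_def fun_eq_iff)
  have z: "christoffel_form G x 0 w = 0" using linear_0[OF christoffel_form_linear1] .
  show ?thesis
    unfolding riemann_def n l by (simp add: nabla_def z)
qed

end

section \<open>Curves, one-sided jets and polarization\<close>

lemma dird_scaleR: "f differentiable (at x) \<Longrightarrow> dird f (c *\<^sub>R v) x = c *\<^sub>R dird f v x"
  using linear_frechet_derivative linear_cmul by blast

lemma linear_dird: "f differentiable (at x) \<Longrightarrow> linear (\<lambda>v. dird f v x)"
  using linear_frechet_derivative by (metis eta_contract_eq)

lemma vector_derivative_nth:
  "(f has_vector_derivative D) F \<Longrightarrow> ((\<lambda>t. f t $ k) has_vector_derivative D $ k) F"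
  by (rule bounded_linear.has_vector_derivative[OF bounded_linear_vec_nth])

lemma real_derivative_nth:
  fixes f :: "real \<Rightarrow> real ^ 'n"
  shows "(f has_vector_derivative D) (at t) \<Longrightarrow> ((\<lambda>t. f t $ k) has_real_derivative D $ k) (at t)"
  by (simp add: has_real_derivative_iff_has_vector_derivative vector_derivative_nth)

lemma has_vector_derivative_vecI:
  fixes f :: "real \<Rightarrow> real ^ 'n"
  assumes "\<And>k. ((\<lambda>t. f t $ k) has_real_derivative D $ k) (at t)"
  shows "(f has_vector_derivative D) (at t)"
  unfolding has_vector_derivative_def
proof (subst has_derivative_componentwise_within, intro ballI)
  fix b :: "real ^ 'n" assume "b \<in> Basis"
  then obtain k where b: "b = axis k 1" by (auto simp: Basis_vec_def)
  show "((\<lambda>t. f t \<bullet> b) has_derivative (\<lambda>x. (x *\<^sub>R D) \<bullet> b)) (at t)"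
    using assms[of k] by (simp add: b inner_axis has_field_derivative_def mult_commute_abs)
qed

lemma curve_has_real_derivative:
  fixes f :: "'e::euclidean_space \<Rightarrow> real"
  assumes "f differentiable (at (x t))" "(x has_vector_derivative x') (at t)"
  shows "((\<lambda>s. f (x s)) has_real_derivative dird f x' (x t)) (at t)"
proof -
  have "((\<lambda>s. f (x s)) has_derivative (\<lambda>h. dird f (h *\<^sub>R x') (x t))) (at t)"
    using has_derivative_compose[OF assms(2)[unfolded has_vector_derivative_def] has_derivative_dird[OF assms(1)]] .
  then show ?thesis
    by (simp add: has_field_derivative_def dird_scaleR[OF assms(1)] mult_commute_abs)
qed


text \<open>The geodesic equation along a ray is available for positive times only, while the jets
  are wanted at 0. Since the two-sided derivative exists there, it equals the one-sided derivative,
  which the zero values on the right determine.\<close>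

lemma vanishing_right_jet:
  fixes h :: "real \<Rightarrow> 'f::real_normed_vector"
  assumes h: "(h has_vector_derivative D) (at 0)" and d: "d > 0" and z: "\<And>t. 0 < t \<Longrightarrow> t < d \<Longrightarrow> h t = 0"
  shows "h 0 = 0" "D = 0"
proof -
  have ev: "\<forall>\<^sub>F t in at_right 0. h t = 0"
    using d z by (auto simp: eventually_at_right_field)
  have "(h \<longlongrightarrow> h 0) (at_right 0)"
    using h has_vector_derivative_continuous continuous_at filterlim_at_split by blast
  moreover have "(h \<longlongrightarrow> 0) (at_right 0)"
    using tendsto_cong[OF ev] by simp
  ultimately show h0: "h 0 = 0" using tendsto_unique trivial_limit_at_right_real by blast
  have "h t = 0" if "t \<in> cbox 0 (d/2)" for t
    using that z[of t] d h0 by (cases "t = 0") auto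
  then have "(h has_vector_derivative 0) (at 0 within cbox 0 (d/2))"
    using d by (intro has_vector_derivative_transform[OF _ _ has_vector_derivative_const]) auto
  moreover have "(h has_vector_derivative D) (at 0 within cbox 0 (d/2))"
    using h has_vector_derivative_at_within by blast
  ultimately show "D = 0"
    using vector_derivative_unique_within_closed_interval[of 0 "d/2" 0 h] d by auto
qed

text \<open>\<open>T\<close> is symmetric but \<open>C\<close> need not be, so \<open>C\<close>
  enters through the sum over the three positions of \<open>w\<close>. Expansion at
  \<open>v + w\<close> and at \<open>v - w\<close> separates the terms linear in \<open>w\<close>
  from those quadratic in \<open>w\<close>.\<close>

lemma trilinear_polarization:
  fixes T C :: "'v::real_vector \<Rightarrow> 'v \<Rightarrow> 'v \<Rightarrow> 'w::real_vector"
  assumes T: "\<And>u v. linear (\<lambda>w. T u v w)" "\<And>u w. linear (\<lambda>v. T u v w)" "\<And>v w. linear (\<lambda>u. T u v w)"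
    and C: "\<And>u v. linear (\<lambda>w. C u v w)" "\<And>u w. linear (\<lambda>v. C u v w)" "\<And>v w. linear (\<lambda>u. C u v w)"
    and sym: "\<And>u v w. T u v w = T v u w" "\<And>u v w. T u v w = T u w v"
    and eq: "\<And>v. T v v v = C v v v"
  shows "3 *\<^sub>R T v v w = C w v v + C v w v + C v v w"
proof -
  note lT = linear_add[OF T(1)] linear_add[OF T(2)] linear_add[OF T(3)]
    linear_diff[OF T(1)] linear_diff[OF T(2)] linear_diff[OF T(3)]
  note lC = linear_add[OF C(1)] linear_add[OF C(2)] linear_add[OF C(3)]
    linear_diff[OF C(1)] linear_diff[OF C(2)] linear_diff[OF C(3)]
  have s: "T v w v = T v v w" "T w v v = T v v w" "T w v w = T v w w" "T w w v = T v w w"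
    using sym by metis+
  define a b where "a = C w v v + C v w v + C v v w" and "b = C v w w + C w v w + C w w v"
  have three: "3 *\<^sub>R x = x + x + x" for x :: 'w
    using scaleR_left_distrib[of 2 1 x] by (simp add: scaleR_2)
  have "T (v + w) (v + w) (v + w) = T v v v + 3 *\<^sub>R T v v w + 3 *\<^sub>R T v w w + T w w w"
    by (simp add: lT s three add_ac)
  moreover have "C (v + w) (v + w) (v + w) = C v v v + a + b + C w w w"
    by (simp add: lC a_def b_def add_ac)
  ultimately have 1: "3 *\<^sub>R T v v w + 3 *\<^sub>R T v w w = a + b"
    using eq[of "v + w"] eq[of v] eq[of w] by (simp add: add_ac)
  have "T (v - w) (v - w) (v - w) = T v v v - 3 *\<^sub>R T v v w + 3 *\<^sub>R T v w w - T w w w"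
    by (simp add: lT s three)
  moreover have "C (v - w) (v - w) (v - w) = C v v v - a + b - C w w w"
    by (simp add: lC a_def b_def)
  ultimately have 2: "3 *\<^sub>R T v w w - 3 *\<^sub>R T v v w = b - a"
    using eq[of "v - w"] eq[of v] eq[of w] by (simp add: algebra_simps)
  have "2 *\<^sub>R (3 *\<^sub>R T v v w) = (3 *\<^sub>R T v v w + 3 *\<^sub>R T v w w) - (3 *\<^sub>R T v w w - 3 *\<^sub>R T v v w)"
    unfolding scaleR_2 by simp
  also have "\<dots> = 2 *\<^sub>R a" unfolding 1 2 scaleR_2 by simp
  finally have "3 *\<^sub>R T v v w = a" unfolding scaleR_cancel_left by simp
  then show ?thesis by (simp add: a_def)
qed

context chart_metric begin

lemma christoffel_form_differentiable: "x \<in> U \<Longrightarrow> (\<lambda>y. christoffel_form G y u w) differentiable (at x)"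
  using Ck_on_differentiable[OF Ck_christoffel_form[of 1]] by simp

lemma dird_christoffel_form_nth:
  assumes x: "x \<in> U"
  shows "dird (\<lambda>y. christoffel_form G y u w) z x $ k =
    (\<Sum>i\<in>UNIV. \<Sum>j\<in>UNIV. dird (\<lambda>y. christoffel G y k i j) z x * u $ i * w $ j)"
proof -
  have "((\<lambda>y. christoffel_form G y u w $ k) has_derivative
     (\<lambda>z. \<Sum>i\<in>UNIV. \<Sum>j\<in>UNIV. dird (\<lambda>y. christoffel G y k i j) z x * u $ i * w $ j)) (at x)"
    unfolding christoffel_form_def
    using Ck_on_differentiable[OF Ck_christoffel[of 1] _ x]
    by (simp, intro has_derivative_sum has_derivative_mult_left has_derivative_dird) auto
  from has_derivative_unique[OF bounded_linear.has_derivative[OF bounded_linear_vec_nth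
        has_derivative_dird[OF christoffel_form_differentiable[OF x]]] this]
  show ?thesis by (rule fun_cong)
qed

lemma christoffel_form_curve:
  assumes "(x has_vector_derivative x') (at t)" "(a has_vector_derivative a') (at t)"
    "(b has_vector_derivative b') (at t)" and x: "x t \<in> U"
  shows "((\<lambda>t. christoffel_form G (x t) (a t) (b t)) has_vector_derivative
    dird (\<lambda>y. christoffel_form G y (a t) (b t)) x' (x t)
    + christoffel_form G (x t) a' (b t) + christoffel_form G (x t) (a t) b') (at t)"
proof (rule has_vector_derivative_vecI)
  fix k
  have "((\<lambda>t. christoffel G (x t) k i j * a t $ i * b t $ j) has_real_derivative
     (dird (\<lambda>y. christoffel G y k i j) x' (x t) * a t $ i + a' $ i * christoffel G (x t) k i j) * b t $ j
      + b' $ j * (christoffel G (x t) k i j * a t $ i)) (at t)" for i j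
    using Ck_on_differentiable[OF Ck_christoffel[of 1] _ x] assms
    by (intro DERIV_mult curve_has_real_derivative real_derivative_nth) auto
  then have "((\<lambda>t. \<Sum>i\<in>UNIV. \<Sum>j\<in>UNIV. christoffel G (x t) k i j * a t $ i * b t $ j) has_real_derivative
    (\<Sum>i\<in>UNIV. \<Sum>j\<in>UNIV. (dird (\<lambda>y. christoffel G y k i j) x' (x t) * a t $ i + a' $ i * christoffel G (x t) k i j) * b t $ j
      + b' $ j * (christoffel G (x t) k i j * a t $ i))) (at t)"
    by (intro DERIV_sum)
  moreover have "(\<Sum>i\<in>UNIV. \<Sum>j\<in>UNIV. (dird (\<lambda>y. christoffel G y k i j) x' (x t) * a t $ i + a' $ i * christoffel G (x t) k i j) * b t $ j
      + b' $ j * (christoffel G (x t) k i j * a t $ i)) = (dird (\<lambda>y. christoffel_form G y (a t) (b t)) x' (x t)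
    + christoffel_form G (x t) a' (b t) + christoffel_form G (x t) (a t) b') $ k"
    by (simp only: vector_add_component dird_christoffel_form_nth[OF x])
      (simp add: christoffel_form_def sum.distrib algebra_simps)
  ultimately show "((\<lambda>t. christoffel_form G (x t) (a t) (b t) $ k) has_real_derivative (dird (\<lambda>y. christoffel_form G y (a t) (b t)) x' (x t)
    + christoffel_form G (x t) a' (b t) + christoffel_form G (x t) (a t) b') $ k) (at t)"
    by (simp add: christoffel_form_def)
qed

end

section \<open>The volume density along radial geodesics\<close>

text \<open>\<open>E\<close> stands for the exponential map read in a chart around the base point
  \<open>E 0\<close>. The equation is demanded only at times strictly between 0 and 1: a ray is
  identified with a geodesic on the closed unit interval, which determines its derivatives at
  interior times.\<close>

locale radial_geodesics = chart_metric U G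
  for U :: "(real ^ 'n::finite) set" and G +
  fixes E :: "real ^ 'n \<Rightarrow> real ^ 'n" and e :: real
  assumes e_pos: "e > 0" and smooth_E: "smooth_on (ball 0 e) E" and E_U: "E ` ball 0 e \<subseteq> U"
    and dE0: "\<And>v. dird E v 0 = v"
    and geodesic_E: "\<And>v t. norm v < e \<Longrightarrow> 0 < t \<Longrightarrow> t < 1 \<Longrightarrow>
      dird (dird E v) v (t *\<^sub>R v) +
        christoffel_form G (E (t *\<^sub>R v)) (dird E v (t *\<^sub>R v)) (dird E v (t *\<^sub>R v)) = 0"
begin

section \<open>Derivatives of the exponential map at the origin up to order three\<close>

abbreviation "\<Gamma> \<equiv> christoffel_form G (E 0)"
abbreviation "d\<Gamma> u v w \<equiv> dird (\<lambda>y. christoffel_form G y v w) u (E 0)"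
abbreviation "d2E u v \<equiv> dird (dird E u) v 0"
abbreviation "d3E u v w \<equiv> dird (dird (dird E u) v) w 0"

lemma E0_U: "E 0 \<in> U" using E_U e_pos by auto

lemma smooth_dE: "smooth_on (ball 0 e) (dird E u)" "smooth_on (ball 0 e) (dird (dird E u) v)"
  using smooth_on_dird smooth_E by blast+

lemma dE_line:
  assumes "norm (t *\<^sub>R v) < e"
  shows "((\<lambda>t. E (t *\<^sub>R v)) has_vector_derivative dird E v (t *\<^sub>R v)) (at t)"
    "((\<lambda>t. dird E u (t *\<^sub>R v)) has_vector_derivative dird (dird E u) v (t *\<^sub>R v)) (at t)"
    "((\<lambda>t. dird (dird E u) w (t *\<^sub>R v)) has_vector_derivative dird (dird (dird E u) w) v (t *\<^sub>R v)) (at t)"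
proof -
  have *: "((\<lambda>t. f (t *\<^sub>R v)) has_vector_derivative dird f v (t *\<^sub>R v)) (at t)"
    if "smooth_on (ball 0 e) f" for f :: "real ^ 'n \<Rightarrow> real ^ 'n"
    using line_has_vector_derivative[of f 0 t v] smooth_on_differentiable[OF that, of "t *\<^sub>R v"] assms
    by simp
  show "((\<lambda>t. E (t *\<^sub>R v)) has_vector_derivative dird E v (t *\<^sub>R v)) (at t)"
    "((\<lambda>t. dird E u (t *\<^sub>R v)) has_vector_derivative dird (dird E u) v (t *\<^sub>R v)) (at t)"
    "((\<lambda>t. dird (dird E u) w (t *\<^sub>R v)) has_vector_derivative dird (dird (dird E u) w) v (t *\<^sub>R v)) (at t)"
    by (rule * smooth_E smooth_dE)+
qed

lemma dE_differentiable:
  "E differentiable (at 0)" "dird E u differentiable (at 0)" "dird (dird E u) v differentiable (at 0)"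
  by (rule smooth_on_differentiable[OF smooth_E] smooth_on_differentiable[OF smooth_dE(1)]
      smooth_on_differentiable[OF smooth_dE(2)]; use e_pos in simp)+

lemma d2E_sym: "d2E u v = d2E v u"
  using smooth_E e_pos by (intro dird_symmetric[of "ball 0 e"]) (auto simp: smooth_on_def)

lemma d3E_sym: "d3E u v w = d3E u w v" "d3E u v w = d3E v u w"
proof -
  show "d3E u v w = d3E u w v"
    using smooth_dE e_pos by (intro dird_symmetric[of "ball 0 e"]) (auto simp: smooth_on_def)
  show "d3E u v w = d3E v u w"
  proof (rule dird_cong_open(1)[of "ball 0 e"])
    show "dird (dird E u) v y = dird (dird E v) u y" if "y \<in> ball 0 e" for y
      using smooth_E that by (intro dird_symmetric[of "ball 0 e"]) (auto simp: smooth_on_def)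
  qed (use dE_differentiable e_pos in auto)
qed

lemma linear_d2E: "linear (d2E u)" "linear (\<lambda>u. d2E u v)"
proof -
  show 1: "linear (d2E u)" for u
    by (intro linear_dird dE_differentiable)
  show "linear (\<lambda>u. d2E u v)" using 1[of v] by (subst d2E_sym)
qed

lemma linear_d3E: "linear (d3E u v)" "linear (\<lambda>v. d3E u v w)" "linear (\<lambda>u. d3E u v w)"
proof -
  show 1: "linear (d3E u v)" for u v
    by (intro linear_dird dE_differentiable)
  show "linear (\<lambda>v. d3E u v w)" for u using 1[of u w] by (subst d3E_sym(1))
  then show "linear (\<lambda>u. d3E u v w)" by (subst d3E_sym(2))
qed

lemma linear_d\<Gamma>: "linear (\<lambda>u. d\<Gamma> u v w)" "linear (\<lambda>v. d\<Gamma> u v w)" "linear (\<lambda>w. d\<Gamma> u v w)"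
proof -
  show "linear (\<lambda>u. d\<Gamma> u v w)"
    by (intro linear_dird christoffel_form_differentiable E0_U)
  show "linear (\<lambda>v. d\<Gamma> u v w)" "linear (\<lambda>w. d\<Gamma> u v w)"
    by (rule linearI; simp add: vec_eq_iff dird_christoffel_form_nth[OF E0_U]
        algebra_simps sum.distrib sum_distrib_left)+
qed

lemma d\<Gamma>_sym: "d\<Gamma> u v w = d\<Gamma> u w v"
  by (rule dird_cong_open(1)[OF open_U E0_U])
    (auto intro: christoffel_form_sym christoffel_form_differentiable E0_U)

lemma small_scalar: obtains s where "s > 0" "norm (s *\<^sub>R v) < e"
proof
  show "e / (norm v + 1) > 0" using e_pos by (simp add: add_nonneg_pos)
  have "norm ((e / (norm v + 1)) *\<^sub>R v) = e * (norm v / (norm v + 1))"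
    using e_pos by (simp add: add_nonneg_pos)
  also have "\<dots> < e * 1" using e_pos by (intro mult_strict_left_mono) (auto simp: add_nonneg_pos)
  finally show "norm ((e / (norm v + 1)) *\<^sub>R v) < e" by simp
qed

text \<open>The left-hand side of the geodesic equation, as a function of time along the ray,
  vanishes between times 0 and 1. Its value at 0 yields the second derivative of \<open>E\<close>,
  and its own derivative at 0 yields the third.\<close>

lemma jet_small:
  assumes v: "norm v < e"
  shows "d2E v v = - \<Gamma> v v" "d3E v v v = - d\<Gamma> v v v + 2 *\<^sub>R \<Gamma> (\<Gamma> v v) v"
proof -
  let ?a = "\<lambda>t. dird E v (t *\<^sub>R v)"
  let ?h = "\<lambda>t. dird (dird E v) v (t *\<^sub>R v) + christoffel_form G (E (t *\<^sub>R v)) (?a t) (?a t)"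
  have n0: "norm (0 *\<^sub>R v) < e" using e_pos by simp
  have h: "(?h has_vector_derivative d3E v v v + (d\<Gamma> v v v + \<Gamma> (d2E v v) v + \<Gamma> v (d2E v v))) (at 0)"
    using christoffel_form_curve[OF dE_line(1,2,2)[OF n0]] dE_line(3)[OF n0, of v v] E0_U
    by (auto simp: dE0 intro!: has_vector_derivative_add)
  from vanishing_right_jet[OF h zero_less_one geodesic_E[OF v]]
  have "?h 0 = 0" and 2: "d3E v v v + (d\<Gamma> v v v + \<Gamma> (d2E v v) v + \<Gamma> v (d2E v v)) = 0" by auto
  then show 1: "d2E v v = - \<Gamma> v v" by (simp add: dE0 eq_neg_iff_add_eq_0)
  have g: "\<Gamma> v (d2E v v) = - \<Gamma> (\<Gamma> v v) v" "\<Gamma> (d2E v v) v = - \<Gamma> (\<Gamma> v v) v"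
    using christoffel_form_sym[OF E0_U, of v "\<Gamma> v v"]
    by (simp_all add: 1 linear_neg[OF christoffel_form_linear1] linear_neg[OF christoffel_form_linear2])
  have "d3E v v v = - (d\<Gamma> v v v + \<Gamma> (d2E v v) v + \<Gamma> v (d2E v v))"
    using 2 unfolding eq_neg_iff_add_eq_0 .
  then show "d3E v v v = - d\<Gamma> v v v + 2 *\<^sub>R \<Gamma> (\<Gamma> v v) v"
    unfolding g scaleR_2 by simp
qed


text \<open>Both identities are homogeneous in \<open>v\<close>, of degree 2 and 3, so the
  restriction to short vectors is removed by scaling.\<close>

lemma jet:
  shows "d2E v v = - \<Gamma> v v" "d3E v v v = - d\<Gamma> v v v + 2 *\<^sub>R \<Gamma> (\<Gamma> v v) v"
proof -
  obtain s where s: "s > 0" "norm (s *\<^sub>R v) < e" using small_scalar .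
  have g: "\<Gamma> (c *\<^sub>R u) (d *\<^sub>R w) = (c * d) *\<^sub>R \<Gamma> u w" for c d u w
    by (simp add: linear_cmul[OF christoffel_form_linear1] linear_cmul[OF christoffel_form_linear2])
  have dg: "d\<Gamma> (s *\<^sub>R v) (s *\<^sub>R v) (s *\<^sub>R v) = (s * (s * s)) *\<^sub>R d\<Gamma> v v v"
    by (simp only: linear_cmul[OF linear_d\<Gamma>(1)] linear_cmul[OF linear_d\<Gamma>(2)]
        linear_cmul[OF linear_d\<Gamma>(3)] scaleR_scaleR)
  have d2: "d2E (s *\<^sub>R v) (s *\<^sub>R v) = (s * s) *\<^sub>R d2E v v"
    by (simp only: linear_cmul[OF linear_d2E(1)] linear_cmul[OF linear_d2E(2)] scaleR_scaleR)
  have d3: "d3E (s *\<^sub>R v) (s *\<^sub>R v) (s *\<^sub>R v) = (s * (s * s)) *\<^sub>R d3E v v v"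
    by (simp only: linear_cmul[OF linear_d3E(1)] linear_cmul[OF linear_d3E(2)]
        linear_cmul[OF linear_d3E(3)] scaleR_scaleR)
  have "(s * s) *\<^sub>R d2E v v = (s * s) *\<^sub>R (- \<Gamma> v v)"
    using jet_small(1)[OF s(2)] unfolding d2 g by simp
  then show "d2E v v = - \<Gamma> v v" using s(1) unfolding scaleR_cancel_left by simp
  have "(s * (s * s)) *\<^sub>R d3E v v v = (s * (s * s)) *\<^sub>R (- d\<Gamma> v v v + 2 *\<^sub>R \<Gamma> (\<Gamma> v v) v)"
    using jet_small(2)[OF s(2)] unfolding d3 dg g by (simp add: algebra_simps)
  then show "d3E v v v = - d\<Gamma> v v v + 2 *\<^sub>R \<Gamma> (\<Gamma> v v) v"
    using s(1) unfolding scaleR_cancel_left by simp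
qed

lemma d2E_eq: "d2E u v = - \<Gamma> u v"
proof -
  have "2 *\<^sub>R d2E u v = d2E (u + v) (u + v) - d2E u u - d2E v v"
    using d2E_sym[of v u] by (simp add: linear_add[OF linear_d2E(1)] linear_add[OF linear_d2E(2)] scaleR_2)
  also have "\<dots> = 2 *\<^sub>R (- \<Gamma> u v)"
    unfolding jet using christoffel_form_sym[OF E0_U, of v u]
    by (simp add: linear_add[OF christoffel_form_linear1] linear_add[OF christoffel_form_linear2] scaleR_2)
  finally show ?thesis unfolding scaleR_cancel_left by simp
qed

lemma linear_\<Gamma>2: "linear (\<lambda>u. \<Gamma> (\<Gamma> u v) w)" "linear (\<lambda>v. \<Gamma> (\<Gamma> u v) w)" "linear (\<lambda>w. \<Gamma> (\<Gamma> u v) w)"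
  using linear_compose[OF christoffel_form_linear1 christoffel_form_linear1]
    linear_compose[OF christoffel_form_linear2 christoffel_form_linear1] christoffel_form_linear2
  by (auto simp: o_def)

text \<open>Third derivatives commute, so their diagonal values polarize. The symmetry of the
  Christoffel form in its two arguments identifies two of the three resulting terms of each kind,
  whence the inner factors 2.\<close>

lemma d3E_eq:
  "3 *\<^sub>R d3E v v w = - (d\<Gamma> w v v + 2 *\<^sub>R d\<Gamma> v v w) + 2 *\<^sub>R (\<Gamma> (\<Gamma> v v) w + 2 *\<^sub>R \<Gamma> (\<Gamma> v w) v)"
proof -
  let ?C = "\<lambda>u v w. - d\<Gamma> u v w + 2 *\<^sub>R \<Gamma> (\<Gamma> u v) w"
  have "3 *\<^sub>R d3E v v w = ?C w v v + ?C v w v + ?C v v w"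
  proof (rule trilinear_polarization[of "\<lambda>u v w. d3E u v w" ?C])
    show "linear (\<lambda>w. ?C u v w)" "linear (\<lambda>v. ?C u v w)" "linear (\<lambda>u. ?C u v w)" for u v w
      by (intro linear_compose_add linear_compose_neg linear_compose_scale_right linear_d\<Gamma> linear_\<Gamma>2)+
  qed (fact linear_d3E d3E_sym jet(2))+
  then show ?thesis
    using d\<Gamma>_sym[of v w v] christoffel_form_sym[OF E0_U, of w v]
    unfolding scaleR_2 by (simp add: algebra_simps)
qed

end

section \<open>The squared density along rays and its second derivative\<close>

context radial_geodesics begin

definition jac :: "real ^ 'n \<Rightarrow> real ^ 'n ^ 'n" where
  "jac x = matrix (\<lambda>w. dird E w x)"

text \<open>Up to the sign of \<open>det G\<close>, this is the square of the volume density in normal coordinates. Unlike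
  the density itself, it is a polynomial in smooth functions.\<close>

definition dens2 :: "real ^ 'n \<Rightarrow> real" where
  "dens2 x = det (G (E x)) * (det (jac x))\<^sup>2"

lemma jac_nth: "jac x $ i $ j = dird E (axis j 1) x $ i"
  by (simp add: jac_def matrix_def)

lemma jac_0: "jac 0 = mat 1"
  by (simp add: vec_eq_iff jac_nth dE0 mat_def axis_def)

lemma Ck_jac: "Ck_on k (ball 0 e) (\<lambda>x. jac x $ i $ j)"
  unfolding jac_nth using smooth_dE(1) by (intro Ck_on_nth) (auto simp: smooth_on_def)

lemma Ck_dens2: "Ck_on k (ball 0 e) dens2"
proof -
  have G: "Ck_on k (ball 0 e) (\<lambda>x. det (G (E x)))"
    using smooth_E by (intro Ck_on_compose[OF _ open_U E_U Ck_on_det[OF open_U Ck_G]]) (auto simp: smooth_on_def)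
  show ?thesis
    unfolding dens2_def power2_eq_square by (intro Ck_on_mult G Ck_on_det Ck_jac) auto
qed

lemma dens2_0: "dens2 0 = det (G (E 0))"
  by (simp add: dens2_def jac_0)

lemma det_jac_nonzero: obtains d where "d > 0" "d \<le> e" "\<And>x. norm x < d \<Longrightarrow> det (jac x) \<noteq> 0"
proof -
  have "continuous_on (ball 0 e) (\<lambda>x. det (jac x))"
    by (intro Ck_on_continuous Ck_on_det Ck_jac) auto
  then have "continuous (at 0) (\<lambda>x. det (jac x))"
    using e_pos by (simp add: continuous_on_eq_continuous_at)
  then have "((\<lambda>x. det (jac x)) \<longlongrightarrow> det (jac 0)) (nhds 0)"
    using tendsto_at_iff_tendsto_nhds[of "\<lambda>x. det (jac x)" 0] by (simp add: isCont_def)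
  then have "\<forall>\<^sub>F x in nhds 0. det (jac x) \<in> - {0}"
    by (rule topological_tendstoD) (auto simp: jac_0)
  then obtain d where "d > 0" "\<And>x. norm x < d \<Longrightarrow> det (jac x) \<noteq> 0"
    unfolding eventually_nhds_metric by (auto simp: dist_norm)
  then show ?thesis using that[of "min d e"] e_pos by auto
qed

text \<open>The logarithmic derivative of \<open>det (jac x)\<close> along the ray, in the trace
  form of Jacobi's formula.\<close>

definition tau :: "real ^ 'n \<Rightarrow> real \<Rightarrow> real" where
  "tau v t = trace (matrix_inv (jac (t *\<^sub>R v)) ** (\<chi> i j. dird (dird E (axis j 1)) v (t *\<^sub>R v) $ i))"

text \<open>Half the logarithmic derivative of \<open>det (G (E x))\<close> along the ray, as a
  contracted Christoffel form.\<close>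

definition theta :: "real ^ 'n \<Rightarrow> real \<Rightarrow> real" where
  "theta v t = (\<Sum>k\<in>UNIV. christoffel_form G (E (t *\<^sub>R v)) (axis k 1) (dird E v (t *\<^sub>R v)) $ k)"

lemma jac_deriv:
  assumes "norm (t *\<^sub>R v) < e"
  shows "((\<lambda>t. jac (t *\<^sub>R v) $ i $ j) has_real_derivative
    (\<chi> i j. dird (dird E (axis j 1)) v (t *\<^sub>R v) $ i) $ i $ j) (at t)"
  unfolding jac_nth using real_derivative_nth[OF dE_line(2)[OF assms]] by simp

text \<open>Jacobi's formula for both determinants: the metric factor contributes
  \<open>2 * theta v t\<close>, and the Jacobian factor, being squared, contributes
  \<open>2 * tau v t\<close>.\<close>

lemma dens2_line_deriv:
  assumes t: "norm (t *\<^sub>R v) < e" and nz: "det (jac (t *\<^sub>R v)) \<noteq> 0"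
  shows "((\<lambda>t. dens2 (t *\<^sub>R v)) has_real_derivative 2 * dens2 (t *\<^sub>R v) * (theta v t + tau v t)) (at t)"
proof -
  let ?x = "t *\<^sub>R v"
  have U: "E ?x \<in> U" using E_U t by auto
  have J: "((\<lambda>t. det (jac (t *\<^sub>R v))) has_real_derivative det (jac ?x) * tau v t) (at t)"
    unfolding tau_def by (rule det_has_derivative[OF jac_deriv[OF t] nz])
  have "((\<lambda>t. G (E (t *\<^sub>R v)) $ i $ j) has_real_derivative
      (\<chi> i j. dird (\<lambda>y. G y $ i $ j) (dird E v ?x) (E ?x)) $ i $ j) (at t)" for i j
    using curve_has_real_derivative[OF _ dE_line(1)[OF t], of "\<lambda>y. G y $ i $ j"]
      Ck_on_differentiable[OF Ck_G[of 1] _ U] by simp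
  note D' = det_has_derivative[OF this det_G[OF U]]
  have "trace (matrix_inv (G (E ?x)) ** (\<chi> i j. dird (\<lambda>y. G y $ i $ j) (dird E v ?x) (E ?x))) = 2 * theta v t"
    using christoffel_form_contraction[OF U, of "dird E v ?x"] by (simp add: theta_def)
  with D' have D: "((\<lambda>t. det (G (E (t *\<^sub>R v)))) has_real_derivative det (G (E ?x)) * (2 * theta v t)) (at t)"
    by (simp only:)
  show ?thesis
    unfolding dens2_def power2_eq_square
    by (rule DERIV_cong[OF DERIV_mult[OF D DERIV_mult[OF J J]]]) (simp add: algebra_simps)
qed

lemma theta_0: "theta v 0 = (\<Sum>k\<in>UNIV. \<Gamma> (axis k 1) v $ k)"
  by (simp add: theta_def dE0)

text \<open>The opposite of \<open>theta_0\<close>, because the second derivative of the exponential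
  map at 0 is minus the Christoffel form. This cancellation makes 0 a critical point of the squared
  density.\<close>

lemma tau_0: "tau v 0 = - (\<Sum>k\<in>UNIV. \<Gamma> (axis k 1) v $ k)"
proof -
  have "matrix_inv (mat 1 :: real ^ 'n ^ 'n) = mat 1"
    using matrix_inv_inverse(1)[of "mat 1 :: real ^ 'n ^ 'n"] by simp
  then show ?thesis by (simp add: tau_def jac_0 trace_def d2E_eq sum_negf)
qed

lemma theta_deriv:
  "(theta v has_real_derivative (\<Sum>k\<in>UNIV. (d\<Gamma> v (axis k 1) v - \<Gamma> (axis k 1) (\<Gamma> v v)) $ k)) (at 0)"
proof -
  have n0: "norm (0 *\<^sub>R v) < e" using e_pos by simp
  have z: "\<Gamma> 0 w = 0" for w using linear_0[OF christoffel_form_linear1] .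
  have "((\<lambda>t. christoffel_form G (E (t *\<^sub>R v)) (axis k 1) (dird E v (t *\<^sub>R v))) has_vector_derivative
    d\<Gamma> v (axis k 1) v - \<Gamma> (axis k 1) (\<Gamma> v v)) (at 0)" for k
    using christoffel_form_curve[OF dE_line(1)[OF n0] has_vector_derivative_const[of "axis k 1"] dE_line(2)[OF n0]] E0_U
    by (simp add: dE0 d2E_eq z linear_neg[OF christoffel_form_linear2])
  from real_derivative_nth[OF this] show ?thesis
    unfolding theta_def by (intro DERIV_sum)
qed

lemma tau_deriv:
  "(tau v has_real_derivative (\<Sum>k\<in>UNIV. (d3E (axis k 1) v v - \<Gamma> (\<Gamma> (axis k 1) v) v) $ k)) (at 0)"
proof -
  let ?A' = "\<lambda>t. (\<chi> i j. dird (dird E (axis j 1)) v (t *\<^sub>R v) $ i) :: real ^ 'n ^ 'n"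
  obtain d where d: "d > 0" "d \<le> e" "\<And>x. norm x < d \<Longrightarrow> det (jac x) \<noteq> 0" using det_jac_nonzero by metis
  define r where "r = d / (norm v + 1)"
  have r: "r > 0" using d by (simp add: r_def add_nonneg_pos)
  have small: "norm (s *\<^sub>R v) < d" if "\<bar>s\<bar> < r" for s
  proof -
    have "norm (s *\<^sub>R v) \<le> \<bar>s\<bar> * (norm v + 1)" by (simp add: mult_left_mono)
    also have "\<dots> < r * (norm v + 1)" using that by (intro mult_strict_right_mono) (auto simp: add_nonneg_pos)
    also have "\<dots> = d" by (simp add: r_def add_nonneg_eq_0_iff)
    finally show ?thesis .
  qed
  have n0: "norm (0 *\<^sub>R v) < e" using e_pos by simp
  have A': "((\<lambda>t. ?A' t $ i $ j) has_real_derivative (\<chi> i j. d3E (axis j 1) v v $ i) $ i $ j) (at 0)" for i j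
    using real_derivative_nth[OF dE_line(3)[OF n0]] by simp
  have D: "(tau v has_real_derivative trace (\<chi> i j. d3E (axis j 1) v v $ i) - trace (?A' 0 ** ?A' 0)) (at 0)"
    unfolding tau_def
    using small d r by (intro trace_matrix_inv_mult_deriv[OF r jac_deriv A'])
      (auto simp: jac_0 intro: order_less_le_trans)
  \<comment> \<open>\<open>?A' 0\<close> is the matrix of the map sending \<open>w\<close> to
    \<open>d2E w v\<close>, which is minus the Christoffel form; the sign disappears in the
    square.\<close>
  have "(?A' 0 ** ?A' 0) $ i $ i = \<Gamma> (\<Gamma> (axis i 1) v) v $ i" for i
  proof -
    let ?w = "\<Gamma> (axis i 1) v"
    have "\<Gamma> ?w v = (\<Sum>k\<in>UNIV. ?w $ k *\<^sub>R \<Gamma> (axis k 1) v)"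
      by (subst (1) basis_expansion[of ?w, symmetric])
        (simp add: linear_sum[OF christoffel_form_linear1] linear_cmul[OF christoffel_form_linear1] scalar_mult_eq_scaleR)
    then show ?thesis
      by (simp add: matrix_matrix_mult_def d2E_eq sum_component mult.commute)
  qed
  then have "trace (\<chi> i j. d3E (axis j 1) v v $ i) - trace (?A' 0 ** ?A' 0) =
     (\<Sum>k\<in>UNIV. (d3E (axis k 1) v v - \<Gamma> (\<Gamma> (axis k 1) v) v) $ k)"
    by (simp add: trace_def sum_subtractf)
  then show ?thesis using D by simp
qed

definition ric0 :: "real ^ 'n \<Rightarrow> real" where
  "ric0 v = trace (matrix (\<lambda>w. riemann G (\<lambda>_. w) (\<lambda>_. v) (\<lambda>_. v) (E 0)))"

text \<open>The identity holds for each \<open>w\<close> before any summation: the factor 3 clears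
  the denominator of \<open>d3E_eq\<close>, and the Christoffel terms recombine into minus the
  curvature vector \<open>R(w, v)v\<close>. Summing the diagonal components gives minus the Ricci
  trace.\<close>

lemma theta_tau_deriv: "((\<lambda>t. theta v t + tau v t) has_real_derivative - ric0 v / 3) (at 0)"
proof (rule DERIV_cong[OF DERIV_add[OF theta_deriv tau_deriv]])
  let ?R = "\<lambda>w. riemann G (\<lambda>_. w) (\<lambda>_. v) (\<lambda>_. v) (E 0)"
  have "3 * (d\<Gamma> v w v - \<Gamma> w (\<Gamma> v v) + (d3E w v v - \<Gamma> (\<Gamma> w v) v)) $ k = - ?R w $ k" for w k
  proof -
    have "d3E w v v = d3E v v w" using d3E_sym by metis
    then have "3 * d3E w v v $ k = (- (d\<Gamma> w v v + 2 *\<^sub>R d\<Gamma> v v w) + 2 *\<^sub>R (\<Gamma> (\<Gamma> v v) w + 2 *\<^sub>R \<Gamma> (\<Gamma> v w) v)) $ k"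
      unfolding d3E_eq[symmetric] by simp
    then have "3 * d3E w v v $ k = - d\<Gamma> w v v $ k - 2 * d\<Gamma> v w v $ k + 2 * \<Gamma> w (\<Gamma> v v) $ k + 4 * \<Gamma> (\<Gamma> w v) v $ k"
      using christoffel_form_sym[OF E0_U, of v w] christoffel_form_sym[OF E0_U, of "\<Gamma> v v" w] d\<Gamma>_sym[of v w v]
      by simp
    moreover have "\<Gamma> v (\<Gamma> w v) = \<Gamma> (\<Gamma> w v) v" by (rule christoffel_form_sym[OF E0_U])
    ultimately show ?thesis
      unfolding riemann_const[OF E0_U] by simp
  qed
  then have "3 * ((\<Sum>k\<in>UNIV. (d\<Gamma> v (axis k 1) v - \<Gamma> (axis k 1) (\<Gamma> v v)) $ k) +
    (\<Sum>k\<in>UNIV. (d3E (axis k 1) v v - \<Gamma> (\<Gamma> (axis k 1) v) v) $ k)) = - ric0 v"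
    unfolding sum.distrib[symmetric] sum_distrib_left
    by (simp add: ric0_def trace_def matrix_def sum_negf)
  then show "(\<Sum>k\<in>UNIV. (d\<Gamma> v (axis k 1) v - \<Gamma> (axis k 1) (\<Gamma> v v)) $ k) +
    (\<Sum>k\<in>UNIV. (d3E (axis k 1) v v - \<Gamma> (\<Gamma> (axis k 1) v) v) $ k) = - ric0 v / 3" by simp
qed

text \<open>In the derivative of the formula for the logarithmic derivative, the term with the
  derivative of \<open>dens2\<close> drops out because the sum \<open>theta v 0 + tau v 0\<close> is
  0. What remains is \<open>2 * dens2 0\<close> times the derivative of that sum, hence the factor
  2/3, twice the Taylor coefficient 1/3.\<close>

lemma dens2_jet:
  shows "dird dens2 v 0 = 0" "dird (dird dens2 v) v 0 = - 2/3 * det (G (E 0)) * ric0 v"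
proof -
  obtain d where d: "d > 0" "d \<le> e" "\<And>x. norm x < d \<Longrightarrow> det (jac x) \<noteq> 0" using det_jac_nonzero by metis
  have diff: "dens2 differentiable (at x)" "dird dens2 v differentiable (at x)" if "norm x < e" for x
    using Ck_dens2[of 2] that by (auto simp: numeral_2_eq_2)
  have 1: "dird dens2 v (t *\<^sub>R v) = 2 * dens2 (t *\<^sub>R v) * (theta v t + tau v t)" if "norm (t *\<^sub>R v) < d" for t
    using DERIV_unique[OF dens2_line_deriv[of t v] line_has_real_derivative[of dens2 0 t v, simplified]] diff(1)[of "t *\<^sub>R v"] d that
    by force
  have z: "theta v 0 + tau v 0 = 0" by (simp add: theta_0 tau_0)
  from 1[of 0] z d show g0: "dird dens2 v 0 = 0" by simp
  have D0: "((\<lambda>t. dens2 (t *\<^sub>R v)) has_real_derivative 0) (at 0)"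
    using line_has_real_derivative[of dens2 0 0 v] diff(1)[of 0] e_pos g0 by simp
  have D1: "((\<lambda>t. 2 * dens2 (t *\<^sub>R v) * (theta v t + tau v t)) has_real_derivative
      2 * det (G (E 0)) * (- ric0 v / 3)) (at 0)"
    by (rule DERIV_cong[OF DERIV_mult[OF DERIV_cmult[OF D0] theta_tau_deriv]]) (simp add: z dens2_0)
  \<comment> \<open>The formula for the first derivative is known only near 0, where the Jacobian is
    invertible; that is enough to differentiate it at 0.\<close>
  have ev: "\<forall>\<^sub>F t in nhds 0. dird dens2 v (t *\<^sub>R v) = 2 * dens2 (t *\<^sub>R v) * (theta v t + tau v t)"
  proof -
    have "((\<lambda>t. t *\<^sub>R v) \<longlongrightarrow> 0 *\<^sub>R v) (nhds 0)" by (intro tendsto_intros filterlim_ident)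
    from tendstoD[OF this d(1)] show ?thesis
      by eventually_elim (simp add: 1 dist_norm)
  qed
  have "((\<lambda>t. dird dens2 v (t *\<^sub>R v)) has_real_derivative 2 * det (G (E 0)) * (- ric0 v / 3)) (at 0)"
    by (rule iffD2[OF DERIV_cong_ev[OF refl ev refl] D1])
  from DERIV_unique[OF this line_has_real_derivative[of "dird dens2 v" 0 0 v, simplified]] diff(2)[of 0] e_pos
  show "dird (dird dens2 v) v 0 = - 2/3 * det (G (E 0)) * ric0 v" by simp
qed

end

section \<open>Charts and the Gram matrix\<close>

locale smooth_atlas =
  fixes M :: "('a::{t2_space, second_countable_topology}, 'n::finite) chart set"
  assumes manifold: "smooth_manifold M"
begin

lemma is_chart: "c \<in> M \<Longrightarrow> is_chart c"
  using manifold by (simp add: smooth_manifold_def)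

lemma chart_open: "c \<in> M \<Longrightarrow> open (fst c)" "c \<in> M \<Longrightarrow> open (snd c ` fst c)"
  using is_chart by (auto simp: is_chart_def)

lemma chart_continuous: "c \<in> M \<Longrightarrow> continuous_on (fst c) (snd c)"
    "c \<in> M \<Longrightarrow> continuous_on (snd c ` fst c) (chart_inv c)"
  using is_chart by (auto simp: is_chart_def homeomorphism_def)

lemma chart_inv_snd: "c \<in> M \<Longrightarrow> q \<in> fst c \<Longrightarrow> chart_inv c (snd c q) = q"
  using is_chart by (auto simp: is_chart_def homeomorphism_def)

lemma chart_inj: "c \<in> M \<Longrightarrow> inj_on (snd c) (fst c)"
  by (metis chart_inv_snd inj_onI)

lemma chart_inv_in: "c \<in> M \<Longrightarrow> x \<in> snd c ` fst c \<Longrightarrow> chart_inv c x \<in> fst c"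
  by (auto simp: chart_inv_snd)

lemma chart_image_open:
  assumes c: "c \<in> M" and A: "open A"
  shows "open (snd c ` (fst c \<inter> A))"
proof -
  have "snd c ` (fst c \<inter> A) = snd c ` fst c \<inter> chart_inv c -` A"
    using chart_inv_snd[OF c] by force
  then show ?thesis
    using continuous_open_preimage[OF chart_continuous(2)[OF c] chart_open(2)[OF c] A] by simp
qed

lemma chart_at: "chart_at M q \<in> M" "q \<in> fst (chart_at M q)"
proof -
  have "\<exists>c. c \<in> M \<and> q \<in> fst c" using manifold unfolding smooth_manifold_def by blast
  then show "chart_at M q \<in> M" "q \<in> fst (chart_at M q)"
    unfolding chart_at_def by (metis (mono_tags, lifting) someI_ex)+
qed

abbreviation transition :: "('a, 'n) chart \<Rightarrow> ('a, 'n) chart \<Rightarrow> real ^ 'n \<Rightarrow> real ^ 'n" where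
  "transition c d \<equiv> snd d \<circ> chart_inv c"

lemma transition_smooth:
  "c \<in> M \<Longrightarrow> d \<in> M \<Longrightarrow> smooth_on (snd c ` (fst c \<inter> fst d)) (transition c d)"
  using manifold by (simp add: smooth_manifold_def)

lemma transition_differentiable:
  "c \<in> M \<Longrightarrow> d \<in> M \<Longrightarrow> q \<in> fst c \<Longrightarrow> q \<in> fst d \<Longrightarrow> transition c d differentiable (at (snd c q))"
  using smooth_on_differentiable[OF transition_smooth] by blast

text \<open>The identity of coordinate changes behind the chain rule holds only on the image of the
  overlap of \<open>c\<close> and \<open>d\<close>. That image is open, which suffices for comparing
  derivatives.\<close>

lemma transition_chain:
  assumes c: "c \<in> M" "d \<in> M" "b \<in> M" and q: "q \<in> fst c" "q \<in> fst d" "q \<in> fst b"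
  shows "dird (transition c b) v (snd c q) = dird (transition d b) (dird (transition c d) v (snd c q)) (snd d q)"
proof -
  have e: "snd d q = transition c d (snd c q)" using c q by (simp add: chart_inv_snd)
  note d1 = has_derivative_dird[OF transition_differentiable[OF c(1,2) q(1,2)]]
  note d2 = has_derivative_dird[OF transition_differentiable[OF c(2,3) q(2,3)], unfolded e]
  have "(transition c b has_derivative
     (\<lambda>v. dird (transition d b) (dird (transition c d) v (snd c q)) (transition c d (snd c q)))) (at (snd c q))"
  proof (rule has_derivative_transform_within_open[OF has_derivative_compose[OF d1 d2]])
    show "open (snd c ` (fst c \<inter> fst d))" using c chart_image_open chart_open by blast
  qed (use c q in \<open>auto simp: chart_inv_snd\<close>)
  from dird_eq[OF this] show ?thesis using c q by (simp add: chart_inv_snd)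
qed

lemma transition_self:
  assumes c: "c \<in> M" and q: "q \<in> fst c"
  shows "dird (transition c c) v (snd c q) = v"
proof -
  have "((\<lambda>x. x) has_derivative (\<lambda>v. v)) (at (snd c q))" by simp
  then have "(transition c c has_derivative (\<lambda>v. v)) (at (snd c q))"
    by (rule has_derivative_transform_within_open[OF _ chart_open(2)[OF c]])
      (use c q in \<open>auto simp: chart_inv_snd\<close>)
  from dird_eq[OF this] show ?thesis .
qed

lemma from_chart_transition:
  assumes "c \<in> M" "d \<in> M" "q \<in> fst c" "q \<in> fst d"
  shows "from_chart M c q v = from_chart M d q (dird (transition c d) v (snd c q))"
  unfolding from_chart_def using transition_chain[of c d "chart_at M q" q] chart_at assms by simp

lemma from_chart_at: "from_chart M (chart_at M q) q v = v"
  unfolding from_chart_def using transition_self chart_at by blast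

lemma linear_from_chart: "c \<in> M \<Longrightarrow> q \<in> fst c \<Longrightarrow> linear (from_chart M c q)"
  unfolding from_chart_def
  using linear_dird[OF transition_differentiable[of c "chart_at M q" q]] chart_at by simp

lemma det_transition_nonzero:
  assumes "c \<in> M" "d \<in> M" "q \<in> fst c" "q \<in> fst d"
  shows "det (matrix (\<lambda>v. dird (transition c d) v (snd c q))) \<noteq> 0"
proof -
  let ?J = "\<lambda>v. dird (transition c d) v (snd c q)" and ?K = "\<lambda>v. dird (transition d c) v (snd d q)"
  have "linear ?J" "linear ?K" using assms by (auto intro: linear_dird transition_differentiable)
  moreover have "?K \<circ> ?J = id"
    using transition_chain[of c d c q] transition_self assms by (auto simp: fun_eq_iff)
  ultimately have "matrix ?K ** matrix ?J = mat 1"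
    by (metis matrix_compose matrix_id_mat_1 id_def)
  then show ?thesis by (metis det_I det_mul mult_zero_right zero_neq_one)
qed

end

section \<open>Gram matrices and change of coordinates\<close>

lemma bilinear_matrix_expand:
  fixes B :: "real ^ 'n \<Rightarrow> real ^ 'n \<Rightarrow> real"
  assumes "bilinear B"
  shows "B v w = (\<Sum>i\<in>UNIV. \<Sum>j\<in>UNIV. v $ i * w $ j * B (axis i 1) (axis j 1))"
proof -
  have l: "linear (\<lambda>v. B v w)" "linear (B v)" for v w using assms by (auto simp: bilinear_def)
  have "B v w = (\<Sum>i\<in>UNIV. v $ i * B (axis i 1) w)"
    by (subst basis_expansion[of v, symmetric])
      (simp add: linear_sum[OF l(1)] linear_cmul[OF l(1)] scalar_mult_eq_scaleR)
  also have "\<dots> = (\<Sum>i\<in>UNIV. v $ i * (\<Sum>j\<in>UNIV. w $ j * B (axis i 1) (axis j 1)))"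
    by (rule sum.cong[OF refl], subst basis_expansion[of w, symmetric])
      (simp add: linear_sum[OF l(2)] linear_cmul[OF l(2)] scalar_mult_eq_scaleR)
  finally show ?thesis by (simp add: sum_distrib_left mult.assoc)
qed

lemma bilinear_pullback_matrix:
  fixes B :: "real ^ 'n \<Rightarrow> real ^ 'n \<Rightarrow> real" and f :: "real ^ 'n \<Rightarrow> real ^ 'n"
  assumes B: "bilinear B" and f: "linear f"
  shows "(\<chi> i j. B (f (axis i 1)) (f (axis j 1))) =
    transpose (matrix f) ** (\<chi> i j. B (axis i 1) (axis j 1)) ** matrix f"
proof -
  have "(transpose (matrix f) ** (\<chi> i j. B (axis i 1) (axis j 1)) ** matrix f) $ a $ b =
    (\<Sum>j\<in>UNIV. \<Sum>i\<in>UNIV. f (axis a 1) $ i * B (axis i 1) (axis j 1) * f (axis b 1) $ j)" for a b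
    by (simp add: matrix_matrix_mult_def transpose_def matrix_def sum_distrib_right)
  moreover have "\<dots> a b = B (f (axis a 1)) (f (axis b 1))" for a b
    by (subst bilinear_matrix_expand[OF B, of "f (axis a 1)"], subst sum.swap) (simp add: mult_ac)
  ultimately show ?thesis by (simp add: vec_eq_iff)
qed

lemma nondegenerate_det:
  fixes B :: "real ^ 'n \<Rightarrow> real ^ 'n \<Rightarrow> real"
  assumes B: "bilinear B" and n: "nondegenerate B" and s: "\<And>v w. B v w = B w v"
  shows "det (\<chi> i j. B (axis i 1) (axis j 1)) \<noteq> 0"
proof
  let ?A = "\<chi> i j. B (axis i 1) (axis j 1)"
  assume "det ?A = 0"
  then obtain v where v: "v \<noteq> 0" "?A *v v = 0"
    using matrix_left_invertible_ker[of ?A] invertible_det_nz[of ?A] by (auto simp: invertible_left_inverse)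
  have "B v w = 0" for w
  proof -
    have "B w v = (\<Sum>i\<in>UNIV. w $ i * (?A *v v) $ i)"
      by (subst bilinear_matrix_expand[OF B])
        (simp add: matrix_vector_mult_def sum_distrib_left mult_ac)
    then show ?thesis using v s by simp
  qed
  then show False using n v by (auto simp: nondegenerate_def)
qed

locale semi_riemannian_manifold =
  fixes M :: "('a::{t2_space, second_countable_topology}, 'n::finite) chart set"
    and g :: "('a, 'n) tensor2" and \<nu> :: nat
  assumes semi_riemannian: "semi_riemannian \<nu> M g"
begin

sublocale smooth_atlas M
  using semi_riemannian by unfold_locales (simp add: semi_riemannian_def)

lemma metric: "bilinear (g q)" "g q v w = g q w v" "nondegenerate (g q)"
  using semi_riemannian by (auto simp: semi_riemannian_def)

lemma gram_snd: "c \<in> M \<Longrightarrow> q \<in> fst c \<Longrightarrow>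
   gram M g c (snd c q) = (\<chi> i j. g q (from_chart M c q (axis i 1)) (from_chart M c q (axis j 1)))"
  by (simp add: gram_def chart_inv_snd Let_def)

lemma bilinear_from_chart:
  assumes "c \<in> M" "q \<in> fst c"
  shows "bilinear (\<lambda>v w. g q (from_chart M c q v) (from_chart M c q w))"
  using linear_compose[OF linear_from_chart[OF assms]] metric(1)[of q]
  unfolding bilinear_def o_def by blast

lemma gram_transform:
  assumes c: "c \<in> M" "d \<in> M" and q: "q \<in> fst c" "q \<in> fst d"
  defines "J \<equiv> matrix (\<lambda>v. dird (transition c d) v (snd c q))"
  shows "gram M g c (snd c q) = transpose J ** gram M g d (snd d q) ** J"
  using bilinear_pullback_matrix[OF bilinear_from_chart[OF c(2) q(2)], of "\<lambda>v. dird (transition c d) v (snd c q)"]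
    linear_dird[OF transition_differentiable[OF c q]]
  by (simp add: gram_snd c q J_def from_chart_transition[OF c q])

text \<open>The Jacobian determinant appears squared, so the root of the absolute value changes by
  the factor required in a change of variables. This is why chart volumes agree on overlaps.\<close>

lemma det_gram_transform:
  assumes c: "c \<in> M" "d \<in> M" and q: "q \<in> fst c" "q \<in> fst d"
  shows "det (gram M g c (snd c q)) =
    (det (matrix (\<lambda>v. dird (transition c d) v (snd c q))))\<^sup>2 * det (gram M g d (snd d q))"
  by (simp add: gram_transform[OF c q] det_mul det_transpose power2_eq_square)

lemma gram_at: "gram M g (chart_at M q) (snd (chart_at M q) q) = (\<chi> i j. g q (axis i 1) (axis j 1))"
  by (simp add: gram_snd chart_at from_chart_at)

lemma chart_metric_gram:
  assumes c: "c \<in> M" shows "chart_metric (snd c ` fst c) (gram M g c)"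
proof
  show "open (snd c ` fst c)" using chart_open c by blast
  show "smooth_on (snd c ` fst c) (gram M g c)" using semi_riemannian c by (simp add: semi_riemannian_def)
next
  fix x i j assume "x \<in> snd c ` fst c"
  then obtain q where q: "q \<in> fst c" "x = snd c q" by blast
  show "gram M g c x $ i $ j = gram M g c x $ j $ i" using metric(2) by (simp add: q gram_snd c)
  \<comment> \<open>In the preferred chart the Gram matrix is that of \<open>g q\<close> in the
    standard basis, where nondegeneracy applies directly; the transformation rule then carries the
    conclusion over to \<open>c\<close>.\<close>
  have "det (gram M g (chart_at M q) (snd (chart_at M q) q)) \<noteq> 0"
    unfolding gram_at by (rule nondegenerate_det) (rule metric)+
  then show "det (gram M g c x) \<noteq> 0"
    using det_gram_transform[of c "chart_at M q" q] det_transition_nonzero[of c "chart_at M q" q] chart_at c q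
    by auto
qed

end

section \<open>Geodesics in a chart\<close>

text \<open>Continuous partial derivatives are bounded on the compact set, and convexity allows the
  mean value inequality between any two of its points.\<close>

lemma Ck1_lipschitz:
  fixes f :: "'e::euclidean_space \<Rightarrow> 'f::real_normed_vector"
  assumes f: "Ck_on 1 S f" and K: "compact K" "convex K" "K \<subseteq> S"
  obtains L where "L \<ge> 0" "\<And>x y. x \<in> K \<Longrightarrow> y \<in> K \<Longrightarrow> norm (f x - f y) \<le> L * norm (x - y)"
proof -
  have "\<exists>B. \<forall>x\<in>K. norm (dird f b x) \<le> B" for b
  proof -
    have "continuous_on K (dird f b)" using f K(3) by (auto intro: continuous_on_subset)
    then have "bounded (dird f b ` K)" using K(1) compact_continuous_image compact_imp_bounded by blast
    then show ?thesis by (auto simp: bounded_iff)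
  qed
  then obtain B where B: "\<And>b x. x \<in> K \<Longrightarrow> norm (dird f b x) \<le> B b" by metis
  define L where "L = (\<Sum>b\<in>Basis. \<bar>B b\<bar>)"
  have d: "f differentiable (at x)" if "x \<in> K" for x using f K(3) that by auto
  have "norm (dird f v x) \<le> L * norm v" if x: "x \<in> K" for x v
  proof -
    have "norm (dird f v x) \<le> (\<Sum>b\<in>Basis. norm ((v \<bullet> b) *\<^sub>R dird f b x))"
      by (subst dird_expand[OF d[OF x]]) (rule norm_sum)
    also have "\<dots> \<le> (\<Sum>b\<in>Basis. norm v * \<bar>B b\<bar>)"
    proof (rule sum_mono)
      fix b :: 'e assume "b \<in> Basis"
      then have "\<bar>v \<bullet> b\<bar> * norm (dird f b x) \<le> norm v * \<bar>B b\<bar>"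
        using B[OF x, of b] by (intro mult_mono Basis_le_norm) auto
      then show "norm ((v \<bullet> b) *\<^sub>R dird f b x) \<le> norm v * \<bar>B b\<bar>" by simp
    qed
    finally show ?thesis by (simp add: L_def sum_distrib_left mult.commute)
  qed
  then have "onorm (\<lambda>v. dird f v x) \<le> L" if "x \<in> K" for x
    using that by (intro onorm_le) auto
  from differentiable_bound[OF K(2) has_derivative_at_withinI[OF has_derivative_dird[OF d]] this]
  have "norm (f x - f y) \<le> L * norm (x - y)" if "x \<in> K" "y \<in> K" for x y
    using that by blast
  then show ?thesis by (intro that[of L]) (auto simp: L_def sum_nonneg)
qed

text \<open>Gronwall's argument: the squared distance of two solutions, damped by
  \<open>exp (- 2 * L * s)\<close>, cannot increase, and it starts at 0.\<close>

lemma ode_unique: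
  fixes z w :: "real \<Rightarrow> 'e::euclidean_space"
  assumes z: "\<And>t. t \<in> {0..1} \<Longrightarrow> (z has_vector_derivative f (z t)) (at t)" "\<And>t. t \<in> {0..1} \<Longrightarrow> z t \<in> K"
    and w: "\<And>t. t \<in> {0..1} \<Longrightarrow> (w has_vector_derivative f (w t)) (at t)" "\<And>t. t \<in> {0..1} \<Longrightarrow> w t \<in> K"
    and L: "L \<ge> 0" "\<And>x y. x \<in> K \<Longrightarrow> y \<in> K \<Longrightarrow> norm (f x - f y) \<le> L * norm (x - y)"
    and init: "z 0 = w 0" and t: "t \<in> {0..1}"
  shows "z t = w t"
proof -
  define H where "H s = ((z s - w s) \<bullet> (z s - w s)) * exp (- 2 * L * s)" for s
  have decr: "\<exists>y. (H has_real_derivative y) (at s) \<and> y \<le> 0" if "0 \<le> s" "s \<le> t" for s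
  proof -
    let ?u = "z s - w s" and ?f = "f (z s) - f (w s)"
    have s: "s \<in> {0..1}" using that t by auto
    have d: "((\<lambda>s. z s - w s) has_vector_derivative ?f) (at s)"
      by (intro has_vector_derivative_diff z w s)
    have "((\<lambda>s. (z s - w s) \<bullet> (z s - w s)) has_real_derivative ?u \<bullet> ?f + ?f \<bullet> ?u) (at s)"
      using bounded_bilinear.has_vector_derivative[OF bounded_bilinear_inner d d]
      by (simp add: has_real_derivative_iff_has_vector_derivative)
    moreover have "((\<lambda>s. exp (- 2 * L * s)) has_real_derivative exp (- 2 * L * s) * (- 2 * L)) (at s)"
      by (auto intro!: derivative_eq_intros)
    ultimately have 1: "(H has_real_derivative (?u \<bullet> ?f + ?f \<bullet> ?u) * exp (- 2 * L * s) +
        exp (- 2 * L * s) * (- 2 * L) * (?u \<bullet> ?u)) (at s)"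
      unfolding H_def by (rule DERIV_mult)
    have "?u \<bullet> ?f \<le> norm ?u * norm ?f" by (rule norm_cauchy_schwarz)
    also have "\<dots> \<le> norm ?u * (L * norm ?u)" by (intro mult_left_mono L(2) z w s) auto
    also have "\<dots> = L * (?u \<bullet> ?u)" by (simp add: dot_square_norm power2_eq_square)
    finally have "(?u \<bullet> ?f + ?f \<bullet> ?u) - 2 * L * (?u \<bullet> ?u) \<le> 0" by (simp add: inner_commute)
    then have "exp (- 2 * L * s) * ((?u \<bullet> ?f + ?f \<bullet> ?u) - 2 * L * (?u \<bullet> ?u)) \<le> 0"
      by (intro mult_nonneg_nonpos) auto
    then have "(?u \<bullet> ?f + ?f \<bullet> ?u) * exp (- 2 * L * s) + exp (- 2 * L * s) * (- 2 * L) * (?u \<bullet> ?u) \<le> 0"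
      by (simp only: algebra_simps)
    then show ?thesis using 1 by blast
  qed
  have "0 \<le> t" using t by simp
  then have "H t \<le> H 0" by (rule DERIV_nonpos_imp_nonincreasing) (rule decr)
  then have "(z t - w t) \<bullet> (z t - w t) \<le> 0"
    by (simp add: H_def init mult_le_0_iff)
  then show ?thesis by (metis eq_iff_diff_eq_0 inner_ge_zero inner_eq_zero_iff order_antisym)
qed

lemma Ck_on_Pair:
  assumes "open S" "Ck_on k S f" "Ck_on k S h"
  shows "Ck_on k S (\<lambda>x. (f x, h x))"
proof -
  have "Ck_on k S (\<lambda>x. (f x, 0))"
    by (rule Ck_on_bounded_linear_compose[OF assms(1) _ assms(2)])
      (rule bounded_linear_Pair[OF bounded_linear_ident bounded_linear_zero])
  moreover have "Ck_on k S (\<lambda>x. (0, h x))"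
    by (rule Ck_on_bounded_linear_compose[OF assms(1) _ assms(3)])
      (rule bounded_linear_Pair[OF bounded_linear_zero bounded_linear_ident])
  ultimately show ?thesis using Ck_on_add[OF assms(1)] by fastforce
qed

context chart_metric begin

text \<open>The geodesic spray: the second-order geodesic equation written as a first-order system
  for position and velocity, so that \<open>ode_unique\<close> applies.\<close>

definition spray :: "(real ^ 'n) \<times> (real ^ 'n) \<Rightarrow> (real ^ 'n) \<times> (real ^ 'n)" where
  "spray z = (snd z, - christoffel_form G (fst z) (snd z) (snd z))"

lemma Ck_spray: "Ck_on k (U \<times> UNIV) spray"
proof -
  have o: "open (U \<times> (UNIV :: (real ^ 'n) set))" by (intro open_Times open_U open_UNIV)
  have s: "Ck_on k (U \<times> UNIV) (\<lambda>z. snd z :: real ^ 'n)" and f: "Ck_on k (U \<times> UNIV) (\<lambda>z. fst z :: real ^ 'n)"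
    by (intro Ck_on_bounded_linear bounded_linear_snd bounded_linear_fst)+
  have "Ck_on k (U \<times> UNIV) (\<lambda>z. 0 - christoffel_form G (fst z) (snd z) (snd z))"
    unfolding christoffel_form_def
    by (intro Ck_on_diff Ck_on_const Ck_on_vec o)
      (simp, intro Ck_on_sum Ck_on_mult Ck_on_compose[OF o open_U _ Ck_christoffel f] Ck_on_nth s o, auto)
  then show ?thesis unfolding spray_def by (intro Ck_on_Pair o s) simp
qed

text \<open>Being quadratic in the velocity, the acceleration of a slow geodesic is small compared
  with its speed. This is what confines slow geodesics to a chart up to time 1.\<close>

lemma christoffel_form_quadratic_bound:
  assumes "cball x0 r \<subseteq> U"
  obtains B where "B \<ge> 0" "\<And>x u. x \<in> cball x0 r \<Longrightarrow> norm (christoffel_form G x u u) \<le> B * (norm u)\<^sup>2"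
proof -
  have "\<exists>B. \<forall>x\<in>cball x0 r. \<bar>christoffel G x k i j\<bar> \<le> B" for k i j
  proof -
    have "continuous_on (cball x0 r) (\<lambda>x. christoffel G x k i j)"
      using Ck_on_continuous[OF Ck_christoffel[of 0]] assms continuous_on_subset by blast
    then have "bounded ((\<lambda>x. christoffel G x k i j) ` cball x0 r)"
      using compact_cball compact_continuous_image compact_imp_bounded by blast
    then show ?thesis by (auto simp: bounded_iff)
  qed
  then obtain C where C: "\<And>k i j x. x \<in> cball x0 r \<Longrightarrow> \<bar>christoffel G x k i j\<bar> \<le> C k i j" by metis
  let ?B = "\<Sum>k\<in>UNIV. \<Sum>i\<in>UNIV. \<Sum>j\<in>UNIV. \<bar>C k i j\<bar>"
  show ?thesis
  proof (rule that[of ?B])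
    fix x u assume x: "x \<in> cball x0 r"
    have "norm (christoffel_form G x u u) \<le> (\<Sum>k\<in>UNIV. \<bar>christoffel_form G x u u $ k\<bar>)"
      by (rule norm_le_l1_cart)
    also have "\<dots> \<le> (\<Sum>k\<in>UNIV. \<Sum>i\<in>UNIV. \<Sum>j\<in>UNIV. \<bar>C k i j\<bar> * (norm u * norm u))"
    proof (rule sum_mono)
      fix k
      have "\<bar>christoffel_form G x u u $ k\<bar> \<le> (\<Sum>i\<in>UNIV. \<Sum>j\<in>UNIV. \<bar>christoffel G x k i j * u $ i * u $ j\<bar>)"
        unfolding christoffel_form_def vec_lambda_beta by (intro order_trans[OF sum_abs] sum_mono sum_abs)
      also have "\<dots> \<le> (\<Sum>i\<in>UNIV. \<Sum>j\<in>UNIV. \<bar>C k i j\<bar> * (norm u * norm u))"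
      proof (intro sum_mono)
        fix i j
        show "\<bar>christoffel G x k i j * u $ i * u $ j\<bar> \<le> \<bar>C k i j\<bar> * (norm u * norm u)"
          unfolding abs_mult mult.assoc using C[OF x, of k i j]
          by (intro mult_mono component_le_norm_cart) auto
      qed
      finally show "\<bar>christoffel_form G x u u $ k\<bar> \<le> \<dots>" .
    qed
    finally show "norm (christoffel_form G x u u) \<le> ?B * (norm u)\<^sup>2"
      by (simp add: sum_distrib_right power2_eq_square)
  qed (auto intro: sum_nonneg)
qed

text \<open>The balls for position and velocity form a compact convex set on which the spray is
  Lipschitz, so both curves are assumed to stay in it.\<close>

lemma geodesic_unique:
  assumes K: "cball x0 r \<subseteq> U"
    and x: "\<And>t. t \<in> {0..1} \<Longrightarrow> (x has_vector_derivative x' t) (at t)"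
      "\<And>t. t \<in> {0..1} \<Longrightarrow> (x' has_vector_derivative - christoffel_form G (x t) (x' t) (x' t)) (at t)"
      "\<And>t. t \<in> {0..1} \<Longrightarrow> x t \<in> cball x0 r" "\<And>t. t \<in> {0..1} \<Longrightarrow> norm (x' t) \<le> R"
    and y: "\<And>t. t \<in> {0..1} \<Longrightarrow> (y has_vector_derivative y' t) (at t)"
      "\<And>t. t \<in> {0..1} \<Longrightarrow> (y' has_vector_derivative - christoffel_form G (y t) (y' t) (y' t)) (at t)"
      "\<And>t. t \<in> {0..1} \<Longrightarrow> y t \<in> cball x0 r" "\<And>t. t \<in> {0..1} \<Longrightarrow> norm (y' t) \<le> R"
    and init: "x 0 = y 0" "x' 0 = y' 0" and t: "t \<in> {0..1}"
  shows "x t = y t"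
proof -
  have "compact (cball x0 r \<times> cball (0 :: real ^ 'n) R)" "convex (cball x0 r \<times> cball (0 :: real ^ 'n) R)"
    by (intro compact_Times compact_cball convex_Times convex_cball)+
  moreover have "cball x0 r \<times> cball (0 :: real ^ 'n) R \<subseteq> U \<times> UNIV" using K by auto
  ultimately obtain L where L: "L \<ge> 0" "\<And>z w. z \<in> cball x0 r \<times> cball 0 R \<Longrightarrow> w \<in> cball x0 r \<times> cball 0 R \<Longrightarrow>
      norm (spray z - spray w) \<le> L * norm (z - w)"
    using Ck1_lipschitz[OF Ck_spray] by blast
  have "(x t, x' t) = (y t, y' t)"
  proof (rule ode_unique[of "\<lambda>t. (x t, x' t)" spray "cball x0 r \<times> cball 0 R" "\<lambda>t. (y t, y' t)" L])
    show "((\<lambda>t. (x t, x' t)) has_vector_derivative spray (x t, x' t)) (at t)"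
      "((\<lambda>t. (y t, y' t)) has_vector_derivative spray (y t, y' t)) (at t)" if "t \<in> {0..1}" for t
      unfolding spray_def using x y that by (auto intro!: has_vector_derivative_Pair)
  qed (use x y L init t in auto)
  then show ?thesis by simp
qed

end

lemma vector_derivative_bound:
  fixes f :: "real \<Rightarrow> 'f::real_normed_vector"
  assumes "\<And>t. t \<in> {a..b} \<Longrightarrow> (f has_vector_derivative f' t) (at t)"
    and "\<And>t. t \<in> {a..b} \<Longrightarrow> norm (f' t) \<le> B" and "a \<le> b"
  shows "norm (f b - f a) \<le> B * (b - a)"
proof -
  have "norm (f b - f a) \<le> B * norm (b - a)"
  proof (rule differentiable_bound[of "{a..b}" f "\<lambda>t h. h *\<^sub>R f' t"])
    show "(f has_derivative (\<lambda>h. h *\<^sub>R f' t)) (at t within {a..b})" if "t \<in> {a..b}" for t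
      using assms(1)[OF that] has_derivative_at_withinI unfolding has_vector_derivative_def by blast
    show "onorm (\<lambda>h. h *\<^sub>R f' t) \<le> B" if "t \<in> {a..b}" for t
      using assms(2)[OF that] by (intro onorm_le) (simp add: mult.commute[of B] mult_left_mono)
  qed (use assms(3) in auto)
  then show ?thesis using assms(3) by simp
qed

section \<open>Geodesics and the exponential map near the origin, read in a chart\<close>

context semi_riemannian_manifold begin

text \<open>The definition of a geodesic uses \<open>vector_derivative\<close>, which has a value
  even where no derivative exists. Smoothness of the coordinate curve turns both of its occurrences
  into actual derivatives.\<close>

lemma geodesic_chart_equation:
  assumes \<gamma>: "geodesic_on M g I \<gamma>" and c: "c \<in> M" and t: "t \<in> I \<inter> \<gamma> -` fst c"
  defines "x \<equiv> snd c \<circ> \<gamma>"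
  defines "x' \<equiv> \<lambda>s. vector_derivative x (at s)"
  shows "open (I \<inter> \<gamma> -` fst c)" "(x has_vector_derivative x' t) (at t)"
    "(x' has_vector_derivative - christoffel_form (gram M g c) (x t) (x' t) (x' t)) (at t)"
proof -
  let ?J = "I \<inter> \<gamma> -` fst c"
  show J: "open ?J"
    using \<gamma> chart_open(1)[OF c] continuous_open_preimage unfolding geodesic_on_def by blast
  have sm: "smooth_on ?J x" and eq: "vector_derivative x' (at t) + christoffel_form (gram M g c) (x t) (x' t) (x' t) = 0"
    using \<gamma> c t unfolding geodesic_on_def Let_def x_def x'_def by blast+
  have dx: "x differentiable (at s)" if "s \<in> ?J" for s using smooth_on_differentiable[OF sm that] .
  show "(x has_vector_derivative x' t) (at t)"
    using dx[OF t] unfolding x'_def by (simp add: vector_derivative_works)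
  have "dird x 1 s = x' s" if "s \<in> ?J" for s
    using dx[OF that] vector_derivative_works unfolding x'_def
    by (subst dird_eq[of x "\<lambda>h. h *\<^sub>R vector_derivative x (at s)"]) (auto simp: has_vector_derivative_def)
  then have "x' differentiable (at t)"
    using dird_cong_open(2)[OF J t, of "dird x 1" x'] smooth_on_differentiable[OF smooth_on_dird[OF sm] t] by blast
  then show "(x' has_vector_derivative - christoffel_form (gram M g c) (x t) (x' t) (x' t)) (at t)"
    using eq by (simp add: vector_derivative_works eq_neg_iff_add_eq_0[symmetric])
qed

text \<open>A slow geodesic does not leave the chart before time \<open>1\<close>: at a first exit time its chart
  coordinates would still lie in a compact set, whose preimage is closed.\<close>

lemma geodesic_stays:
  assumes c: "c \<in> M" "p \<in> fst c" and r: "r > 0" "cball (snd c p) r \<subseteq> snd c ` fst c"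
    and B: "B \<ge> 0" "\<And>x u. x \<in> cball (snd c p) r \<Longrightarrow> norm (christoffel_form (gram M g c) x u u) \<le> B * (norm u)\<^sup>2"
    and \<eta>: "\<eta> > 0" "4 * \<eta> \<le> r" "8 * B * \<eta> \<le> 1"
    and \<gamma>: "geodesic_on M g I \<gamma>" "{0..1} \<subseteq> I" "\<gamma> 0 = p"
    and v: "norm (vector_derivative (snd c \<circ> \<gamma>) (at 0)) < \<eta>"
    and t: "t \<in> {0..1}"
  shows "\<gamma> t \<in> fst c \<and> snd c (\<gamma> t) \<in> cball (snd c p) r \<and> norm (vector_derivative (snd c \<circ> \<gamma>) (at t)) \<le> 2 * \<eta>"
proof -
  let ?J = "I \<inter> \<gamma> -` fst c" and ?x0 = "snd c p"
  define x x' where "x = snd c \<circ> \<gamma>" and "x' = (\<lambda>s. vector_derivative x (at s))"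
  note eqs = geodesic_chart_equation[OF \<gamma>(1) c(1)]
  have x_deriv: "(x has_vector_derivative x' s) (at s)"
    and x'_deriv: "(x' has_vector_derivative - christoffel_form (gram M g c) (x s) (x' s) (x' s)) (at s)"
    if "s \<in> ?J" for s
    using eqs(2,3)[OF that] unfolding x_def x'_def .
  have J0: "0 \<in> ?J" using \<gamma> c by auto
  have x_0: "x 0 = ?x0" by (simp add: x_def \<gamma>)
  have cont: "continuous_on ?J x" "continuous_on ?J x'"
    using x_deriv x'_deriv by (auto intro!: continuous_at_imp_continuous_on has_vector_derivative_continuous)
  define \<Omega> where "\<Omega> = (?J \<inter> x -` ball ?x0 r) \<inter> (?J \<inter> x' -` ball 0 (2 * \<eta>))"
  have "open \<Omega>" unfolding \<Omega>_def
    by (intro open_Int continuous_open_preimage cont eqs(1)[OF J0] open_ball)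
  have "{0..1} \<subseteq> \<Omega>"
  proof (rule ccontr)
    assume "\<not> {0..1} \<subseteq> \<Omega>"
    moreover have "compact ({0..1} - \<Omega>)" using \<open>open \<Omega>\<close> compact_diff compact_Icc by blast
    ultimately obtain T where T: "T \<in> {0..1} - \<Omega>" "\<And>s. s \<in> {0..1} - \<Omega> \<Longrightarrow> T \<le> s"
      using compact_attains_inf[of "{0..1} - \<Omega>"] by (metis Diff_eq_empty_iff)
    have "0 \<in> \<Omega>" using J0 r v \<eta> x_0 by (auto simp: \<Omega>_def x_def x'_def)
    then have T0: "0 < T" using T(1) by (cases "T = 0") auto
    have good: "s \<in> \<Omega>" if "s \<in> {0..<T}" for s using T that by force
    have cl: "closure {0..<T} = {0..T}" using T0 by simp
    \<comment> \<open>Before the first bad time \<open>T\<close> the open bounds \<open>r\<close>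
      and \<open>2 * \<eta>\<close> improve to the closed bounds \<open>r/2\<close> and
      \<open>3/2 * \<eta>\<close>, by the two conditions on \<open>\<eta>\<close>. Closed bounds
      persist at \<open>T\<close> and lie strictly inside the open ones, so \<open>T\<close> is not
      bad.\<close>
    have x_near: "x s \<in> cball ?x0 (r/2)" if s: "s \<in> {0..<T}" for s
    proof -
      have "norm (x s - x 0) \<le> 2 * \<eta> * (s - 0)"
      proof (rule vector_derivative_bound)
        fix u assume "u \<in> {0..s}"
        then have "u \<in> \<Omega>" using good s by auto
        then show "(x has_vector_derivative x' u) (at u)" "norm (x' u) \<le> 2 * \<eta>"
          using x_deriv by (auto simp: \<Omega>_def)
      qed (use s in auto)
      also have "\<dots> \<le> 2 * \<eta> * 1" using s T \<eta> by (intro mult_left_mono) auto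
      finally show ?thesis using \<eta> by (simp add: x_0 dist_norm norm_minus_commute)
    qed
    have x'_near: "x' s \<in> cball 0 (3/2 * \<eta>)" if s: "s \<in> {0..<T}" for s
    proof -
      have "norm (x' s - x' 0) \<le> (\<eta>/2) * (s - 0)"
      proof (rule vector_derivative_bound)
        fix u assume u: "u \<in> {0..s}"
        then have uO: "u \<in> \<Omega>" using good s by auto
        then show "(x' has_vector_derivative - christoffel_form (gram M g c) (x u) (x' u) (x' u)) (at u)"
          by (intro x'_deriv) (auto simp: \<Omega>_def)
        have "norm (christoffel_form (gram M g c) (x u) (x' u) (x' u)) \<le> B * (norm (x' u))\<^sup>2"
          using uO by (intro B(2)) (auto simp: \<Omega>_def)
        also have "\<dots> \<le> B * (2 * \<eta>)\<^sup>2"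
          using uO B(1) by (intro mult_left_mono power_mono) (auto simp: \<Omega>_def)
        also have "\<dots> = (8 * B * \<eta>) * (\<eta> / 2)" by (simp add: power2_eq_square)
        also have "\<dots> \<le> 1 * (\<eta> / 2)" using \<eta> by (intro mult_right_mono) auto
        finally show "norm (- christoffel_form (gram M g c) (x u) (x' u) (x' u)) \<le> \<eta> / 2" by simp
      qed (use s in auto)
      also have "\<dots> \<le> \<eta>/2 * 1" using s T \<eta> by (intro mult_left_mono) auto
      finally have "norm (x' s - x' 0) \<le> \<eta>/2" by simp
      moreover have "norm (x' 0) < \<eta>" using v by (simp add: x_def x'_def)
      ultimately have "norm (x' s) \<le> 3/2 * \<eta>"
        using norm_triangle_ineq2[of "x' s" "x' 0"] by linarith
      then show ?thesis by simp
    qed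
    let ?K = "chart_inv c ` cball ?x0 (r/2)"
    have Ksub: "cball ?x0 (r/2) \<subseteq> snd c ` fst c" using r by (auto intro!: subsetD[OF r(2)])
    have "compact ?K"
      by (intro compact_continuous_image continuous_on_subset[OF chart_continuous(2)[OF c(1)] Ksub] compact_cball)
    then have "closed ?K" by (rule compact_imp_closed)
    moreover have "continuous_on {0..T} \<gamma>"
    proof (rule continuous_on_subset[of I])
      show "continuous_on I \<gamma>" using \<gamma>(1) by (simp add: geodesic_on_def)
      show "{0..T} \<subseteq> I" using \<gamma>(2) T(1) by auto
    qed
    moreover have "\<gamma> ` {0..<T} \<subseteq> ?K"
    proof
      fix q assume "q \<in> \<gamma> ` {0..<T}"
      then obtain s where s: "s \<in> {0..<T}" "q = \<gamma> s" by blast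
      have "q = chart_inv c (x s)"
        using good[OF s(1)] s(2) chart_inv_snd[OF c(1)] by (auto simp: \<Omega>_def x_def)
      then show "q \<in> ?K" using x_near[OF s(1)] by blast
    qed
    ultimately have "\<gamma> ` {0..T} \<subseteq> ?K"
      using image_closure_subset[of "{0..<T}" \<gamma> ?K] by (simp add: cl)
    moreover have "?K \<subseteq> fst c"
      by (rule image_subsetI) (rule chart_inv_in[OF c(1) subsetD[OF Ksub]])
    ultimately have "\<gamma> ` {0..T} \<subseteq> fst c" by (rule subset_trans)
    then have TJ: "{0..T} \<subseteq> ?J" using \<gamma>(2) T by auto
    have "x ` {0..T} \<subseteq> cball ?x0 (r/2)"
      by (rule image_closure_subset[of "{0..<T}" x, unfolded cl])
        (rule continuous_on_subset[OF cont(1) TJ] closed_cball image_subsetI[OF x_near], assumption?)+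
    moreover have "x' ` {0..T} \<subseteq> cball 0 (3/2 * \<eta>)"
      by (rule image_closure_subset[of "{0..<T}" x', unfolded cl])
        (rule continuous_on_subset[OF cont(2) TJ] closed_cball image_subsetI[OF x'_near], assumption?)+
    moreover have "T \<in> {0..T}" using T0 by simp
    ultimately have "x T \<in> cball ?x0 (r/2)" "x' T \<in> cball 0 (3/2 * \<eta>)" "T \<in> ?J"
      using TJ by blast+
    then have "T \<in> \<Omega>" using r(1) \<eta>(1) by (auto simp: \<Omega>_def)
    then show False using T by blast
  qed
  then have "t \<in> \<Omega>" using t by blast
  then show ?thesis by (auto simp: \<Omega>_def x_def x'_def)
qed


text \<open>The velocity \<open>x'\<close> is an explicit argument and the bounds \<open>r\<close>
  and \<open>R\<close> belong to the notion, so that two such curves with equal initial velocity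
  meet the hypotheses of \<open>geodesic_unique\<close> at once.\<close>

definition chart_geodesic where
  "chart_geodesic c x0 r R v x x' \<longleftrightarrow> x 0 = x0 \<and> x' 0 = v \<and>
    (\<forall>t\<in>{0..1}. (x has_vector_derivative x' t) (at t) \<and>
       (x' has_vector_derivative - christoffel_form (gram M g c) (x t) (x' t) (x' t)) (at t) \<and>
       x t \<in> cball x0 r \<and> norm (x' t) \<le> R)"

lemma chart_geodesic_unique:
  assumes "c \<in> M" "cball x0 r \<subseteq> snd c ` fst c"
    "chart_geodesic c x0 r R v x x'" "chart_geodesic c x0 r R v y y'" "t \<in> {0..1}"
  shows "x t = y t"
  using chart_metric.geodesic_unique[OF chart_metric_gram[OF assms(1)] assms(2), of x x' R y y' t] assms(3-5)
  unfolding chart_geodesic_def by auto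

text \<open>Slowing a geodesic down by \<open>s\<close> scales its initial velocity by
  \<open>s\<close> and, as \<open>s\<close> is at most 1, keeps the same bounds. Evaluation at time
  1 then relates the exponential map along a whole ray to a single geodesic.\<close>

lemma chart_geodesic_scale:
  assumes x: "chart_geodesic c x0 r R v x x'" and s: "0 \<le> s" "s \<le> 1"
  shows "chart_geodesic c x0 r R (s *\<^sub>R v) (\<lambda>t. x (s * t)) (\<lambda>t. s *\<^sub>R x' (s * t))"
  unfolding chart_geodesic_def
proof (intro conjI ballI)
  show "x (s * 0) = x0" "s *\<^sub>R x' (s * 0) = s *\<^sub>R v" using x by (auto simp: chart_geodesic_def)
next
  fix t :: real assume t: "t \<in> {0..1}"
  then have st: "s * t \<in> {0..1}" using s by (auto intro: mult_le_one)
  note xs = x[unfolded chart_geodesic_def, THEN conjunct2, THEN conjunct2, rule_format, OF st]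
  have m: "((\<lambda>t. s * t) has_vector_derivative s) (at t)"
    by (auto intro!: derivative_eq_intros simp: has_real_derivative_iff_has_vector_derivative[symmetric])
  show "((\<lambda>t. x (s * t)) has_vector_derivative s *\<^sub>R x' (s * t)) (at t)"
    using vector_diff_chain_at[OF m, of x] xs by (simp add: o_def)
  have "((\<lambda>t. s *\<^sub>R x' (s * t)) has_vector_derivative
     s *\<^sub>R (s *\<^sub>R (- christoffel_form (gram M g c) (x (s * t)) (x' (s * t)) (x' (s * t))))) (at t)"
  proof (intro bounded_linear.has_vector_derivative[OF bounded_linear_scaleR_right])
    have "(x' has_vector_derivative - christoffel_form (gram M g c) (x (s * t)) (x' (s * t)) (x' (s * t))) (at (s * t))"
      using xs by blast
    from vector_diff_chain_at[OF m this] show "((\<lambda>t. x' (s * t)) has_vector_derivative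
     s *\<^sub>R (- christoffel_form (gram M g c) (x (s * t)) (x' (s * t)) (x' (s * t)))) (at t)"
      by (simp only: o_def)
  qed
  then show "((\<lambda>t. s *\<^sub>R x' (s * t)) has_vector_derivative
     - christoffel_form (gram M g c) (x (s * t)) (s *\<^sub>R x' (s * t)) (s *\<^sub>R x' (s * t))) (at t)"
    by (simp add: linear_cmul[OF christoffel_form_linear1] linear_cmul[OF christoffel_form_linear2])
  show "x (s * t) \<in> cball x0 r" using xs by blast
  have "norm (s *\<^sub>R x' (s * t)) \<le> 1 * norm (x' (s * t))" using s by (simp add: mult_left_le_one_le)
  then show "norm (s *\<^sub>R x' (s * t)) \<le> R" using xs by linarith
qed

text \<open>\<open>exp_map\<close> is a definite description over all geodesics with the given
  initial velocity. For short vectors each of them stays in the chart up to time 1, so uniqueness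
  there makes the description well defined and identifies its value.\<close>

lemma exp_map_chart_geodesic:
  fixes p
  defines "c \<equiv> chart_at M p"
  obtains r R \<eta> where "\<eta> > 0" "cball (snd c p) r \<subseteq> snd c ` fst c"
    "\<And>v. norm v < \<eta> \<Longrightarrow> v \<in> exp_dom M g p \<Longrightarrow> exp_map M g p v \<in> fst c \<and>
       (\<exists>x x'. chart_geodesic c (snd c p) r R v x x' \<and> snd c (exp_map M g p v) = x 1)"
proof -
  have c: "c \<in> M" "p \<in> fst c" using chart_at by (auto simp: c_def)
  interpret chart_metric "snd c ` fst c" "gram M g c" by (rule chart_metric_gram[OF c(1)])
  obtain r where r: "r > 0" "cball (snd c p) r \<subseteq> snd c ` fst c"
    using open_U c open_contains_cball by (metis imageI)
  obtain B where B: "B \<ge> 0" "\<And>x u. x \<in> cball (snd c p) r \<Longrightarrow> norm (christoffel_form (gram M g c) x u u) \<le> B * (norm u)\<^sup>2"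
    using christoffel_form_quadratic_bound[OF r(2)] by blast
  \<comment> \<open>The first term serves the distance condition of \<open>geodesic_stays\<close>,
    the second its acceleration condition; \<open>B + 1\<close> avoids division by zero.\<close>
  define \<eta> where "\<eta> = min (r/4) (1 / (8 * (B + 1)))"
  have \<eta>1: "\<eta> > 0" using r B by (auto simp: \<eta>_def)
  have "8 * B * \<eta> \<le> 8 * (B + 1) * (1 / (8 * (B + 1)))"
    using B \<eta>1 by (intro mult_mono) (auto simp: \<eta>_def)
  also have "\<dots> = 1" using B(1) by simp
  finally have \<eta>: "\<eta> > 0" "4 * \<eta> \<le> r" "8 * B * \<eta> \<le> 1" using \<eta>1 by (auto simp: \<eta>_def)
  have main: "\<exists>x x'. chart_geodesic c (snd c p) r (2 * \<eta>) v x x' \<and> \<gamma> 1 \<in> fst c \<and> snd c (\<gamma> 1) = x 1"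
    if v: "norm v < \<eta>" and \<gamma>: "geodesic_from M g p v I \<gamma>" "1 \<in> I" for v I \<gamma>
  proof -
    have go: "geodesic_on M g I \<gamma>" "\<gamma> 0 = p" and I: "0 \<in> I" "is_interval I"
      and v0: "vector_derivative (snd c \<circ> \<gamma>) (at 0) = v"
      using \<gamma> by (auto simp: geodesic_from_def geodesic_on_def c_def)
    have sub: "{0..1} \<subseteq> I" using I \<gamma>(2) unfolding is_interval_1 by (meson atLeastAtMost_iff subsetI)
    have nv: "norm (vector_derivative (snd c \<circ> \<gamma>) (at 0)) < \<eta>" using v v0 by simp
    have stay: "\<gamma> t \<in> fst c \<and> snd c (\<gamma> t) \<in> cball (snd c p) r \<and> norm (vector_derivative (snd c \<circ> \<gamma>) (at t)) \<le> 2 * \<eta>"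
      if "t \<in> {0..1}" for t
      by (rule geodesic_stays[OF c r B(1) _ \<eta> go(1) sub go(2) nv that]) (rule B(2))
    have "chart_geodesic c (snd c p) r (2 * \<eta>) v (snd c \<circ> \<gamma>) (\<lambda>s. vector_derivative (snd c \<circ> \<gamma>) (at s))"
      unfolding chart_geodesic_def
    proof (intro conjI ballI)
      fix t :: real assume t: "t \<in> {0..1}"
      then have tJ: "t \<in> I \<inter> \<gamma> -` fst c" using stay[OF t] sub by auto
      show "(snd c \<circ> \<gamma> has_vector_derivative vector_derivative (snd c \<circ> \<gamma>) (at t)) (at t)"
        "((\<lambda>s. vector_derivative (snd c \<circ> \<gamma>) (at s)) has_vector_derivative
         - christoffel_form (gram M g c) ((snd c \<circ> \<gamma>) t) (vector_derivative (snd c \<circ> \<gamma>) (at t))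
          (vector_derivative (snd c \<circ> \<gamma>) (at t))) (at t)"
        using geodesic_chart_equation(2,3)[OF go(1) c(1) tJ] by blast+
      show "(snd c \<circ> \<gamma>) t \<in> cball (snd c p) r" "norm (vector_derivative (snd c \<circ> \<gamma>) (at t)) \<le> 2 * \<eta>"
        using stay[OF t] by auto
    qed (use go v0 in auto)
    then show ?thesis using stay[of 1] by fastforce
  qed
  show ?thesis
  proof (rule that[OF \<eta>(1) r(2)])
    fix v assume v: "norm v < \<eta>" "v \<in> exp_dom M g p"
    then obtain I \<gamma> where \<gamma>: "geodesic_from M g p v I \<gamma>" "1 \<in> I" by (auto simp: exp_dom_def)
    have "exp_map M g p v = \<gamma> 1"
      unfolding exp_map_def
    proof (rule the_equality)
      show "\<exists>I \<gamma>'. geodesic_from M g p v I \<gamma>' \<and> 1 \<in> I \<and> \<gamma> 1 = \<gamma>' 1" using \<gamma> by blast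
      fix q assume "\<exists>I \<gamma>'. geodesic_from M g p v I \<gamma>' \<and> 1 \<in> I \<and> q = \<gamma>' 1"
      then obtain I' \<gamma>' where \<gamma>': "geodesic_from M g p v I' \<gamma>'" "1 \<in> I'" "q = \<gamma>' 1" by blast
      obtain x x' y y' where "chart_geodesic c (snd c p) r (2 * \<eta>) v x x'" "\<gamma> 1 \<in> fst c" "snd c (\<gamma> 1) = x 1"
        "chart_geodesic c (snd c p) r (2 * \<eta>) v y y'" "\<gamma>' 1 \<in> fst c" "snd c (\<gamma>' 1) = y 1"
        using main[OF v(1) \<gamma>] main[OF v(1) \<gamma>'(1,2)] by blast
      then have "snd c (\<gamma>' 1) = snd c (\<gamma> 1)" "\<gamma>' 1 \<in> fst c" "\<gamma> 1 \<in> fst c"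
        using chart_geodesic_unique[OF c(1) r(2), of "2 * \<eta>" v x x' y y' 1] by auto
      then show "q = \<gamma> 1"
        using \<gamma>'(3) chart_inv_snd[OF c(1)] by metis
    qed
    then show "exp_map M g p v \<in> fst c \<and>
       (\<exists>x x'. chart_geodesic c (snd c p) r (2 * \<eta>) v x x' \<and> snd c (exp_map M g p v) = x 1)"
      using main[OF v(1) \<gamma>] by auto
  qed
qed


definition exp_chart :: "'a \<Rightarrow> real ^ 'n \<Rightarrow> real ^ 'n" where
  "exp_chart p = snd (chart_at M p) \<circ> exp_map M g p"

text \<open>Smoothness of the exponential map is inherited from the normal neighbourhood. What
  remains is that short rays are mapped to geodesics with the right initial velocity, which follows
  by rescaling.\<close>

lemma radial_geodesics_exp:
  assumes V: "normal_nbhd_via M g p Vb V"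
  obtains e where "e > 0" "ball 0 e \<subseteq> Vb" "exp_map M g p ` ball 0 e \<subseteq> fst (chart_at M p)"
    "exp_chart p 0 = snd (chart_at M p) p"
    "radial_geodesics (snd (chart_at M p) ` fst (chart_at M p)) (gram M g (chart_at M p)) (exp_chart p) e"
proof -
  define c where "c = chart_at M p"
  have c: "c \<in> M" "p \<in> fst c" using chart_at by (auto simp: c_def)
  interpret chart_metric "snd c ` fst c" "gram M g c" by (rule chart_metric_gram[OF c(1)])
  obtain r R \<eta> where \<eta>: "\<eta> > 0" and r: "cball (snd c p) r \<subseteq> snd c ` fst c"
    and exp: "\<And>v. norm v < \<eta> \<Longrightarrow> v \<in> exp_dom M g p \<Longrightarrow> exp_map M g p v \<in> fst c \<and>
       (\<exists>x x'. chart_geodesic c (snd c p) r R v x x' \<and> snd c (exp_map M g p v) = x 1)"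
    using exp_map_chart_geodesic[of p] unfolding c_def by metis
  have Vb: "open Vb" "0 \<in> Vb" "Vb \<subseteq> exp_dom M g p" and sm: "smooth_into M Vb (exp_map M g p)"
    using V by (auto simp: normal_nbhd_via_def diffeo_onto_def)
  obtain e0 where e0: "e0 > 0" "ball 0 e0 \<subseteq> Vb" using Vb openE by blast
  define e where "e = min e0 \<eta>"
  have e: "e > 0" "ball 0 e \<subseteq> Vb" "e \<le> \<eta>" using e0 \<eta> by (auto simp: e_def)
  have in_dom: "norm v < \<eta> \<and> v \<in> exp_dom M g p" if "norm v < e" for v
    using that e Vb(3) by (auto simp: subset_iff)
  have in_chart: "exp_map M g p ` ball 0 e \<subseteq> fst c" using exp in_dom by auto
  let ?E = "exp_chart p"
  have smE: "smooth_on (ball 0 e) ?E"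
    unfolding exp_chart_def c_def[symmetric]
    by (rule smooth_on_subset[of "Vb \<inter> exp_map M g p -` fst c"])
      (use sm c(1) in_chart e(2) in \<open>auto simp: smooth_into_def\<close>)
  \<comment> \<open>One geodesic serves the whole ray: the exponential of
    \<open>t *\<^sub>R v\<close> is the endpoint at time 1 of the geodesic slowed down by
    \<open>t\<close>, hence the point of the original one at time \<open>t\<close>.\<close>
  have line: "\<exists>x x'. chart_geodesic c (snd c p) r R v x x' \<and> (\<forall>t\<in>{0..1}. ?E (t *\<^sub>R v) = x t)"
    if v: "norm v < e" for v
  proof -
    obtain x x' where x: "chart_geodesic c (snd c p) r R v x x'" using exp in_dom[OF v] by blast
    have "?E (t *\<^sub>R v) = x t" if t: "t \<in> {0..1}" for t
    proof -
      have "norm (t *\<^sub>R v) \<le> 1 * norm v" using t by (simp add: mult_left_le_one_le)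
      then have "norm (t *\<^sub>R v) < e" using v by linarith
      then obtain y y' where y: "chart_geodesic c (snd c p) r R (t *\<^sub>R v) y y'" "?E (t *\<^sub>R v) = y 1"
        using exp in_dom unfolding exp_chart_def c_def by (metis comp_apply)
      have "y 1 = x (t * 1)"
        using chart_geodesic_unique[OF c(1) r y(1) chart_geodesic_scale[OF x], of 1] t by simp
      then show ?thesis using y(2) by simp
    qed
    then show ?thesis using x by blast
  qed
  have diff: "?E differentiable (at v)" "dird ?E u differentiable (at v)" if "norm v < e" for v u
    using smooth_on_differentiable[OF smE] smooth_on_differentiable[OF smooth_on_dird[OF smE]] that by auto
  have E0: "?E 0 = snd c p"
  proof -
    obtain x x' where "chart_geodesic c (snd c p) r R 0 x x'" "\<forall>t\<in>{0..1}. ?E (t *\<^sub>R 0) = x t"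
      using line[of 0] e(1) by auto
    then show ?thesis by (auto simp: chart_geodesic_def dest!: bspec[of _ _ 0])
  qed
  have dE_small: "dird ?E v 0 = v" if v: "norm v < e" for v
  proof -
    obtain x x' where x: "chart_geodesic c (snd c p) r R v x x'" "\<And>t. t \<in> {0..1} \<Longrightarrow> ?E (t *\<^sub>R v) = x t"
      using line[OF v] by blast
    \<comment> \<open>The image of the ray and the geodesic agree between times 0 and 1, and both
      are differentiable at 0; so their derivatives at 0 agree.\<close>
    have "((\<lambda>t. ?E (t *\<^sub>R v) - x t) has_vector_derivative dird ?E v 0 - v) (at 0)"
      using line_has_vector_derivative[of ?E 0 0 v] diff(1)[of 0] e(1) x(1)
      by (intro has_vector_derivative_diff) (auto simp: chart_geodesic_def)
    from vanishing_right_jet(2)[OF this zero_less_one] show ?thesis using x(2) by simp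
  qed
  have "radial_geodesics (snd c ` fst c) (gram M g c) ?E e"
  proof
    show "e > 0" "smooth_on (ball 0 e) ?E" by fact+
    show "?E ` ball 0 e \<subseteq> snd c ` fst c" using in_chart by (auto simp: exp_chart_def c_def)
    show "dird ?E v 0 = v" for v
    proof (cases "v = 0")
      case True then show ?thesis using dE_small[of 0] e(1) by simp
    next
      case False
      define s where "s = e / (2 * norm v)"
      have s: "s > 0" "norm (s *\<^sub>R v) < e" using e(1) False by (auto simp: s_def)
      have "s *\<^sub>R dird ?E v 0 = s *\<^sub>R v"
        using dE_small[OF s(2)] dird_scaleR[OF diff(1)[of 0]] e(1) by simp
      then show ?thesis using s(1) by simp
    qed
  next
    fix v :: "real ^ 'n" and t :: real
    assume v: "norm v < e" and t: "0 < t" "t < 1"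
    obtain x x' where x: "chart_geodesic c (snd c p) r R v x x'" "\<And>t. t \<in> {0..1} \<Longrightarrow> ?E (t *\<^sub>R v) = x t"
      using line[OF v] by blast
    have nsv: "norm (s *\<^sub>R v) < e" if "s \<in> {0<..<1}" for s
    proof -
      have "norm (s *\<^sub>R v) \<le> 1 * norm v" using that by (simp add: mult_left_le_one_le)
      then show ?thesis using v by linarith
    qed
    have 1: "dird ?E v (s *\<^sub>R v) = x' s" if s: "s \<in> {0<..<1}" for s
    proof (rule vector_derivative_unique_at)
      show "((\<lambda>s. ?E (s *\<^sub>R v)) has_vector_derivative dird ?E v (s *\<^sub>R v)) (at s)"
        using line_has_vector_derivative[of ?E 0 s v] diff(1)[OF nsv[OF s]] by simp
      show "((\<lambda>s. ?E (s *\<^sub>R v)) has_vector_derivative x' s) (at s)"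
        by (rule has_vector_derivative_transform_within_open[of x _ _ "{0<..<1}"])
          (use x s in \<open>auto simp: chart_geodesic_def\<close>)
    qed
    have ts: "t \<in> {0<..<1}" using t by simp
    have "dird (dird ?E v) v (t *\<^sub>R v) = - christoffel_form (gram M g c) (x t) (x' t) (x' t)"
    proof (rule vector_derivative_unique_at)
      show "((\<lambda>s. dird ?E v (s *\<^sub>R v)) has_vector_derivative dird (dird ?E v) v (t *\<^sub>R v)) (at t)"
        using line_has_vector_derivative[of "dird ?E v" 0 t v] diff(2)[OF nsv[OF ts]] by simp
      show "((\<lambda>s. dird ?E v (s *\<^sub>R v)) has_vector_derivative - christoffel_form (gram M g c) (x t) (x' t) (x' t)) (at t)"
        by (rule has_vector_derivative_transform_within_open[of x' _ _ "{0<..<1}"])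
          (use x 1 ts in \<open>auto simp: chart_geodesic_def\<close>)
    qed
    then show "dird (dird ?E v) v (t *\<^sub>R v) + christoffel_form (gram M g c) (?E (t *\<^sub>R v))
        (dird ?E v (t *\<^sub>R v)) (dird ?E v (t *\<^sub>R v)) = 0"
      using x(2)[of t] 1[OF ts] t by simp
  qed
  then show ?thesis using that[of e] e in_chart E0 by (simp add: c_def)
qed

end

section \<open>Change of variables for nonnegative functions\<close>

text \<open>For nonnegative functions, absolute integrability with integral \<open>r\<close> says
  that the nonnegative integral is the finite number \<open>r\<close>. The formula for absolutely
  integrable functions thus matches all finite values of the two sides, and if neither is finite
  both are infinite.\<close>

lemma nn_integral_change_of_variables_wellorder:
  fixes \<phi> :: "real ^ 'm::{finite,wellorder} \<Rightarrow> real ^ 'm::_" and f :: "real ^ 'm::_ \<Rightarrow> real"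
  assumes S: "S \<in> sets borel"
    and d: "\<And>x. x \<in> S \<Longrightarrow> (\<phi> has_derivative \<phi>' x) (at x)" and inj: "inj_on \<phi> S"
    and f: "\<And>y. f y \<ge> 0"
    and m1: "(\<lambda>y. indicator (\<phi> ` S) y * f y) \<in> borel_measurable borel"
    and m2: "(\<lambda>x. indicator S x * (\<bar>det (matrix (\<phi>' x))\<bar> * f (\<phi> x))) \<in> borel_measurable borel"
  shows "(\<integral>\<^sup>+y. indicator (\<phi> ` S) y * f y \<partial>lborel) =
    (\<integral>\<^sup>+x. indicator S x * (\<bar>det (matrix (\<phi>' x))\<bar> * f (\<phi> x)) \<partial>lborel)"
    (is "?a = ?b")
proof -
  let ?h = "\<lambda>x. \<bar>det (matrix (\<phi>' x))\<bar> * f (\<phi> x)"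
  have *: "(\<integral>\<^sup>+y. indicator T y * k y \<partial>lborel) = ennreal r \<and> r \<ge> 0 \<longleftrightarrow> (k absolutely_integrable_on T \<and> integral T k = r)"
    if k: "\<And>y. k y \<ge> 0" and m: "(\<lambda>y. indicator T y * k y) \<in> borel_measurable borel"
    for T and k :: "real ^ 'm::_ \<Rightarrow> real" and r
  proof -
    have "(k absolutely_integrable_on T \<and> integral T k = r) \<longleftrightarrow> (k has_integral r) T"
      using k absolutely_integrable_on_iff_nonneg by (metis has_integral_iff)
    also have "\<dots> \<longleftrightarrow> ((\<lambda>y. indicator T y * k y) has_integral r) UNIV"
      by (subst has_integral_restrict_UNIV[symmetric])
        (simp add: indicator_def of_bool_def if_distrib[of "\<lambda>x. x * _"] cong: if_cong)
    also have "\<dots> \<longleftrightarrow> (\<integral>\<^sup>+y. indicator T y * k y \<partial>lborel) = ennreal r \<and> r \<ge> 0"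
      by (subst has_integral_iff_nn_integral_lebesgue)
        (use k m in \<open>auto simp: nn_integral_completion measurable_completion\<close>)
    finally show ?thesis by blast
  qed
  have "(\<lambda>x. ?h x) absolutely_integrable_on S \<and> integral S ?h = r
      \<longleftrightarrow> f absolutely_integrable_on (\<phi> ` S) \<and> integral (\<phi> ` S) f = r" for r
  proof -
    \<comment> \<open>The formula is stated for vector-valued integrands; dimension one recovers the
      scalar case.\<close>
    have "(\<lambda>x. \<bar>det (matrix (\<phi>' x))\<bar> *\<^sub>R (vec (f (\<phi> x)) :: real ^ 1)) absolutely_integrable_on S \<and>
        integral S (\<lambda>x. \<bar>det (matrix (\<phi>' x))\<bar> *\<^sub>R (vec (f (\<phi> x)) :: real ^ 1)) = vec r
      \<longleftrightarrow> (\<lambda>x. vec (f x) :: real ^ 1) absolutely_integrable_on (\<phi> ` S) \<and>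
        integral (\<phi> ` S) (\<lambda>x. vec (f x) :: real ^ 1) = vec r"
      by (rule has_absolute_integral_change_of_variables)
        (use S inj in \<open>auto intro: has_derivative_at_withinI[OF d]\<close>)
    then show ?thesis
      unfolding absolutely_integrable_on_1_iff integral_on_1_eq by (simp add: vec_eq_iff)
  qed
  then have iff: "?a = ennreal r \<and> r \<ge> 0 \<longleftrightarrow> ?b = ennreal r \<and> r \<ge> 0" for r
    using *[of f "\<phi> ` S" r] *[of ?h S r] f m1 m2 by simp
  show ?thesis
  proof (cases "?a")
    case (real r) then show ?thesis using iff[of r] by auto
  next
    case a: top
    show ?thesis
    proof (cases "?b")
      case (real r) then show ?thesis using iff[of r] by auto
    next
      case top then show ?thesis using a by simp
    qed
  qed
qed

text \<open>The library states the change of variables formula only for well-ordered index types. Every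
  finite index type has a well-ordered copy, to which the formula is transported by relabelling
  coordinates.\<close>

typedef 'n wo = "UNIV :: 'n set" ..

instance wo :: (finite) finite
proof
  have "(UNIV :: 'a wo set) = Abs_wo ` UNIV" by (metis Rep_wo_inverse surj_def)
  then show "finite (UNIV :: 'a wo set)" by (metis finite finite_imageI)
qed

instantiation wo :: (finite) wellorder
begin

text \<open>The order is pulled back along the injection into the natural numbers, which supplies
  linearity and well-foundedness.\<close>

definition less_eq_wo :: "'a wo \<Rightarrow> 'a wo \<Rightarrow> bool" where
  "less_eq_wo x y \<longleftrightarrow> to_nat (Rep_wo x) \<le> to_nat (Rep_wo y)"

definition less_wo :: "'a wo \<Rightarrow> 'a wo \<Rightarrow> bool" where
  "less_wo x y \<longleftrightarrow> to_nat (Rep_wo x) < to_nat (Rep_wo y)"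

instance
proof
  fix P and a :: "'a wo"
  assume step: "\<And>x :: 'a wo. (\<And>y. y < x \<Longrightarrow> P y) \<Longrightarrow> P x"
  show "P a"
    by (induction a rule: measure_induct[of "\<lambda>x. to_nat (Rep_wo x)"]) (rule step, simp add: less_wo_def)
qed (auto simp: less_eq_wo_def less_wo_def Rep_wo_inject)

end

lemma bij_Rep_wo: "bij Rep_wo"
  by (rule bijI') (auto simp: Rep_wo_inject intro: Abs_wo_inverse[symmetric])

definition relabel :: "real ^ 'n \<Rightarrow> real ^ 'n wo" where
  "relabel x = (\<chi> i. x $ Rep_wo i)"

definition unlabel :: "real ^ 'n wo \<Rightarrow> real ^ 'n" where
  "unlabel y = (\<chi> i. y $ Abs_wo i)"

lemma relabel_unlabel [simp]: "relabel (unlabel y) = y" "unlabel (relabel x) = x"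
  by (simp_all add: relabel_def unlabel_def Rep_wo_inverse Abs_wo_inverse)

lemma inj_relabel: "inj relabel" and inj_unlabel: "inj unlabel"
  by (metis injI relabel_unlabel)+

lemma linear_relabel: "linear relabel" and linear_unlabel: "linear unlabel"
  by (rule linearI; simp add: relabel_def unlabel_def vec_eq_iff)+

lemma bounded_linear_relabel: "bounded_linear (relabel :: real ^ 'n::finite \<Rightarrow> _)"
  and bounded_linear_unlabel: "bounded_linear (unlabel :: _ \<Rightarrow> real ^ 'n::finite)"
  using linear_conv_bounded_linear linear_relabel linear_unlabel by blast+

lemma measurable_relabel [measurable]: "(relabel :: real ^ 'n::finite \<Rightarrow> _) \<in> borel_measurable borel"
  and measurable_unlabel [measurable]: "(unlabel :: _ \<Rightarrow> real ^ 'n::finite) \<in> borel_measurable borel"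
  by (intro borel_measurable_continuous_onI linear_continuous_on bounded_linear_relabel bounded_linear_unlabel)+

lemma unlabel_axis: "unlabel (axis j 1) = axis (Rep_wo j) 1"
  by (auto simp: unlabel_def axis_def vec_eq_iff Rep_wo_inverse Abs_wo_inverse)

lemma prod_Basis_vec: "(\<Prod>b\<in>(Basis :: (real ^ 'n) set). h b) = (\<Prod>i\<in>UNIV. h (axis i 1))"
proof -
  have B: "(Basis :: (real ^ 'n) set) = range (\<lambda>i. axis i 1)" by (auto simp: Basis_vec_def)
  have inj: "inj (\<lambda>i. axis i (1::real) :: real ^ 'n)" by (auto intro!: injI simp: axis_eq_axis)
  show ?thesis unfolding B prod.reindex[OF inj] by (simp add: o_def)
qed

text \<open>Lebesgue measure is determined by its values on boxes, and relabelling coordinates only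
  permutes the side lengths of a box.\<close>

lemma distr_relabel: "distr lborel borel (relabel :: real ^ 'n::finite \<Rightarrow> _) = lborel"
proof (rule lborel_eqI[symmetric])
  fix l u :: "real ^ 'n wo"
  assume lu: "\<And>b. b \<in> Basis \<Longrightarrow> l \<bullet> b \<le> u \<bullet> b"
  have le: "l $ i \<le> u $ i" for i using lu[of "axis i 1"] by (simp add: inner_axis)
  have "relabel -` box l u = box (unlabel l :: real ^ 'n) (unlabel u)"
    unfolding box_def Basis_vec_def
    by (auto simp: inner_axis relabel_def unlabel_def; metis Abs_wo_inverse Rep_wo_inverse UNIV_I)
  then have "emeasure (distr lborel borel (relabel :: real ^ 'n \<Rightarrow> _)) (box l u) = emeasure lborel (box (unlabel l :: real ^ 'n) (unlabel u))"
    by (simp add: emeasure_distr)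
  also have "\<dots> = (\<Prod>i\<in>UNIV. u $ Abs_wo i - l $ Abs_wo (i :: 'n))"
  proof (subst emeasure_lborel_box)
    fix b :: "real ^ 'n" assume "b \<in> Basis"
    then show "unlabel l \<bullet> b \<le> unlabel u \<bullet> b"
      by (auto simp: Basis_vec_def inner_axis unlabel_def le)
  qed (simp add: prod_Basis_vec inner_axis unlabel_def)
  also have "\<dots> = (\<Prod>i\<in>UNIV. u $ i - l $ (i :: 'n wo))"
    by (rule arg_cong[of _ _ ennreal], subst prod.reindex_bij_betw[OF bij_Rep_wo, symmetric]) (simp add: Rep_wo_inverse)
  finally show "emeasure (distr lborel borel (relabel :: real ^ 'n \<Rightarrow> _)) (box l u) = (\<Prod>b\<in>Basis. (u - l) \<bullet> b)"
    by (simp add: prod_Basis_vec inner_axis)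
qed simp

lemma nn_integral_relabel:
  fixes F :: "real ^ 'n::finite wo \<Rightarrow> ennreal"
  assumes [measurable]: "F \<in> borel_measurable borel"
  shows "(\<integral>\<^sup>+y. F y \<partial>lborel) = (\<integral>\<^sup>+x. F (relabel x) \<partial>lborel)"
  by (subst distr_relabel[symmetric]) (simp add: nn_integral_distr)

text \<open>Conjugation by \<open>f\<close> is a sign-preserving bijection between the permutations
  of the two index types, and it matches the products in the Leibniz formula.\<close>

lemma det_relabel:
  fixes A :: "real ^ 'n ^ 'n" and f :: "'m::finite \<Rightarrow> 'n::finite"
  assumes f: "bij f"
  shows "det (\<chi> i j. A $ f i $ f j) = det A"
proof -
  have i: "inv f (f x) = x" "f (inv f y) = y" for x y
    using f by (auto simp: bij_is_inj bij_is_surj surj_f_inv_f)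
  have mp: "map_permutation UNIV f p = f \<circ> p \<circ> inv f" for p
    using f by (simp add: map_permutation_def restrict_id_def bij_is_surj fun_eq_iff)
  have perm: "f \<circ> p \<circ> inv f permutes UNIV" "sign (f \<circ> p \<circ> inv f) = sign p" if "p permutes UNIV" for p
    using map_permutation_permutes[of f UNIV UNIV p] sign_map_permutation[of f UNIV p] f that
    by (auto simp: mp bij_is_inj)
  have "(\<Prod>i\<in>UNIV. A $ f i $ f (p i)) = (\<Prod>k\<in>UNIV. A $ k $ (f \<circ> p \<circ> inv f) k)" for p
    by (subst prod.reindex_bij_betw[OF f, symmetric]) (simp add: i)
  then have "det (\<chi> i j. A $ f i $ f j) =
    (\<Sum>p | p permutes UNIV. of_int (sign p) * (\<Prod>k\<in>UNIV. A $ k $ (f \<circ> p \<circ> inv f) k))"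
    by (simp add: det_def)
  also have "\<dots> = det A"
    unfolding det_def
  proof (rule sum.reindex_bij_witness[of _ "\<lambda>q. inv f \<circ> q \<circ> f" "\<lambda>p. f \<circ> p \<circ> inv f"])
    fix q :: "'n \<Rightarrow> 'n" assume "q \<in> {p. p permutes UNIV}"
    then have "bij q" using permutes_bij by blast
    then show "inv f \<circ> q \<circ> f \<in> {p. p permutes UNIV}"
      using f by (auto intro!: bij_imp_permutes bij_comp bij_imp_bij_inv)
  qed (auto simp: perm i fun_eq_iff)
  finally show ?thesis .
qed

text \<open>The map is conjugated by the relabelling, which preserves integrals and, by
  \<open>det_relabel\<close>, the Jacobian determinant.\<close>

lemma nn_integral_change_of_variables:
  fixes \<phi> :: "real ^ 'n::finite \<Rightarrow> real ^ 'n" and f :: "real ^ 'n \<Rightarrow> real"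
  assumes S: "S \<in> sets borel"
    and d: "\<And>x. x \<in> S \<Longrightarrow> (\<phi> has_derivative \<phi>' x) (at x)" and inj: "inj_on \<phi> S"
    and f: "\<And>y. f y \<ge> 0"
    and m1: "(\<lambda>y. indicator (\<phi> ` S) y * f y) \<in> borel_measurable borel"
    and m2: "(\<lambda>x. indicator S x * (\<bar>det (matrix (\<phi>' x))\<bar> * f (\<phi> x))) \<in> borel_measurable borel"
  shows "(\<integral>\<^sup>+y. indicator (\<phi> ` S) y * f y \<partial>lborel) =
    (\<integral>\<^sup>+x. indicator S x * (\<bar>det (matrix (\<phi>' x))\<bar> * f (\<phi> x)) \<partial>lborel)"
proof -
  let ?S = "relabel ` S" and ?\<phi> = "relabel \<circ> \<phi> \<circ> unlabel" and ?f = "f \<circ> unlabel"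
  let ?\<phi>' = "\<lambda>y. relabel \<circ> \<phi>' (unlabel y) \<circ> unlabel"
  have im: "?\<phi> ` ?S = relabel ` \<phi> ` S" by (simp add: image_image)
  have rel_image: "relabel ` T = unlabel -` T" for T :: "(real ^ 'n) set"
    by (auto simp: image_iff) (metis relabel_unlabel(1))
  have ind: "indicator (relabel ` T) y = (indicator T (unlabel y) :: real)" for T and y :: "real ^ 'n wo"
    unfolding rel_image by (simp add: indicator_def)
  have det: "det (matrix (?\<phi>' y)) = det (matrix (\<phi>' (unlabel y)))" for y
  proof -
    have "matrix (?\<phi>' y) = (\<chi> i j. matrix (\<phi>' (unlabel y)) $ Rep_wo i $ Rep_wo j)"
      by (simp add: matrix_def vec_eq_iff relabel_def unlabel_axis)
    then show ?thesis using det_relabel[OF bij_Rep_wo] by simp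
  qed
  have "(\<integral>\<^sup>+y. indicator (?\<phi> ` ?S) y * ?f y \<partial>lborel) =
    (\<integral>\<^sup>+x. indicator ?S x * (\<bar>det (matrix (?\<phi>' x))\<bar> * ?f (?\<phi> x)) \<partial>lborel)"
  proof (rule nn_integral_change_of_variables_wellorder)
    show "?S \<in> sets borel"
      unfolding rel_image using measurable_sets[OF measurable_unlabel, of S] S by simp
    show "(?\<phi> has_derivative ?\<phi>' y) (at y)" if "y \<in> ?S" for y
    proof -
      have "(\<phi> has_derivative \<phi>' (unlabel y)) (at (unlabel y))" using d that by auto
      then have "(\<phi> \<circ> unlabel has_derivative \<phi>' (unlabel y) \<circ> unlabel) (at y)"
        using diff_chain_at[OF bounded_linear_imp_has_derivative[OF bounded_linear_unlabel]] by blast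
      then show ?thesis
        using diff_chain_at[OF _ bounded_linear_imp_has_derivative[OF bounded_linear_relabel]]
        by (metis comp_assoc)
    qed
    show "inj_on ?\<phi> ?S"
      using inj inj_relabel by (auto simp: inj_on_def)
    show "(\<lambda>y. indicator (?\<phi> ` ?S) y * ?f y) \<in> borel_measurable borel"
      unfolding im ind comp_apply using measurable_compose[OF measurable_unlabel m1] by simp
    show "(\<lambda>x. indicator ?S x * (\<bar>det (matrix (?\<phi>' x))\<bar> * ?f (?\<phi> x))) \<in> borel_measurable borel"
      unfolding ind det using measurable_compose[OF measurable_unlabel m2] by simp
  qed (use f in auto)
  moreover have "(\<integral>\<^sup>+y. indicator (?\<phi> ` ?S) y * ?f y \<partial>lborel) = (\<integral>\<^sup>+y. indicator (\<phi> ` S) y * f y \<partial>lborel)"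
    unfolding im ind comp_apply
    by (subst nn_integral_relabel) (use measurable_compose[OF measurable_unlabel m1] in auto)
  moreover have "(\<integral>\<^sup>+x. indicator ?S x * (\<bar>det (matrix (?\<phi>' x))\<bar> * ?f (?\<phi> x)) \<partial>lborel) =
    (\<integral>\<^sup>+x. indicator S x * (\<bar>det (matrix (\<phi>' x))\<bar> * f (\<phi> x)) \<partial>lborel)"
    unfolding ind det
    by (subst nn_integral_relabel) (use measurable_compose[OF measurable_unlabel m2] in auto)
  ultimately show ?thesis by simp
qed

section \<open>The metric volume measure\<close>

context semi_riemannian_manifold begin

definition gram_density :: "('a, 'n) chart \<Rightarrow> real ^ 'n \<Rightarrow> real" where
  "gram_density c x = sqrt \<bar>det (gram M g c x)\<bar>"

definition chart_volume :: "('a, 'n) chart \<Rightarrow> 'a set \<Rightarrow> ennreal" where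
  "chart_volume c A = (\<integral>\<^sup>+x\<in>snd c ` A. ennreal (gram_density c x) \<partial>lborel)"

lemma continuous_gram_density:
  assumes "c \<in> M" shows "continuous_on (snd c ` fst c) (gram_density c)"
proof -
  interpret chart_metric "snd c ` fst c" "gram M g c" by (rule chart_metric_gram[OF assms])
  have "continuous_on (snd c ` fst c) (\<lambda>x. det (gram M g c x))"
    by (rule Ck_on_continuous[OF Ck_on_det[OF open_U Ck_G]])
  then show ?thesis unfolding gram_density_def by (intro continuous_intros)
qed

text \<open>The image under the chart is a preimage under its continuous inverse, intersected with
  an open set.\<close>

lemma chart_image_borel:
  assumes c: "c \<in> M" and A: "A \<in> sets borel" "A \<subseteq> fst c"
  shows "snd c ` A \<in> sets borel"
proof -
  let ?U = "snd c ` fst c"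
  have "snd c ` A = chart_inv c -` A \<inter> ?U"
    using A(2) chart_inv_snd[OF c] by force
  moreover have "chart_inv c \<in> borel_measurable (restrict_space borel ?U)"
    by (rule borel_measurable_continuous_on_restrict[OF chart_continuous(2)[OF c]])
  from measurable_sets[OF this A(1)] have "chart_inv c -` A \<inter> ?U \<in> sets borel"
    using chart_open(2)[OF c] by (simp add: space_restrict_space sets_restrict_space_iff)
  ultimately show ?thesis by simp
qed

text \<open>The parametrization \<open>\<phi>\<close> will be a coordinate change, or the
  exponential map in a chart preceded by a linear map. Giving the transformed integrand as a
  continuous \<open>h\<close> supplies the measurability that the change of variables asks
  for.\<close>

lemma chart_volume_image:
  fixes \<phi> :: "real ^ 'n \<Rightarrow> real ^ 'n"
  assumes c: "c \<in> M" and S: "S \<in> sets borel" and B: "B \<in> sets borel" "B \<subseteq> fst c" "\<phi> ` S = snd c ` B"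
    and d: "\<And>x. x \<in> S \<Longrightarrow> (\<phi> has_derivative \<phi>' x) (at x)" and inj: "inj_on \<phi> S"
    and cont: "continuous_on S h"
    and h: "\<And>x. x \<in> S \<Longrightarrow> h x = \<bar>det (matrix (\<phi>' x))\<bar> * gram_density c (\<phi> x)"
  shows "chart_volume c B = (\<integral>\<^sup>+x\<in>S. ennreal (h x) \<partial>lborel)"
proof -
  have eq: "(\<lambda>x. indicator S x * (\<bar>det (matrix (\<phi>' x))\<bar> * gram_density c (\<phi> x))) = (\<lambda>x. indicator S x *\<^sub>R h x)"
    by (auto simp: h indicator_def)
  have "(\<integral>\<^sup>+y. indicator (\<phi> ` S) y * gram_density c y \<partial>lborel) =
    (\<integral>\<^sup>+x. indicator S x * (\<bar>det (matrix (\<phi>' x))\<bar> * gram_density c (\<phi> x)) \<partial>lborel)"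
  proof (rule nn_integral_change_of_variables[OF S d inj])
    show "gram_density c y \<ge> 0" for y by (simp add: gram_density_def)
    have "(\<lambda>y. indicator (\<phi> ` S) y *\<^sub>R gram_density c y) \<in> borel_measurable borel"
      unfolding B(3) using B continuous_on_subset[OF continuous_gram_density[OF c], of "snd c ` B"]
      by (intro borel_measurable_continuous_on_indicator chart_image_borel[OF c]) auto
    then show "(\<lambda>y. indicator (\<phi> ` S) y * gram_density c y) \<in> borel_measurable borel" by simp
    show "(\<lambda>x. indicator S x * (\<bar>det (matrix (\<phi>' x))\<bar> * gram_density c (\<phi> x))) \<in> borel_measurable borel"
      unfolding eq by (rule borel_measurable_continuous_on_indicator[OF S cont])
  qed
  moreover have "(\<integral>\<^sup>+y. indicator (\<phi> ` S) y * gram_density c y \<partial>lborel) = chart_volume c B"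
    unfolding chart_volume_def B(3) by (rule nn_integral_cong) (auto simp: indicator_def)
  moreover have "(\<integral>\<^sup>+x. indicator S x * (\<bar>det (matrix (\<phi>' x))\<bar> * gram_density c (\<phi> x)) \<partial>lborel) =
     (\<integral>\<^sup>+x\<in>S. ennreal (h x) \<partial>lborel)"
    by (rule nn_integral_cong) (auto simp: indicator_def h)
  ultimately show ?thesis by simp
qed

lemma chart_volume_transition:
  assumes c: "c \<in> M" "d \<in> M" and A: "A \<in> sets borel" "A \<subseteq> fst c" "A \<subseteq> fst d"
  shows "chart_volume d A = chart_volume c A"
  unfolding chart_volume_def[of c]
proof (rule chart_volume_image[OF c(2) chart_image_borel[OF c(1) A(1,2)] A(1,3)])
  have sub: "snd c ` A \<subseteq> snd c ` fst c" using A by blast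
  show "continuous_on (snd c ` A) (gram_density c)"
    by (rule continuous_on_subset[OF continuous_gram_density[OF c(1)] sub])
  have tr: "transition c d (snd c q) = snd d q" if "q \<in> A" for q
    using that A chart_inv_snd[OF c(1)] by auto
  show "transition c d ` snd c ` A = snd d ` A" using tr by (force simp: image_iff)
  show "inj_on (transition c d) (snd c ` A)"
  proof (rule inj_onI)
    fix x y assume "x \<in> snd c ` A" "y \<in> snd c ` A" and e: "transition c d x = transition c d y"
    then obtain q q' where q: "q \<in> A" "x = snd c q" "q' \<in> A" "y = snd c q'" by blast
    then have "snd d q = snd d q'" using e tr by metis
    then have "q = q'" using chart_inj[OF c(2)] q A(3) by (metis inj_onD subsetD)
    then show "x = y" using q by simp
  qed
  fix x assume "x \<in> snd c ` A"
  then obtain q where q: "q \<in> A" "x = snd c q" by blast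
  have qc: "q \<in> fst c" "q \<in> fst d" using q A by auto
  show "(transition c d has_derivative (\<lambda>v. dird (transition c d) v x)) (at x)"
    unfolding q(2) by (rule has_derivative_dird[OF transition_differentiable[OF c qc]])
  show "gram_density c x = \<bar>det (matrix (\<lambda>v. dird (transition c d) v x))\<bar> * gram_density d (transition c d x)"
    unfolding gram_density_def q(2) tr[OF q(1)] det_gram_transform[OF c qc]
    by (simp add: abs_mult real_sqrt_mult)
qed

text \<open>Within one chart the volume comes from a measure with a density on coordinate space, and
  injectivity of the chart keeps the images of the pieces disjoint.\<close>

lemma chart_volume_UN:
  assumes c: "c \<in> M" and A: "\<And>i::nat. A i \<in> sets borel" "\<And>i. A i \<subseteq> fst c" "disjoint_family A"
  shows "chart_volume c (\<Union>i. A i) = (\<Sum>i. chart_volume c (A i))"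
proof -
  let ?U = "snd c ` fst c"
  let ?\<kappa> = "density lborel (\<lambda>x. ennreal (indicator ?U x *\<^sub>R gram_density c x))"
  have meas [measurable]: "(\<lambda>x. indicator ?U x *\<^sub>R gram_density c x) \<in> borel_measurable borel"
    by (intro borel_measurable_continuous_on_indicator continuous_gram_density c borel_open chart_open)
  have \<kappa>: "chart_volume c B = emeasure ?\<kappa> (snd c ` B)" if "B \<in> sets borel" "B \<subseteq> fst c" for B
  proof -
    have "emeasure ?\<kappa> (snd c ` B) = (\<integral>\<^sup>+x\<in>snd c ` B. ennreal (indicator ?U x *\<^sub>R gram_density c x) \<partial>lborel)"
      using chart_image_borel[OF c that] meas by (intro emeasure_density) auto
    also have "\<dots> = chart_volume c B"
      unfolding chart_volume_def
    proof (rule nn_integral_cong)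
      fix x
      have "x \<in> snd c ` B \<Longrightarrow> x \<in> ?U" using that(2) by blast
      then show "ennreal (indicator ?U x *\<^sub>R gram_density c x) * indicator (snd c ` B) x =
        ennreal (gram_density c x) * indicator (snd c ` B) x"
        by (cases "x \<in> snd c ` B") auto
    qed
    finally show ?thesis by simp
  qed
  have disj: "disjoint_family (\<lambda>i. snd c ` A i)"
    unfolding disjoint_family_on_def
  proof (intro ballI impI)
    fix i j :: nat assume "i \<noteq> j"
    then have "A i \<inter> A j = {}" using A(3) by (auto simp: disjoint_family_on_def)
    then show "snd c ` A i \<inter> snd c ` A j = {}"
      using inj_on_image_Int[OF chart_inj[OF c] A(2) A(2), of i j] by simp
  qed
  have "(\<Sum>i. chart_volume c (A i)) = (\<Sum>i. emeasure ?\<kappa> (snd c ` A i))"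
    using \<kappa> A by simp
  also have "\<dots> = emeasure ?\<kappa> (\<Union>i. snd c ` A i)"
    using chart_image_borel[OF c A(1,2)] disj by (intro suminf_emeasure) auto
  also have "(\<Union>i. snd c ` A i) = snd c ` (\<Union>i. A i)" by blast
  also have "emeasure ?\<kappa> \<dots> = chart_volume c (\<Union>i. A i)"
    using A by (intro \<kappa>[symmetric]) auto
  finally show ?thesis by simp
qed

text \<open>Second countability yields countably many covering chart domains by Lindelof's theorem;
  removing from each the earlier ones makes the pieces disjoint and keeps them Borel.\<close>

lemma countable_partition:
  obtains c :: "nat \<Rightarrow> ('a, 'n) chart" and D :: "nat \<Rightarrow> 'a set"
  where "\<And>n. c n \<in> M" "\<And>n. D n \<in> sets borel" "\<And>n. D n \<subseteq> fst (c n)" "disjoint_family D" "(\<Union>n. D n) = UNIV"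
proof -
  obtain F where F: "F \<subseteq> fst ` M" "countable F" "\<Union> F = (\<Union>c\<in>M. fst c)"
  proof (rule Lindelof[of "fst ` M"])
    show "open S" if "S \<in> fst ` M" for S using that chart_open(1) by blast
  qed blast
  have cover: "\<Union> F = UNIV" using F(3) manifold by (simp add: smooth_manifold_def)
  then have "F \<noteq> {}" by auto
  then have r: "range (from_nat_into F) = F" using F(2) by (simp add: range_from_nat_into)
  then have "\<forall>n. \<exists>c\<in>M. fst c = from_nat_into F n" using F(1) by (metis imageE rangeI subsetD)
  then obtain c where c: "\<And>n. c n \<in> M" "\<And>n. fst (c n) = from_nat_into F n" by metis
  have un: "(\<Union>n. fst (c n)) = UNIV" using c(2) r cover by simp
  let ?D = "disjointed (\<lambda>n. fst (c n))"
  have "range (\<lambda>n. fst (c n)) \<subseteq> sets borel" using chart_open(1)[OF c(1)] by auto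
  then have "range ?D \<subseteq> sets borel" by (rule sets.range_disjointed_sets)
  then have "\<And>n. ?D n \<in> sets borel" by blast
  moreover have "\<And>n. ?D n \<subseteq> fst (c n)" by (rule disjointed_subset)
  moreover have "(\<Union>n. ?D n) = UNIV" using un by (simp add: UN_disjointed_eq)
  ultimately show ?thesis using that[of c ?D] c(1) disjoint_family_disjointed by blast
qed

text \<open>Existence: chart volumes are summed over a countable partition, and their agreement on
  overlaps makes the sum correct in every chart. Uniqueness: such a measure is prescribed on the
  intersection of a set with each piece, and countable additivity does the rest.\<close>

lemma volume_measure_unique:
  "\<exists>!\<mu>. sets \<mu> = sets borel \<and> (\<forall>c\<in>M. \<forall>A\<in>sets borel. A \<subseteq> fst c \<longrightarrow> emeasure \<mu> A = chart_volume c A)"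
proof -
  obtain c D where c: "\<And>n::nat. c n \<in> M" and D: "\<And>n. D n \<in> sets borel" "\<And>n. D n \<subseteq> fst (c n)"
    "disjoint_family D" "(\<Union>n. D n) = UNIV" using countable_partition by metis
  have disj: "disjoint_family (\<lambda>n. A \<inter> D n)" for A
    using D(3) unfolding disjoint_family_on_def by blast
  define m where "m A = (\<Sum>n. chart_volume (c n) (A \<inter> D n))" for A
  let ?\<mu> = "measure_of UNIV (sets borel) m"
  have em: "emeasure ?\<mu> A = m A" if "A \<in> sets borel" for A
  proof (rule emeasure_measure_of_sigma)
    show "sigma_algebra UNIV (sets (borel :: 'a measure))"
      using sets.sigma_algebra_axioms[of borel] by simp
    show "positive (sets borel) m" by (simp add: positive_def m_def chart_volume_def)
    show "countably_additive (sets borel) m"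
      unfolding countably_additive_def
    proof (intro allI impI)
      fix A :: "nat \<Rightarrow> 'a set" assume A: "range A \<subseteq> sets borel" "disjoint_family A"
      have "m (\<Union>i. A i) = (\<Sum>n. chart_volume (c n) (\<Union>i. A i \<inter> D n))" by (simp add: m_def)
      also have "\<dots> = (\<Sum>n. \<Sum>i. chart_volume (c n) (A i \<inter> D n))"
      proof -
        have "chart_volume (c n) (\<Union>i. A i \<inter> D n) = (\<Sum>i. chart_volume (c n) (A i \<inter> D n))" for n
        proof (rule chart_volume_UN[OF c])
          show "A i \<inter> D n \<in> sets borel" for i using A(1) D(1)[of n] by blast
          show "A i \<inter> D n \<subseteq> fst (c n)" for i using D(2)[of n] by blast
          show "disjoint_family (\<lambda>i. A i \<inter> D n)" using A(2) unfolding disjoint_family_on_def by blast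
        qed
        then show ?thesis by simp
      qed
      \<comment> \<open>Two sums of nonnegative terms are exchanged by viewing one of them as an
        integral against counting measure.\<close>
      also have "\<dots> = (\<Sum>i. \<Sum>n. chart_volume (c n) (A i \<inter> D n))"
        using nn_integral_suminf[of "\<lambda>i n. chart_volume (c n) (A i \<inter> D n)" "count_space UNIV"]
        by (simp add: nn_integral_count_space_nat)
      finally show "(\<Sum>i. m (A i)) = m (\<Union>i. A i)" by (simp add: m_def)
    qed
  qed (use that in auto)
  have sets_\<mu>: "sets ?\<mu> = sets borel" using sets.sets_measure_of_eq[of borel m] by simp
  have ex: "emeasure ?\<mu> A = chart_volume d A" if d: "d \<in> M" and A: "A \<in> sets borel" "A \<subseteq> fst d" for d A
  proof -
    have "chart_volume (c n) (A \<inter> D n) = chart_volume d (A \<inter> D n)" for n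
      using A D(1,2)[of n] by (intro chart_volume_transition d c) auto
    then have "m A = (\<Sum>n. chart_volume d (A \<inter> D n))" by (simp add: m_def)
    also have "\<dots> = chart_volume d (\<Union>n. A \<inter> D n)"
      using A D by (intro chart_volume_UN[symmetric] d disj) auto
    also have "(\<Union>n. A \<inter> D n) = A" using D(4) by blast
    finally show ?thesis using em A by simp
  qed
  show ?thesis
  proof (rule ex1I[of _ ?\<mu>])
    show "sets ?\<mu> = sets borel \<and> (\<forall>c\<in>M. \<forall>A\<in>sets borel. A \<subseteq> fst c \<longrightarrow> emeasure ?\<mu> A = chart_volume c A)"
      using sets_\<mu> ex by blast
  next
    fix \<mu>' assume \<mu>': "sets \<mu>' = sets borel \<and> (\<forall>c\<in>M. \<forall>A\<in>sets borel. A \<subseteq> fst c \<longrightarrow> emeasure \<mu>' A = chart_volume c A)"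
    show "\<mu>' = ?\<mu>"
    proof (rule measure_eqI)
      show "sets \<mu>' = sets ?\<mu>" using \<mu>' sets_\<mu> by simp
      fix A assume "A \<in> sets \<mu>'"
      then have A: "A \<in> sets borel" using \<mu>' by simp
      have "emeasure \<mu>' A = emeasure \<mu>' (\<Union>n. A \<inter> D n)" using D(4) by (metis UNIV_I Int_UNIV_right Int_UN_distrib)
      also have "\<dots> = (\<Sum>n. emeasure \<mu>' (A \<inter> D n))"
        using A D \<mu>' by (intro suminf_emeasure[symmetric] disj) auto
      also have "\<dots> = m A"
      proof -
        have "emeasure \<mu>' (A \<inter> D n) = chart_volume (c n) (A \<inter> D n)" for n
        proof -
          have "A \<inter> D n \<in> sets borel" "A \<inter> D n \<subseteq> fst (c n)" using A D(1,2)[of n] by auto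
          then show ?thesis using \<mu>' c[of n] by blast
        qed
        then show ?thesis by (simp add: m_def)
      qed
      finally show "emeasure \<mu>' A = emeasure ?\<mu> A" using em A by simp
    qed
  qed
qed

lemma vol_eq_chart_volume:
  assumes "c \<in> M" "A \<in> sets borel" "A \<subseteq> fst c"
  shows "vol M g A = chart_volume c A"
proof -
  have "volume_measure M g = (THE \<mu>. sets \<mu> = sets borel \<and>
     (\<forall>c\<in>M. \<forall>A\<in>sets borel. A \<subseteq> fst c \<longrightarrow> emeasure \<mu> A = chart_volume c A))"
    by (simp add: volume_measure_def chart_volume_def gram_density_def)
  then show ?thesis using theI'[OF volume_measure_unique] assms by simp
qed

end

section \<open>Comparison on thin cones\<close>

text \<open>The second derivative in direction \<open>y\<close> becomes a quadratic form in
  \<open>y\<close> whose coefficients are continuous in \<open>x\<close>. This is what gives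
  continuity jointly in base point and direction.\<close>

lemma dird2_expand:
  fixes \<delta> :: "'e::euclidean_space \<Rightarrow> real"
  assumes S: "open S" "x \<in> S" and \<delta>: "Ck_on 2 S \<delta>"
  shows "dird (dird \<delta> y) y x = (\<Sum>b\<in>Basis. \<Sum>b'\<in>Basis. (y \<bullet> b) * (y \<bullet> b') * dird (dird \<delta> b) b' x)"
proof -
  have d1: "\<delta> differentiable (at z)" and d2: "dird \<delta> u differentiable (at z)" if "z \<in> S" for z u
    using \<delta> that by (auto simp: numeral_2_eq_2)
  have "dird (dird \<delta> y) y x = (\<Sum>b'\<in>Basis. (y \<bullet> b') * dird (dird \<delta> y) b' x)"
    using dird_expand[OF d2[OF S(2)], of y y] by simp
  also have "\<dots> = (\<Sum>b'\<in>Basis. (y \<bullet> b') * dird (dird \<delta> b') y x)"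
    using dird_symmetric[OF S \<delta>, of y] by simp
  also have "\<dots> = (\<Sum>b\<in>Basis. \<Sum>b'\<in>Basis. (y \<bullet> b) * (y \<bullet> b') * dird (dird \<delta> b) b' x)"
  proof -
    have "dird (dird \<delta> b) y x = (\<Sum>b'\<in>Basis. (y \<bullet> b') * dird (dird \<delta> b) b' x)" for b
      using dird_expand[OF d2[OF S(2), of b], of y] by simp
    then show ?thesis by (simp add: sum_distrib_left mult.assoc)
  qed
  finally show ?thesis .
qed

text \<open>Value and slope of \<open>\<delta>\<close> vanish at 0, so by Taylor's formula with
  Lagrange remainder the sign of \<open>\<delta>\<close> on a ray is that of a second derivative at
  an intermediate point. Joint continuity keeps the latter positive for all directions near
  \<open>\<xi>\<close> and all points near 0.\<close>

lemma positive_on_cone: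
  fixes \<delta> :: "'e::euclidean_space \<Rightarrow> real"
  assumes e: "e > 0" and \<delta>: "Ck_on 2 (ball 0 e) \<delta>" and \<delta>0: "\<delta> 0 = 0" "\<And>v. dird \<delta> v 0 = 0"
    and pos: "dird (dird \<delta> \<xi>) \<xi> 0 > 0"
  obtains \<epsilon> r where "\<epsilon> > 0" "r > 0" "\<And>t y. 0 < t \<Longrightarrow> t < r \<Longrightarrow> y \<in> ball \<xi> \<epsilon> \<Longrightarrow> \<delta> (t *\<^sub>R y) > 0"
proof -
  have d1: "\<delta> differentiable (at z)" and d2: "dird \<delta> u differentiable (at z)" if "z \<in> ball 0 e" for z u
    using \<delta> that by (auto simp: numeral_2_eq_2)
  let ?q = "\<lambda>z. \<Sum>b\<in>Basis. \<Sum>b'\<in>Basis. (snd z \<bullet> b) * (snd z \<bullet> b') * dird (dird \<delta> b) b' (fst z)"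
  have q: "dird (dird \<delta> y) y x = ?q (x, y)" if "x \<in> ball 0 e" for x y
    using dird2_expand[OF _ that \<delta>] by simp
  have "continuous_on (ball 0 e \<times> UNIV) ?q"
  proof (intro continuous_intros)
    fix b b' :: 'e
    have "continuous_on (ball 0 e) (dird (dird \<delta> b) b')" using \<delta> by (simp add: numeral_2_eq_2)
    then show "continuous_on (ball 0 e \<times> UNIV) (\<lambda>z. dird (dird \<delta> b) b' (fst z))"
      by (rule continuous_on_compose2) (auto intro: continuous_intros)
  qed
  then have "open ((ball 0 e \<times> UNIV) \<inter> ?q -` {0<..})"
    by (rule continuous_open_preimage) (auto intro: open_Times)
  moreover have "(0, \<xi>) \<in> (ball 0 e \<times> UNIV) \<inter> ?q -` {0<..}" using e pos q[of 0 \<xi>] by simp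
  ultimately obtain A B where AB: "open A" "open B" "(0, \<xi>) \<in> A \<times> B" "A \<times> B \<subseteq> (ball 0 e \<times> UNIV) \<inter> ?q -` {0<..}"
    by (rule open_prod_elim)
  then have AB': "0 \<in> A" "\<xi> \<in> B" by auto
  obtain \<epsilon> where \<epsilon>: "\<epsilon> > 0" "ball \<xi> \<epsilon> \<subseteq> B" using AB(2) AB'(2) openE by blast
  obtain a where a: "a > 0" "ball 0 a \<subseteq> A" using AB(1) AB'(1) openE by blast
  have n: "norm \<xi> + \<epsilon> > 0" using \<epsilon> by (simp add: add_nonneg_pos)
  show ?thesis
  proof (rule that[OF \<epsilon>(1), of "a / (norm \<xi> + \<epsilon>)"])
    show "a / (norm \<xi> + \<epsilon>) > 0" using a n by simp
    fix t y assume t: "0 < t" "t < a / (norm \<xi> + \<epsilon>)" and y: "y \<in> ball \<xi> \<epsilon>"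
    have in_A: "s *\<^sub>R y \<in> A" if "0 \<le> s" "s \<le> t" for s
    proof -
      have "norm y \<le> norm \<xi> + norm (y - \<xi>)" using norm_triangle_sub by blast
      then have "norm y \<le> norm \<xi> + \<epsilon>" using y by (simp add: dist_norm norm_minus_commute)
      then have "norm (s *\<^sub>R y) \<le> t * (norm \<xi> + \<epsilon>)" using that t by (simp add: mult_mono)
      also have "\<dots> < a" using t n by (simp add: field_simps)
      finally show ?thesis using a by auto
    qed
    have in_b: "s *\<^sub>R y \<in> ball 0 e \<and> dird (dird \<delta> y) y (s *\<^sub>R y) > 0" if "0 \<le> s" "s \<le> t" for s
    proof -
      have "(s *\<^sub>R y, y) \<in> A \<times> B" using in_A[OF that] y \<epsilon> by blast
      then have "(s *\<^sub>R y, y) \<in> (ball 0 e \<times> UNIV) \<inter> ?q -` {0<..}" using AB(4) by (rule subsetD[rotated])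
      then show ?thesis using q[of "s *\<^sub>R y" y] by simp
    qed
    define diff where "diff m s = (if m = 0 then \<delta> (s *\<^sub>R y) else if m = 1 then dird \<delta> y (s *\<^sub>R y)
      else dird (dird \<delta> y) y (s *\<^sub>R y))" for m :: nat and s
    have "\<exists>s. 0 < s \<and> s < t \<and> \<delta> (t *\<^sub>R y) = (\<Sum>m<2. (diff m 0 / fact m) * t ^ m) + (diff 2 s / fact 2) * t ^ 2"
    proof (rule Maclaurin[OF t(1)])
      show "diff 0 = (\<lambda>t. \<delta> (t *\<^sub>R y))" by (auto simp: diff_def)
      show "\<forall>m s. m < 2 \<and> 0 \<le> s \<and> s \<le> t \<longrightarrow> ((diff m has_real_derivative diff (Suc m) s) (at s))"
      proof (intro allI impI)
        fix m :: nat and s assume ms: "m < 2 \<and> 0 \<le> s \<and> s \<le> t"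
        then have b: "s *\<^sub>R y \<in> ball 0 e" using in_b by blast
        from ms consider "m = 0" | "m = 1" by linarith
        then show "(diff m has_real_derivative diff (Suc m) s) (at s)"
        proof cases
          case 1
          then show ?thesis
            using line_has_real_derivative[of \<delta> 0 s y] d1[OF b] by (simp add: diff_def[abs_def])
        next
          case 2
          then show ?thesis
            using line_has_real_derivative[of "dird \<delta> y" 0 s y] d2[OF b] by (simp add: diff_def[abs_def])
        qed
      qed
    qed auto
    then obtain s where s: "0 < s" "s < t"
      "\<delta> (t *\<^sub>R y) = (\<Sum>m<2. (diff m 0 / fact m) * t ^ m) + (diff 2 s / fact 2) * t ^ 2" by blast
    have eq: "\<delta> (t *\<^sub>R y) = dird (dird \<delta> y) y (s *\<^sub>R y) / 2 * t\<^sup>2"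
      using s(3) by (simp add: diff_def \<delta>0 numeral_2_eq_2)
    show "\<delta> (t *\<^sub>R y) > 0" unfolding eq using in_b[of s] s(1,2) t by simp
  qed
qed

lemma borel_measurable_continuous_on_open:
  fixes f :: "'e::euclidean_space \<Rightarrow> real"
  assumes "open C" "continuous_on C f"
  shows "(\<lambda>x. ennreal (f x) * indicator C x) \<in> borel_measurable lborel"
proof -
  have "(\<lambda>x. ennreal (f x) * indicator C x) = (\<lambda>x. ennreal (indicator C x *\<^sub>R f x))"
    by (auto simp: indicator_def)
  then show ?thesis
    using measurable_compose[OF borel_measurable_continuous_on_indicator[OF borel_open[OF assms(1)] assms(2)] measurable_ennreal]
    by simp
qed

text \<open>A nonempty open set is not negligible, so a strict inequality on it survives
  integration, provided the smaller integral is finite. Finiteness comes from the bound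
  \<open>K\<close> and the finite measure of \<open>C\<close>.\<close>

lemma set_nn_integral_less:
  fixes \<sigma> \<tau> :: "'e::euclidean_space \<Rightarrow> real"
  assumes C: "open C" "C \<noteq> {}" and fin: "emeasure lborel C < \<infinity>"
    and cont: "continuous_on C \<sigma>" "continuous_on C \<tau>"
    and bound: "\<And>x. x \<in> C \<Longrightarrow> \<sigma> x \<le> K" and less: "\<And>x. x \<in> C \<Longrightarrow> 0 \<le> \<sigma> x \<and> \<sigma> x < \<tau> x"
  shows "(\<integral>\<^sup>+x\<in>C. ennreal (\<sigma> x) \<partial>lborel) < (\<integral>\<^sup>+x\<in>C. ennreal (\<tau> x) \<partial>lborel)"
proof (rule nn_integral_less)
  show "(\<lambda>x. ennreal (\<sigma> x) * indicator C x) \<in> borel_measurable lborel"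
    "(\<lambda>x. ennreal (\<tau> x) * indicator C x) \<in> borel_measurable lborel"
    by (intro borel_measurable_continuous_on_open C cont)+
  have "(\<integral>\<^sup>+x\<in>C. ennreal (\<sigma> x) \<partial>lborel) \<le> (\<integral>\<^sup>+x. ennreal K * indicator C x \<partial>lborel)"
    by (rule nn_integral_mono) (use bound in \<open>auto simp: indicator_def ennreal_leI\<close>)
  also have "\<dots> = ennreal K * emeasure lborel C"
    using C by (simp add: nn_integral_cmult_indicator)
  also have "\<dots> < \<infinity>" using fin by (simp add: ennreal_mult_less_top)
  finally show "(\<integral>\<^sup>+x\<in>C. ennreal (\<sigma> x) \<partial>lborel) \<noteq> \<infinity>" by simp
  show "AE x in lborel. ennreal (\<sigma> x) * indicator C x \<le> ennreal (\<tau> x) * indicator C x"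
  proof (rule AE_I2)
    fix x
    show "ennreal (\<sigma> x) * indicator C x \<le> ennreal (\<tau> x) * indicator C x"
      using less[of x] by (cases "x \<in> C") (auto intro: ennreal_leI)
  qed
  show "\<not> (AE x in lborel. ennreal (\<tau> x) * indicator C x \<le> ennreal (\<sigma> x) * indicator C x)"
  proof
    assume "AE x in lborel. ennreal (\<tau> x) * indicator C x \<le> ennreal (\<sigma> x) * indicator C x"
    then have "AE x in lborel. x \<notin> C"
    proof eventually_elim
      fix x assume "ennreal (\<tau> x) * indicator C x \<le> ennreal (\<sigma> x) * indicator C x"
      then show "x \<notin> C" using less[of x] by (auto simp: ennreal_le_iff2 not_le)
    qed
    then have "C \<in> null_sets lborel" using C by (simp add: AE_iff_null_sets[symmetric])
    then have "negligible C" by (simp add: negligible_iff_null_sets null_sets_completionI)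
    then show False using open_not_negligible C by blast
  qed
qed

text \<open>The neighbourhood is a cone around \<open>\<xi>\<close>, on which the integrands are ordered, together with a ball
  so small that it cannot compensate the gain on the cone.\<close>

lemma starshaped_integral_less:
  fixes \<sigma> \<tau> :: "'e::euclidean_space \<Rightarrow> real"
  assumes e: "e > 0" and C2: "Ck_on 2 (ball 0 e) \<sigma>" "Ck_on 2 (ball 0 e) \<tau>"
    and d0: "\<sigma> 0 = d0" "\<tau> 0 = d0" "d0 \<noteq> 0" and crit: "\<And>v. dird \<sigma> v 0 = 0" "\<And>v. dird \<tau> v 0 = 0"
    and second: "dird (dird \<sigma> \<xi>) \<xi> 0 / d0 < dird (dird \<tau> \<xi>) \<xi> 0 / d0"
    and N: "open N" "0 \<in> N"
  obtains W where "open W" "0 \<in> W" "\<And>v. v \<in> W \<Longrightarrow> closed_segment 0 v \<subseteq> W" "W \<subseteq> N" "W \<subseteq> ball 0 e"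
    "(\<integral>\<^sup>+x\<in>W. ennreal (sqrt \<bar>\<sigma> x\<bar>) \<partial>lborel) < (\<integral>\<^sup>+x\<in>W. ennreal (sqrt \<bar>\<tau> x\<bar>) \<partial>lborel)"
proof -
  \<comment> \<open>The common value \<open>d0\<close> may be negative. After division by it,
    positivity of \<open>\<delta>\<close> means that \<open>\<tau>\<close> has the larger absolute
    value wherever both functions keep the sign of \<open>d0\<close>.\<close>
  define \<delta> where "\<delta> x = (\<tau> x - \<sigma> x) * inverse d0" for x
  have d\<sigma>: "\<sigma> differentiable (at z)" "dird \<sigma> u differentiable (at z)"
    and d\<tau>: "\<tau> differentiable (at z)" "dird \<tau> u differentiable (at z)" if "z \<in> ball 0 e" for z u
    using C2 that by (auto simp: numeral_2_eq_2)
  have dd: "dird (\<lambda>x. (f x - h x) * inverse d0) v z = (dird f v z - dird h v z) * inverse d0"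
    "(\<lambda>x. (f x - h x) * inverse d0) differentiable (at z)"
    if "f differentiable (at z)" "h differentiable (at z)" for f h :: "'e \<Rightarrow> real" and v z
  proof -
    have "((\<lambda>x. (f x - h x) * inverse d0) has_derivative (\<lambda>v. (dird f v z - dird h v z) * inverse d0)) (at z)"
      using that by (intro has_derivative_mult_left has_derivative_diff has_derivative_dird)
    then show "dird (\<lambda>x. (f x - h x) * inverse d0) v z = (dird f v z - dird h v z) * inverse d0"
      "(\<lambda>x. (f x - h x) * inverse d0) differentiable (at z)"
      by (auto simp: dird_eq differentiable_def)
  qed
  have \<delta>C: "Ck_on 2 (ball 0 e) \<delta>"
    unfolding \<delta>_def by (intro Ck_on_mult Ck_on_diff C2 Ck_on_const) auto
  have \<delta>1: "dird \<delta> v z = (dird \<tau> v z - dird \<sigma> v z) * inverse d0" "\<delta> differentiable (at z)" if "z \<in> ball 0 e" for v z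
    using dd d\<sigma> d\<tau> that unfolding \<delta>_def[abs_def] by auto
  have "dird (dird \<delta> \<xi>) \<xi> 0 = dird (\<lambda>z. (dird \<tau> \<xi> z - dird \<sigma> \<xi> z) * inverse d0) \<xi> 0"
    by (rule dird_cong_open(1)[of "ball 0 e"]) (use e \<delta>1 \<delta>C in \<open>auto simp: numeral_2_eq_2\<close>)
  also have "\<dots> = (dird (dird \<tau> \<xi>) \<xi> 0 - dird (dird \<sigma> \<xi>) \<xi> 0) * inverse d0"
    using dd(1)[OF d\<tau>(2) d\<sigma>(2)] e by simp
  finally have pos: "dird (dird \<delta> \<xi>) \<xi> 0 > 0" using second by (simp add: divide_inverse left_diff_distrib)
  obtain \<epsilon> r0 where \<epsilon>: "\<epsilon> > 0" "r0 > 0" "\<And>t y. 0 < t \<Longrightarrow> t < r0 \<Longrightarrow> y \<in> ball \<xi> \<epsilon> \<Longrightarrow> \<delta> (t *\<^sub>R y) > 0"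
    using positive_on_cone[OF e \<delta>C _ _ pos] d0 crit \<delta>1(1)[of 0] e by (auto simp: \<delta>_def)
  \<comment> \<open>Positivity of the quotient fixes the sign of the functions near 0, and the upper
    limit 2 yields the uniform bound \<open>K\<close> on the roots.\<close>
  have ev: "\<forall>\<^sub>F x in nhds 0. f x / d0 \<in> {0<..<2}" if "Ck_on 2 (ball 0 e) f" "f 0 = d0" for f
  proof -
    have "isCont f 0"
      using Ck_on_continuous[OF that(1)] e by (simp add: continuous_on_eq_continuous_at)
    then have "(f \<longlongrightarrow> d0) (nhds 0)"
      using tendsto_at_iff_tendsto_nhds[of f 0] that(2) by (simp add: isCont_def)
    then have "((\<lambda>x. f x / d0) \<longlongrightarrow> d0 / d0) (nhds 0)" using d0 by (intro tendsto_intros)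
    then show ?thesis using d0 by (intro topological_tendstoD) auto
  qed
  have "\<forall>\<^sub>F x in nhds 0. \<sigma> x / d0 \<in> {0<..<2} \<and> \<tau> x / d0 \<in> {0<..<2} \<and> x \<in> N \<and> x \<in> ball 0 e"
    using ev[OF C2(1) d0(1)] ev[OF C2(2) d0(2)] N e
    by (intro eventually_conj eventually_nhds_in_open) auto
  then obtain r1 where r1: "r1 > 0" "\<And>x. norm x < r1 \<Longrightarrow> \<sigma> x / d0 \<in> {0<..<2} \<and> \<tau> x / d0 \<in> {0<..<2} \<and> x \<in> N \<and> x \<in> ball 0 e"
    unfolding eventually_nhds_metric by (auto simp: dist_norm)
  have n: "norm \<xi> + \<epsilon> > 0" using \<epsilon>(1) by (simp add: add_nonneg_pos)
  define t0 where "t0 = min r0 (r1 / (norm \<xi> + \<epsilon>))"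
  have t0: "t0 > 0" using \<epsilon> r1 n by (simp add: t0_def)
  define C where "C = {x. \<exists>t y. 0 < t \<and> t < t0 \<and> y \<in> ball \<xi> \<epsilon> \<and> x = t *\<^sub>R y}"
  have "C = (\<Union>t\<in>{0<..<t0}. (\<lambda>y. t *\<^sub>R y) ` ball \<xi> \<epsilon>)" unfolding C_def by auto
  then have "open C" by (simp only:) (intro open_UN ballI open_scaling; auto)
  have "\<exists>t y. 0 < t \<and> t < t0 \<and> y \<in> ball \<xi> \<epsilon> \<and> (t0/2) *\<^sub>R \<xi> = t *\<^sub>R y"
    using t0 \<epsilon>(1) by (intro exI[of _ "t0/2"] exI[of _ \<xi>]) auto
  then have "(t0/2) *\<^sub>R \<xi> \<in> C" unfolding C_def by (rule CollectI)
  have C_small: "norm x < r1" if x: "x \<in> C" for x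
  proof -
    obtain t y where ty: "0 < t" "t < t0" "y \<in> ball \<xi> \<epsilon>" "x = t *\<^sub>R y"
      using x unfolding C_def by blast
    have "norm y \<le> norm \<xi> + norm (y - \<xi>)" using norm_triangle_sub by blast
    then have "norm y \<le> norm \<xi> + \<epsilon>" using ty(3) by (simp add: dist_norm norm_minus_commute)
    then have "norm x \<le> t * (norm \<xi> + \<epsilon>)" using ty by (simp add: mult_left_mono)
    also have "\<dots> < t0 * (norm \<xi> + \<epsilon>)" using ty n by simp
    also have "\<dots> \<le> (r1 / (norm \<xi> + \<epsilon>)) * (norm \<xi> + \<epsilon>)" using n by (intro mult_right_mono) (auto simp: t0_def)
    finally show ?thesis using n by simp
  qed
  have C_pos: "\<delta> x > 0" if x: "x \<in> C" for x
  proof -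
    obtain t y where "0 < t" "t < t0" "y \<in> ball \<xi> \<epsilon>" "x = t *\<^sub>R y" using x unfolding C_def by blast
    then show ?thesis using \<epsilon>(3)[of t y] by (simp add: t0_def)
  qed
  let ?s = "\<lambda>x. sqrt \<bar>\<sigma> x\<bar>" and ?t = "\<lambda>x. sqrt \<bar>\<tau> x\<bar>"
  define K where "K = sqrt (2 * \<bar>d0\<bar>)"
  have K: "K \<ge> 0" by (simp add: K_def)
  have abs_eq: "\<bar>f\<bar> = \<bar>d0\<bar> * (f / d0)" if "f / d0 > 0" for f
    using that d0(3) by (auto simp: abs_if field_simps zero_less_divide_iff)
  have bound: "?s x \<le> K" if "norm x < r1" for x
  proof -
    have q: "0 < \<sigma> x / d0" "\<sigma> x / d0 < 2" using r1(2)[OF that] by auto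
    have "\<bar>d0\<bar> * (\<sigma> x / d0) \<le> \<bar>d0\<bar> * 2" using q(2) by (intro mult_left_mono) auto
    then show ?thesis unfolding K_def abs_eq[OF q(1)] by (simp add: mult.commute)
  qed
  have ineq: "?s x < ?t x" if x: "x \<in> C" for x
  proof -
    have q0: "\<sigma> x / d0 < \<tau> x / d0" using C_pos[OF x] by (simp add: \<delta>_def divide_inverse left_diff_distrib)
    have "\<bar>\<sigma> x\<bar> < \<bar>\<tau> x\<bar>"
    proof -
      have q: "0 < \<sigma> x / d0" "0 < \<tau> x / d0" using r1(2)[OF C_small[OF x]] by auto
      have "\<bar>d0\<bar> * (\<sigma> x / d0) < \<bar>d0\<bar> * (\<tau> x / d0)" using q0 d0(3) by (intro mult_strict_left_mono) auto
      then show "\<bar>\<sigma> x\<bar> < \<bar>\<tau> x\<bar>" unfolding abs_eq[OF q(1)] abs_eq[OF q(2)] .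
    qed
    then show ?thesis by simp
  qed
  have sub: "ball (0 :: 'e) r1 \<subseteq> ball 0 e"
  proof
    fix x :: 'e assume "x \<in> ball 0 r1"
    then show "x \<in> ball 0 e" using r1(2)[of x] by simp
  qed
  have cont: "continuous_on (ball 0 r1) ?s" "continuous_on (ball 0 r1) ?t"
    using Ck_on_continuous[OF Ck_on_subset[OF C2(1) sub]] Ck_on_continuous[OF Ck_on_subset[OF C2(2) sub]]
    by (auto intro: continuous_intros)
  have C_sub: "C \<subseteq> ball 0 r1" using C_small by auto
  have less: "(\<integral>\<^sup>+x\<in>C. ennreal (?s x) \<partial>lborel) < (\<integral>\<^sup>+x\<in>C. ennreal (?t x) \<partial>lborel)" (is "?a < ?b")
  proof (rule set_nn_integral_less[where K = K])
    have "emeasure lborel C \<le> emeasure lborel (ball (0 :: 'e) r1)" using C_sub by (intro emeasure_mono) auto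
    also have "\<dots> < \<infinity>" using emeasure_lborel_ball_finite by blast
    finally show "emeasure lborel C < \<infinity>" .
  qed (use \<open>open C\<close> \<open>(t0/2) *\<^sub>R \<xi> \<in> C\<close> ineq bound C_small cont continuous_on_subset[OF _ C_sub] in auto)
  \<comment> \<open>A value strictly between the two integrals over the cone leaves room
    \<open>\<beta> - \<alpha>\<close> for the ball, whose contribution to the smaller integral is at
    most \<open>K\<close> times its volume.\<close>
  obtain m where m: "?a < m" "m < ?b" using dense less by blast
  obtain \<alpha> \<beta> where \<alpha>: "?a = ennreal \<alpha>" "\<alpha> \<ge> 0" and \<beta>: "m = ennreal \<beta>" "\<beta> \<ge> 0" "\<alpha> < \<beta>"
  proof -
    have "m < top" by (rule order.strict_trans2[OF m(2) top_greatest])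
    then obtain \<beta> where "m = ennreal \<beta>" "\<beta> \<ge> 0" using less_top_ennreal by blast
    moreover have "?a < top" by (rule order.strict_trans[OF m(1) \<open>m < top\<close>])
    then obtain \<alpha> where "?a = ennreal \<alpha>" "\<alpha> \<ge> 0" using less_top_ennreal by blast
    ultimately show ?thesis using m(1) by (intro that[of \<alpha> \<beta>]) (simp_all add: ennreal_less_iff)
  qed
  let ?v = "\<lambda>r. K * (unit_ball_vol (real DIM('e)) * r ^ DIM('e))"
  have "(?v \<longlongrightarrow> K * (unit_ball_vol (real DIM('e)) * 0 ^ DIM('e))) (at_right 0)"
    by (intro tendsto_intros)
  then have "(?v \<longlongrightarrow> 0) (at_right 0)" by (simp add: zero_power)
  then have "\<forall>\<^sub>F r in at_right 0. ?v r < \<beta> - \<alpha>" using \<beta>(3) by (intro order_tendstoD(2)) auto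
  moreover have "\<forall>\<^sub>F r in at_right 0. r \<in> {0<..<r1}" using r1(1) by (rule eventually_at_right_real)
  ultimately have "\<forall>\<^sub>F r in at_right 0. ?v r < \<beta> - \<alpha> \<and> r \<in> {0<..<r1}" by (rule eventually_conj)
  then obtain r where r: "?v r < \<beta> - \<alpha>" "0 < r" "r < r1"
    using eventually_happens[of _ "at_right (0::real)"] trivial_limit_at_right_real by (metis (no_types, lifting) greaterThanLessThan_iff)
  define W where "W = C \<union> ball 0 r"
  have W_small: "norm x < r1" if "x \<in> W" for x using that C_small r by (auto simp: W_def)
  show ?thesis
  proof (rule that[of W])
    show "open W" using \<open>open C\<close> by (auto simp: W_def)
    show "0 \<in> W" using r by (simp add: W_def)
    show "W \<subseteq> N" "W \<subseteq> ball 0 e" using W_small r1(2) by blast+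
    show "closed_segment 0 v \<subseteq> W" if v: "v \<in> W" for v
    proof
      fix x assume "x \<in> closed_segment 0 v"
      then obtain s where s: "0 \<le> s" "s \<le> 1" "x = s *\<^sub>R v" by (auto simp: closed_segment_def)
      show "x \<in> W"
      \<comment> \<open>The cone is stable under shortening of vectors except for its apex 0, which
        lies in the ball.\<close>
      proof (cases "s = 0 \<or> v \<in> ball 0 r")
        case True
        have "norm x \<le> norm v" using s by (simp add: mult_left_le_one_le)
        then have "x \<in> ball 0 r" using True s r by auto
        then show ?thesis by (simp add: W_def)
      next
        case False
        then obtain t y where ty: "0 < t" "t < t0" "y \<in> ball \<xi> \<epsilon>" "v = t *\<^sub>R y" using v unfolding W_def C_def by blast
        have "s * t \<le> 1 * t" using s ty by (intro mult_right_mono) auto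
        then have "s * t < t0" using ty(2) by simp
        moreover have "0 < s * t" "x = (s * t) *\<^sub>R y" using s ty False by auto
        ultimately show ?thesis using ty(3) unfolding W_def C_def by blast
      qed
    qed
    have "(\<integral>\<^sup>+x\<in>W. ennreal (?s x) \<partial>lborel) \<le>
      (\<integral>\<^sup>+x. ennreal (?s x) * indicator C x + ennreal (?s x) * indicator (ball 0 r) x \<partial>lborel)"
      by (rule nn_integral_mono) (auto simp: W_def indicator_def)
    also have "\<dots> = ?a + (\<integral>\<^sup>+x\<in>ball 0 r. ennreal (?s x) \<partial>lborel)"
      by (intro nn_integral_add borel_measurable_continuous_on_open \<open>open C\<close> open_ball
          continuous_on_subset[OF cont(1)] C_sub subset_ball less_imp_le[OF r(3)])
    also have "\<dots> \<le> ?a + ennreal (?v r)"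
    proof (rule add_left_mono)
      have "(\<integral>\<^sup>+x\<in>ball 0 r. ennreal (?s x) \<partial>lborel) \<le> (\<integral>\<^sup>+x. ennreal K * indicator (ball (0 :: 'e) r) x \<partial>lborel)"
        by (rule nn_integral_mono) (use bound r in \<open>auto simp: indicator_def intro!: ennreal_leI\<close>)
      also have "\<dots> = ennreal K * emeasure lborel (ball (0 :: 'e) r)"
        by (simp add: nn_integral_cmult_indicator)
      also have "\<dots> = ennreal (?v r)"
        using r K by (simp add: emeasure_ball ennreal_mult)
      finally show "(\<integral>\<^sup>+x\<in>ball 0 r. ennreal (?s x) \<partial>lborel) \<le> ennreal (?v r)" .
    qed
    also have "?a + ennreal (?v r) = ennreal (\<alpha> + ?v r)"
      using \<alpha> K r by (simp add: ennreal_plus)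
    also have "\<dots> < ennreal \<beta>" using r \<beta> \<alpha> by (intro ennreal_lessI) auto
    also have "\<dots> < ?b" using m \<beta> by simp
    also have "?b \<le> (\<integral>\<^sup>+x\<in>W. ennreal (?t x) \<partial>lborel)"
      by (rule nn_integral_mono) (auto simp: W_def indicator_def)
    finally show "(\<integral>\<^sup>+x\<in>W. ennreal (?s x) \<partial>lborel) < (\<integral>\<^sup>+x\<in>W. ennreal (?t x) \<partial>lborel)" .
  qed
qed

section \<open>Volumes of small normal neighbourhoods\<close>

text \<open>The point is that the image of \<open>W\<close> is open. In each chart it is the
  preimage of \<open>W\<close> under the inverse of \<open>f\<close> in coordinates, which is
  continuous because it is smooth, and the charts cover the manifold. The other clauses restrict,
  since the inverses on \<open>W\<close> and on \<open>S\<close> agree on the image.\<close>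

lemma (in smooth_atlas) diffeo_onto_restrict:
  assumes f: "diffeo_onto M S V f" and W: "open W" "W \<subseteq> S"
  shows "diffeo_onto M W (f ` W) f"
proof -
  have inj: "inj_on f S" and im: "f ` S = V" and sm: "smooth_into M S f" "smooth_from M V (inv_into S f)" and V: "open V"
    using f by (auto simp: diffeo_onto_def bij_betw_def)
  have injW: "inj_on f W" using inj W(2) inj_on_subset by blast
  have inv_eq: "inv_into W f q = inv_into S f q" if "q \<in> f ` W" for q
    using that inj injW W(2) by (auto simp: subset_iff inv_into_f_f)
  have fW: "fst c \<inter> f ` W = fst c \<inter> snd c -` (snd c ` (fst c \<inter> V) \<inter> (inv_into S f \<circ> chart_inv c) -` W)" if c: "c \<in> M" for c
  proof
    show "fst c \<inter> f ` W \<subseteq> fst c \<inter> snd c -` (snd c ` (fst c \<inter> V) \<inter> (inv_into S f \<circ> chart_inv c) -` W)"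
      using im W(2) inj chart_inv_snd[OF c] by (auto simp: subset_iff inv_into_f_f)
    show "fst c \<inter> snd c -` (snd c ` (fst c \<inter> V) \<inter> (inv_into S f \<circ> chart_inv c) -` W) \<subseteq> fst c \<inter> f ` W"
    proof
      fix q assume q: "q \<in> fst c \<inter> snd c -` (snd c ` (fst c \<inter> V) \<inter> (inv_into S f \<circ> chart_inv c) -` W)"
      then obtain q' where q': "q' \<in> fst c" "q' \<in> V" "snd c q = snd c q'" by auto
      then have "q = q'" using q chart_inv_snd[OF c] by (metis IntD1)
      then have "f (inv_into S f q) = q" using q' im by (auto intro: f_inv_into_f)
      moreover have "inv_into S f (chart_inv c (snd c q)) \<in> W" using q by simp
      then have "inv_into S f q \<in> W" using q chart_inv_snd[OF c] by simp
      ultimately show "q \<in> fst c \<inter> f ` W" using q by (metis IntD1 IntI imageI)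
    qed
  qed
  have open_cW: "open (fst c \<inter> f ` W)" if c: "c \<in> M" for c
    unfolding fW[OF c]
  proof (rule continuous_open_preimage[OF chart_continuous(1)[OF c] chart_open(1)[OF c]])
    have "continuous_on (snd c ` (fst c \<inter> V)) (inv_into S f \<circ> chart_inv c)"
      by (rule smooth_on_continuous) (use sm(2) c in \<open>simp add: smooth_from_def\<close>)
    then show "open (snd c ` (fst c \<inter> V) \<inter> (inv_into S f \<circ> chart_inv c) -` W)"
      by (rule continuous_open_preimage[OF _ chart_image_open[OF c V] W(1)])
  qed
  have "f ` W = (\<Union>c\<in>M. fst c \<inter> f ` W)" using manifold by (auto simp: smooth_manifold_def)
  then have oW: "open (f ` W)" using open_cW by (metis (no_types, lifting) open_UN)
  have "smooth_into M W f"
    unfolding smooth_into_def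
  proof (intro conjI ballI)
    show "continuous_on W f" using sm(1) W(2) continuous_on_subset unfolding smooth_into_def by blast
    show "smooth_on (W \<inter> f -` fst c) (snd c \<circ> f)" if "c \<in> M" for c
      by (rule smooth_on_subset[of "S \<inter> f -` fst c"]) (use sm(1) W(2) that in \<open>auto simp: smooth_into_def\<close>)
  qed
  moreover have "smooth_from M (f ` W) (inv_into W f)"
    unfolding smooth_from_def
  proof
    fix c assume c: "c \<in> M"
    show "smooth_on (snd c ` (fst c \<inter> f ` W)) (inv_into W f \<circ> chart_inv c)"
    proof (rule smooth_on_cong[OF chart_image_open[OF c oW]])
      show "smooth_on (snd c ` (fst c \<inter> f ` W)) (inv_into S f \<circ> chart_inv c)"
        by (rule smooth_on_subset[of "snd c ` (fst c \<inter> V)"])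
          (use sm(2) c im W(2) in \<open>auto simp: smooth_from_def\<close>)
    qed (auto simp: chart_inv_snd[OF c] inv_eq)
  qed
  ultimately show ?thesis using W(1) oW injW by (simp add: diffeo_onto_def bij_betw_def)
qed

context semi_riemannian_manifold begin

lemma normal_nbhd_via_restrict:
  assumes V: "normal_nbhd_via M g p Vb V" and W: "open W" "W \<subseteq> Vb" "0 \<in> W" "\<And>v. v \<in> W \<Longrightarrow> closed_segment 0 v \<subseteq> W"
  shows "normal_nbhd_via M g p W (exp_map M g p ` W)" "open (exp_map M g p ` W)" "exp_map M g p ` W \<subseteq> V"
proof -
  have d: "diffeo_onto M Vb V (exp_map M g p)" and dom: "Vb \<subseteq> exp_dom M g p"
    using V by (auto simp: normal_nbhd_via_def)
  note d' = diffeo_onto_restrict[OF d W(1,2)]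
  show "normal_nbhd_via M g p W (exp_map M g p ` W)"
    using W d' dom by (auto simp: normal_nbhd_via_def)
  show "open (exp_map M g p ` W)" using d' by (simp add: diffeo_onto_def)
  show "exp_map M g p ` W \<subseteq> V" using d W(2) by (auto simp: diffeo_onto_def bij_betw_def)
qed

text \<open>Collects what the comparison needs from one manifold, expressed on the tangent space
  without charts. In the last clause \<open>A\<close> will be the identity for the first manifold
  and the isometry for the second, so that both volumes are integrals over the same
  \<open>W\<close>; the factor \<open>(det (matrix A))\<^sup>2\<close> under the root is the
  Jacobian of \<open>A\<close>.\<close>

definition squared_density :: "'a \<Rightarrow> real \<Rightarrow> (real ^ 'n \<Rightarrow> real) \<Rightarrow> bool" where
  "squared_density p e \<sigma> \<longleftrightarrow> e > 0 \<and> Ck_on 2 (ball 0 e) \<sigma> \<and>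
    \<sigma> 0 = det (\<chi> i j. g p (axis i 1) (axis j 1)) \<and> \<sigma> 0 \<noteq> 0 \<and> (\<forall>v. dird \<sigma> v 0 = 0) \<and>
    (\<forall>v. dird (dird \<sigma> v) v 0 = - 2/3 * \<sigma> 0 * ricci M g p v v) \<and>
    (\<forall>A W. linear A \<longrightarrow> bij A \<longrightarrow> open W \<longrightarrow> A ` W \<subseteq> ball 0 e \<longrightarrow>
       vol M g (exp_map M g p ` A ` W) = (\<integral>\<^sup>+x\<in>W. ennreal (sqrt \<bar>(det (matrix A))\<^sup>2 * \<sigma> (A x)\<bar>) \<partial>lborel))"

lemma squared_densityD:
  assumes "squared_density p e \<sigma>"
  shows "e > 0" "Ck_on 2 (ball 0 e) \<sigma>" "\<sigma> 0 = det (\<chi> i j. g p (axis i 1) (axis j 1))" "\<sigma> 0 \<noteq> 0"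
    "dird \<sigma> v 0 = 0" "dird (dird \<sigma> v) v 0 = - 2/3 * \<sigma> 0 * ricci M g p v v"
    "linear A \<Longrightarrow> bij A \<Longrightarrow> open W \<Longrightarrow> A ` W \<subseteq> ball 0 e \<Longrightarrow>
       vol M g (exp_map M g p ` A ` W) = (\<integral>\<^sup>+x\<in>W. ennreal (sqrt \<bar>(det (matrix A))\<^sup>2 * \<sigma> (A x)\<bar>) \<partial>lborel)"
  using assms unfolding squared_density_def by blast+

text \<open>The witness is \<open>dens2\<close> for the exponential map in the preferred chart at
  \<open>p\<close>. The radius \<open>e\<close> keeps the image inside that chart, so the volume
  clause is a single change of variables along the exponential map composed with
  \<open>A\<close>.\<close>

lemma squared_density_exists:
  assumes V: "normal_nbhd_via M g p Vb V"
  obtains e \<sigma> where "ball 0 e \<subseteq> Vb" "exp_map M g p 0 = p" "squared_density p e \<sigma>"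
proof -
  define c where "c = chart_at M p"
  let ?exp = "exp_map M g p"
  have c: "c \<in> M" "p \<in> fst c" using chart_at by (auto simp: c_def)
  obtain e where e: "e > 0" "ball 0 e \<subseteq> Vb" "?exp ` ball 0 e \<subseteq> fst c" "exp_chart p 0 = snd c p"
    and rad: "radial_geodesics (snd c ` fst c) (gram M g c) (exp_chart p) e"
    using radial_geodesics_exp[OF V] unfolding c_def by metis
  interpret radial_geodesics "snd c ` fst c" "gram M g c" "exp_chart p" e by (rule rad)
  have d: "diffeo_onto M Vb V ?exp" using V by (simp add: normal_nbhd_via_def)
  have inj: "inj_on ?exp (ball 0 e)"
    using d e(2) inj_on_subset by (auto simp: diffeo_onto_def bij_betw_def)
  have ch: "exp_chart p x = snd c (?exp x)" for x by (simp add: exp_chart_def c_def)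
  have exp0: "?exp 0 = p"
    using e(1,3,4) ch[of 0] chart_inv_snd[OF c(1)] c(2) by (metis centre_in_ball image_subset_iff)
  have inj_chart: "inj_on (exp_chart p) (ball 0 e)"
  proof (rule inj_onI)
    fix x y assume xy: "x \<in> ball 0 e" "y \<in> ball 0 e" "exp_chart p x = exp_chart p y"
    then have "?exp x = ?exp y" using e(3) ch chart_inv_snd[OF c(1)] by (metis image_subset_iff)
    then show "x = y" using inj xy by (auto dest: inj_onD)
  qed
  have ric: "ric0 v = ricci M g p v v" for v
    unfolding ric0_def e(4) ricci_def curvature_def c_def[symmetric] ..
  have det0: "det (gram M g c (exp_chart p 0)) = det (\<chi> i j. g p (axis i 1) (axis j 1))"
    using gram_at[of p] by (simp add: e(4) c_def)
  have "squared_density p e dens2"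
    unfolding squared_density_def
  proof (intro conjI allI impI)
    show "e > 0" "Ck_on 2 (ball 0 e) dens2" "dird dens2 v 0 = 0" for v
      using e(1) Ck_dens2 dens2_jet(1) by blast+
    show "dens2 0 = det (\<chi> i j. g p (axis i 1) (axis j 1))" by (simp add: dens2_0 det0)
    show "dens2 0 \<noteq> 0" using det_G[OF E0_U] by (simp add: dens2_0)
    show "dird (dird dens2 v) v 0 = - 2/3 * dens2 0 * ricci M g p v v" for v
      using dens2_jet(2)[of v] by (simp add: dens2_0 ric)
    fix A :: "real ^ 'n \<Rightarrow> real ^ 'n" and W :: "(real ^ 'n) set"
    assume A: "linear A" "bij A" and W: "open W" "A ` W \<subseteq> ball 0 e"
    have bA: "bounded_linear A" using A(1) linear_conv_bounded_linear by blast
    have sub: "A ` W \<subseteq> Vb" using W(2) e(2) by blast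
    have oAW: "open (A ` W)" using open_bijective_linear_image_eq[OF A] W(1) by simp
    have oexp: "open (?exp ` A ` W)"
      using diffeo_onto_restrict[OF d oAW sub] by (simp add: diffeo_onto_def)
    have in_c: "?exp ` A ` W \<subseteq> fst c" using e(3) W(2) by blast
    have "vol M g (?exp ` A ` W) = chart_volume c (?exp ` A ` W)"
      using oexp in_c by (intro vol_eq_chart_volume c) auto
    also have "\<dots> = (\<integral>\<^sup>+x\<in>W. ennreal (sqrt \<bar>(det (matrix A))\<^sup>2 * dens2 (A x)\<bar>) \<partial>lborel)"
    proof (rule chart_volume_image[OF c(1) _ _ in_c, where \<phi> = "exp_chart p \<circ> A" and \<phi>' = "\<lambda>x v. dird (exp_chart p) (A v) (A x)"])
      show "W \<in> sets borel" "?exp ` A ` W \<in> sets borel" using W(1) oexp by auto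
      show "(exp_chart p \<circ> A) ` W = snd c ` ?exp ` A ` W" by (simp add: image_image ch)
      show "inj_on (exp_chart p \<circ> A) W"
        by (rule comp_inj_on[OF inj_on_subset[OF bij_is_inj[OF A(2)] subset_UNIV] inj_on_subset[OF inj_chart W(2)]])
      have "continuous_on W (\<lambda>x. dens2 (A x))"
        by (rule continuous_on_compose2[OF Ck_on_continuous[OF Ck_dens2[of 0]] linear_continuous_on[OF bA] W(2)])
      then show "continuous_on W (\<lambda>x. sqrt \<bar>(det (matrix A))\<^sup>2 * dens2 (A x)\<bar>)"
        by (intro continuous_intros)
      fix x assume x: "x \<in> W"
      then have Ax: "A x \<in> ball 0 e" using W(2) by blast
      have dE: "exp_chart p differentiable (at (A x))"
        using smooth_on_differentiable[OF smooth_E Ax] .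
      show "(exp_chart p \<circ> A has_derivative (\<lambda>v. dird (exp_chart p) (A v) (A x))) (at x)"
        using diff_chain_at[OF bounded_linear_imp_has_derivative[OF bA] has_derivative_dird[OF dE]]
        by (simp add: o_def)
      have "matrix (\<lambda>v. dird (exp_chart p) (A v) (A x)) = jac (A x) ** matrix A"
        unfolding jac_def using matrix_compose[OF A(1) linear_dird[OF dE]] by (simp add: o_def)
      then show "sqrt \<bar>(det (matrix A))\<^sup>2 * dens2 (A x)\<bar> =
        \<bar>det (matrix (\<lambda>v. dird (exp_chart p) (A v) (A x)))\<bar> * gram_density c ((exp_chart p \<circ> A) x)"
        by (simp add: dens2_def gram_density_def det_mul abs_mult real_sqrt_mult)
    qed
    finally show "vol M g (?exp ` A ` W) = (\<integral>\<^sup>+x\<in>W. ennreal (sqrt \<bar>(det (matrix A))\<^sup>2 * dens2 (A x)\<bar>) \<partial>lborel)" .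
  qed
  then show ?thesis using that e(2) exp0 by blast
qed

end

theorem theorem5p2:
  fixes M :: "('a::{t2_space, second_countable_topology}, 'n::finite) chart set"
    and g :: "('a, 'n) tensor2"
    and M' :: "('b::{t2_space, second_countable_topology}, 'n) chart set"
    and g' :: "('b, 'n) tensor2"
    and \<nu> :: nat
    and p :: 'a and p' :: 'b
    and L :: "real ^ 'n \<Rightarrow> real ^ 'n"
    and Vb :: "(real ^ 'n) set" and V :: "'a set"
    and F :: "'a \<Rightarrow> 'b"
    and \<xi> :: "real ^ 'n"
  assumes "CARD('n) \<ge> 2"
    and "semi_riemannian \<nu> M g"
    and "semi_riemannian \<nu> M' g'"
    and "linear_isometry (g p) (g' p') L"
    and "normal_nbhd_via M g p Vb V"
    and "L ` Vb \<subseteq> exp_dom M' g' p'"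
    and "F = geodesic_transfer M g p Vb L M' g' p'"
    and "normal_nbhd M' g' p' (F ` V)"
    and "\<bar>g p \<xi> \<xi>\<bar> = 1"
  shows "(ricci M g p \<xi> \<xi> > ricci M' g' p' (L \<xi>) (L \<xi>) \<longrightarrow>
            (\<forall>N. open N \<and> p \<in> N \<longrightarrow>
               (\<exists>W. normal_nbhd M g p W \<and> W \<subseteq> N \<and> W \<subseteq> V \<and>
                    vol M g W < vol M' g' (F ` W))))
       \<and> (ricci M g p \<xi> \<xi> < ricci M' g' p' (L \<xi>) (L \<xi>) \<longrightarrow>
            (\<forall>N. open N \<and> p \<in> N \<longrightarrow>
               (\<exists>W. normal_nbhd M g p W \<and> W \<subseteq> N \<and> W \<subseteq> V \<and>
                    vol M g W > vol M' g' (F ` W))))"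
proof -
  interpret S: semi_riemannian_manifold M g \<nu> by unfold_locales (fact assms(2))
  interpret S': semi_riemannian_manifold M' g' \<nu> by unfold_locales (fact assms(3))
  let ?exp = "exp_map M g p" and ?exp' = "exp_map M' g' p'"
  obtain Vb' where V': "normal_nbhd_via M' g' p' Vb' (F ` V)"
    using assms(8) by (auto simp: normal_nbhd_def)
  obtain e1 \<sigma> where e1: "ball 0 e1 \<subseteq> Vb" and exp0: "?exp 0 = p" and D: "S.squared_density p e1 \<sigma>"
    using S.squared_density_exists[OF assms(5)] by metis
  note \<sigma> = S.squared_densityD[OF D]
  obtain e2 \<sigma>' where D': "S'.squared_density p' e2 \<sigma>'"
    using S'.squared_density_exists[OF V'] by metis
  note \<sigma>' = S'.squared_densityD[OF D']
  have L: "linear L" "bij L" and iso: "\<And>v w. g' p' (L v) (L w) = g p v w"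
    using assms(4) by (auto simp: linear_isometry_def)
  have bL: "bounded_linear L" using L(1) linear_conv_bounded_linear by blast
  \<comment> \<open>The Jacobian of the isometry enters squared because \<open>\<tau>\<close> is a
    squared density, namely that of the second manifold pulled back along \<open>L\<close>.\<close>
  define k where "k = (det (matrix L))\<^sup>2"
  define \<tau> where "\<tau> x = k * \<sigma>' (L x)" for x
  \<comment> \<open>The isometry makes the Gram matrices at \<open>p\<close> and \<open>p'\<close>
    congruent through \<open>matrix L\<close>. The factor \<open>k\<close> therefore turns one
    determinant into the other, and the leading terms of the two densities coincide.\<close>
  have "(\<chi> i j. g p (axis i 1) (axis j 1)) = transpose (matrix L) ** (\<chi> i j. g' p' (axis i 1) (axis j 1)) ** matrix L"
    using bilinear_pullback_matrix[OF S'.metric(1) L(1), of p'] by (simp add: iso)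
  then have \<tau>0: "\<tau> 0 = \<sigma> 0"
    by (simp add: \<tau>_def \<sigma>(3) \<sigma>'(3) linear_0[OF L(1)] det_mul det_transpose k_def power2_eq_square)
  have "\<forall>\<^sub>F x in nhds 0. L x \<in> ball 0 e2"
    using linear_continuous_at[OF bL, of 0] \<sigma>'(1) linear_0[OF L(1)] tendsto_at_iff_tendsto_nhds[of L 0]
    by (intro topological_tendstoD[of L 0]) (auto simp: isCont_def)
  then obtain e3 where e3: "e3 > 0" "\<And>x. norm x < e3 \<Longrightarrow> L x \<in> ball 0 e2"
    unfolding eventually_nhds_metric by (auto simp: dist_norm)
  define e where "e = min e1 e3"
  have e: "e > 0" "ball 0 e \<subseteq> ball 0 e1" "L ` ball 0 e \<subseteq> ball 0 e2"
    using \<sigma>(1) e3 by (auto simp: e_def)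
  have d1: "\<sigma>' differentiable (at z)" and d2: "dird \<sigma>' u differentiable (at z)" if "z \<in> ball 0 e2" for z u
    using \<sigma>'(2) that by (auto simp: numeral_2_eq_2)
  have chain: "dird (\<lambda>x. k * f (L x)) v x = k * dird f (L v) (L x)" "(\<lambda>x. k * f (L x)) differentiable (at x)"
    if "f differentiable (at (L x))" for f :: "real ^ 'n \<Rightarrow> real" and v x
  proof -
    have "((\<lambda>x. k * f (L x)) has_derivative (\<lambda>v. k * dird f (L v) (L x))) (at x)"
      using diff_chain_at[OF bounded_linear_imp_has_derivative[OF bL] has_derivative_dird[OF that]]
      by (intro has_derivative_mult_right) (simp add: o_def)
    then show "dird (\<lambda>x. k * f (L x)) v x = k * dird f (L v) (L x)" "(\<lambda>x. k * f (L x)) differentiable (at x)"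
      by (auto simp: dird_eq differentiable_def)
  qed
  have C\<tau>: "Ck_on 2 (ball 0 e) \<tau>"
    unfolding \<tau>_def using e(3)
    by (intro Ck_on_mult Ck_on_const Ck_on_compose[OF _ _ _ \<sigma>'(2)] Ck_on_bounded_linear bL) auto
  have L0: "L 0 \<in> ball 0 e2" using \<sigma>'(1) linear_0[OF L(1)] by simp
  have \<tau>1: "dird \<tau> v 0 = 0" for v
    using chain(1)[OF d1[OF L0]] \<sigma>'(5) linear_0[OF L(1)] by (simp add: \<tau>_def[abs_def])
  have \<tau>2: "dird (dird \<tau> v) v 0 = - 2/3 * \<sigma> 0 * ricci M' g' p' (L v) (L v)" for v
  proof -
    have "dird (dird \<tau> v) v 0 = dird (\<lambda>x. k * dird \<sigma>' (L v) (L x)) v 0"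
    proof (rule dird_cong_open(1)[of "ball 0 e"])
      show "dird \<tau> v x = k * dird \<sigma>' (L v) (L x)" if "x \<in> ball 0 e" for x
        using chain(1)[OF d1[OF subsetD[OF e(3) imageI[OF that]]]] by (simp add: \<tau>_def[abs_def])
    qed (use e(1) C\<tau> in \<open>auto simp: numeral_2_eq_2\<close>)
    also have "\<dots> = k * dird (dird \<sigma>' (L v)) (L v) 0"
      using chain(1)[OF d2[OF L0]] linear_0[OF L(1)] by simp
    also have "\<dots> = - 2/3 * \<tau> 0 * ricci M' g' p' (L v) (L v)"
      by (simp add: \<sigma>'(6) \<tau>_def linear_0[OF L(1)])
    finally show ?thesis by (simp add: \<tau>0)
  qed
  have C\<sigma>e: "Ck_on 2 (ball 0 e) \<sigma>" using Ck_on_subset[OF \<sigma>(2) e(2)] .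
  \<comment> \<open>Each small starshaped \<open>Wb\<close> gives a normal neighbourhood of
    \<open>p\<close>. On it \<open>F\<close> undoes the exponential map, applies \<open>L\<close>
    and exponentiates at \<open>p'\<close>, which turns both volumes into integrals over
    \<open>Wb\<close>.\<close>
  have volumes: "\<exists>W. normal_nbhd M g p W \<and> W \<subseteq> N \<and> W \<subseteq> V \<and>
      vol M g W = (\<integral>\<^sup>+x\<in>Wb. ennreal (sqrt \<bar>\<sigma> x\<bar>) \<partial>lborel) \<and>
      vol M' g' (F ` W) = (\<integral>\<^sup>+x\<in>Wb. ennreal (sqrt \<bar>\<tau> x\<bar>) \<partial>lborel)"
    if Wb: "open Wb" "0 \<in> Wb" "\<And>v. v \<in> Wb \<Longrightarrow> closed_segment 0 v \<subseteq> Wb" "Wb \<subseteq> ball 0 e" "?exp ` Wb \<subseteq> N"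
    for Wb N
  proof (intro exI conjI)
    have sub: "Wb \<subseteq> Vb" using Wb(4) e(2) e1 by blast
    note r = S.normal_nbhd_via_restrict[OF assms(5) Wb(1) sub Wb(2,3)]
    show "normal_nbhd M g p (?exp ` Wb)" using r(1) by (auto simp: normal_nbhd_def)
    show "?exp ` Wb \<subseteq> N" by (fact Wb(5))
    show "?exp ` Wb \<subseteq> V" by (rule r(3))
    have "vol M g (?exp ` id ` Wb) = (\<integral>\<^sup>+x\<in>Wb. ennreal (sqrt \<bar>(det (matrix (id :: real ^ 'n \<Rightarrow> _)))\<^sup>2 * \<sigma> (id x)\<bar>) \<partial>lborel)"
      using Wb(1,4) e(2) by (intro \<sigma>(7)) (auto simp: linear_id)
    then show "vol M g (?exp ` Wb) = (\<integral>\<^sup>+x\<in>Wb. ennreal (sqrt \<bar>\<sigma> x\<bar>) \<partial>lborel)"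
      by (simp add: matrix_id)
    have "inj_on ?exp Vb" using assms(5) by (simp add: normal_nbhd_via_def diffeo_onto_def bij_betw_def)
    then have "F (?exp x) = ?exp' (L x)" if "x \<in> Wb" for x
      using that sub by (auto simp: assms(7) geodesic_transfer_def inv_into_f_f)
    then have "F ` ?exp ` Wb = ?exp' ` L ` Wb" by (simp add: image_image)
    then show "vol M' g' (F ` ?exp ` Wb) = (\<integral>\<^sup>+x\<in>Wb. ennreal (sqrt \<bar>\<tau> x\<bar>) \<partial>lborel)"
      using \<sigma>'(7)[OF L Wb(1) subset_trans[OF image_mono[OF Wb(4)] e(3)]] by (simp add: \<tau>_def k_def)
  qed
  have nbhd: "open (Vb \<inter> ?exp -` N)" "0 \<in> Vb \<inter> ?exp -` N" if N: "open N" "p \<in> N" for N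
  proof -
    have "continuous_on Vb ?exp" "open Vb" "0 \<in> Vb"
      using assms(5) by (auto simp: normal_nbhd_via_def diffeo_onto_def smooth_into_def)
    then show "open (Vb \<inter> ?exp -` N)" "0 \<in> Vb \<inter> ?exp -` N"
      using N exp0 by (auto intro: continuous_open_preimage)
  qed
  \<comment> \<open>Division by the common value removes the unknown sign of
    \<open>\<sigma> 0\<close>. The negative factor explains the reversal: larger Ricci curvature
    gives the smaller second derivative, hence the smaller volume.\<close>
  have q: "dird (dird \<sigma> \<xi>) \<xi> 0 / \<sigma> 0 = - 2/3 * ricci M g p \<xi> \<xi>"
    "dird (dird \<tau> \<xi>) \<xi> 0 / \<sigma> 0 = - 2/3 * ricci M' g' p' (L \<xi>) (L \<xi>)"
    using \<sigma>(4) by (simp_all add: \<sigma>(6) \<tau>2)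
  show ?thesis
  proof (intro conjI impI allI)
    fix N assume ric: "ricci M g p \<xi> \<xi> > ricci M' g' p' (L \<xi>) (L \<xi>)" and N: "open N \<and> p \<in> N"
    have "dird (dird \<sigma> \<xi>) \<xi> 0 / \<sigma> 0 < dird (dird \<tau> \<xi>) \<xi> 0 / \<sigma> 0" using ric by (simp add: q)
    from starshaped_integral_less[OF e(1) C\<sigma>e C\<tau> refl \<tau>0 \<sigma>(4) \<sigma>(5) \<tau>1 this nbhd[of N]] N
    obtain Wb where "open Wb" "0 \<in> Wb" "\<And>v. v \<in> Wb \<Longrightarrow> closed_segment 0 v \<subseteq> Wb" "Wb \<subseteq> Vb \<inter> ?exp -` N"
      "Wb \<subseteq> ball 0 e" "(\<integral>\<^sup>+x\<in>Wb. ennreal (sqrt \<bar>\<sigma> x\<bar>) \<partial>lborel) < (\<integral>\<^sup>+x\<in>Wb. ennreal (sqrt \<bar>\<tau> x\<bar>) \<partial>lborel)"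
      by blast
    with volumes[of Wb N]
    show "\<exists>W. normal_nbhd M g p W \<and> W \<subseteq> N \<and> W \<subseteq> V \<and> vol M g W < vol M' g' (F ` W)"
      by (metis (no_types, lifting) Int_subset_iff image_subset_iff_subset_vimage)
  next
    fix N assume ric: "ricci M g p \<xi> \<xi> < ricci M' g' p' (L \<xi>) (L \<xi>)" and N: "open N \<and> p \<in> N"
    have "dird (dird \<tau> \<xi>) \<xi> 0 / \<sigma> 0 < dird (dird \<sigma> \<xi>) \<xi> 0 / \<sigma> 0" using ric by (simp add: q)
    from starshaped_integral_less[OF e(1) C\<tau> C\<sigma>e \<tau>0 refl \<sigma>(4) \<tau>1 \<sigma>(5) this nbhd[of N]] N
    obtain Wb where "open Wb" "0 \<in> Wb" "\<And>v. v \<in> Wb \<Longrightarrow> closed_segment 0 v \<subseteq> Wb" "Wb \<subseteq> Vb \<inter> ?exp -` N"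
      "Wb \<subseteq> ball 0 e" "(\<integral>\<^sup>+x\<in>Wb. ennreal (sqrt \<bar>\<tau> x\<bar>) \<partial>lborel) < (\<integral>\<^sup>+x\<in>Wb. ennreal (sqrt \<bar>\<sigma> x\<bar>) \<partial>lborel)"
      by blast
    with volumes[of Wb N]
    show "\<exists>W. normal_nbhd M g p W \<and> W \<subseteq> N \<and> W \<subseteq> V \<and> vol M g W > vol M' g' (F ` W)"
      by (metis (no_types, lifting) Int_subset_iff image_subset_iff_subset_vimage)
  qed
qed

end
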